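(* Let $A\in\mathbb{C}^{n\times n}$, $1\le k<(n+1)/2$, and let $p=[p_0:p_1:p_2]\in\mathbb{P}^2(\mathbb{R})$ be a point of $\mathcal{V}(f_A)$ with $-p_0=\lambda_k(p_1,p_2)=\lambda_{n-k+1}(p_1,p_2)$. Then $\Lambda_k(A)$ is the convex hull of its elements $a+ib$ for which the line $t+ax+by=0$ is $p$-tangent: $$\Lambda_k(A)=\operatorname{conv}\big(\{a+ib\in\Lambda_k(A): t+ax+by=0\text{ is }p\text{-tangent to }\mathcal{V}(f_A)\}\big).$$
   Context: For $A\in\mathbb{C}^{n\times n}$ put $\Re(A)=\frac12(A+A^* )$, $\Im(A)=\frac{1}{2i}(A-A^* )$, and let $f_A=\det(tI_n+x\Re(A)+y\Im(A))\in\mathbb{R}[t,x,y]$ be the Kippenhahn polynomial, with zero set $\mathcal{V}(f_A)\subset\mathbb{P}^2(\mathbb{C})$. Let $f_A^{\rm red}$ be its square-free part (product of the distinct irreducible factors). For a Hermitian $n\times n$ matrix $M$, $\lambda_1(M)\ge\dots\ge\lambda_n(M)$ are its eigenvalues with multiplicity, and $\lambda_j(x,y)=\lambda_j(x\Re(A)+y\Im(A))$ for $(x,y)\in\mathbb{R}^2$. (The condition $-p_0=\lambda_k(p_1,p_2)=\lambda_{n-k+1}(p_1,p_2)$ is invariant under real rescaling of $(p_0,p_1,p_2)$ since $\lambda_k(-x,-y)=-\lambda_{n-k+1}(x,y)$.) The rank-$k$ numerical range is $\Lambda_k(A)=\{\mu\in\mathbb{C}: \exists X\in\mathbb{C}^{n\times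 k} \text{ with } X^*X=I_k,\ X^*AX=\mu I_k\}$. Elements $a+ib$ are written with $a,b\in\mathbb{R}$. $p$-tangent lines: let $p\in\mathcal{V}(f_A)$ and let $d\ge1$ be the multiplicity of $f_A^{\rm red}$ at $p$, i.e. the largest $d$ such that $r^d$ divides $f_A^{\rm red}(rq+sp)\in\mathbb{C}[r,s]$ for every $q\in\mathbb{C}^3$. A line through $p$, written $\{[rq+sp]:[r:s]\in\mathbb{P}^1(\mathbb{C})\}$ with $q\in\mathbb{C}^3$ not a multiple of $p$, is $p$-tangent to $\mathcal{V}(f_A)$ if one of the following holds: (I) $f_A^{\rm red}(rq+sp)=r^d\cdot\ell^2\cdot h$ for some linear form $\ell\in\mathbb{C}[r,s]_1$ and some $h\in\mathbb{C}[r,s]$; or (II) $f_A^{\rm red}(rq+sp)=r^{d+1}\cdot h$ for some $h\in\mathbb{C}[r,s]$. (Here $h=0$ is allowed.) *)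

theory Defs
  imports
    "HOL-Analysis.Convex"
    "HOL-Computational_Algebra.Field_as_Ring"
    "HOL-Computational_Algebra.Polynomial_Factorial"
    "Jordan_Normal_Form.Schur_Decomposition"
begin

subsection \<open>Hermitian matrices and their ordered eigenvalues\<close>

definition re_mat :: "complex mat \<Rightarrow> complex mat" where
  "re_mat A = (1 / 2) \<cdot>\<^sub>m (A + mat_adjoint A)"

definition im_mat :: "complex mat \<Rightarrow> complex mat" where
  "im_mat A = (1 / (2 * \<i>)) \<cdot>\<^sub>m (A - mat_adjoint A)"

lemma mat_adjoint_dim [simp]:
  "dim_row (mat_adjoint A) = dim_col A" "dim_col (mat_adjoint A) = dim_row A"
  unfolding mat_adjoint_def by auto

lemma mat_adjoint_index [simp]:
  fixes A :: "complex mat"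
  assumes "i < dim_col A" "j < dim_row A"
  shows "mat_adjoint A $$ (i, j) = cnj (A $$ (j, i))"
  using assms unfolding mat_adjoint_def by (simp add: mat_of_rows_index)

lemma re_im_mat_carrier [simp]:
  assumes "A \<in> carrier_mat n n"
  shows "re_mat A \<in> carrier_mat n n" "im_mat A \<in> carrier_mat n n"
  using assms unfolding re_mat_def im_mat_def by auto

lemma re_im_mat_cnj:
  assumes "A \<in> carrier_mat n n" "i < n" "j < n"
  shows "cnj (re_mat A $$ (i, j)) = re_mat A $$ (j, i)"
    and "cnj (im_mat A $$ (i, j)) = im_mat A $$ (j, i)"
  using assms unfolding re_mat_def im_mat_def by (auto simp: field_simps)

lemma mat_adjoint_re_im_mat:
  assumes "A \<in> carrier_mat n n"
  shows "mat_adjoint (re_mat A) = re_mat A" "mat_adjoint (im_mat A) = im_mat A"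
  using re_im_mat_cnj[OF assms] re_im_mat_carrier[OF assms] by (auto intro!: eq_matI)

lemma pencil_hermitian:
  assumes "A \<in> carrier_mat n n"
  defines "M x y \<equiv> complex_of_real x \<cdot>\<^sub>m re_mat A + complex_of_real y \<cdot>\<^sub>m im_mat A"
  shows "M x y \<in> carrier_mat n n" "mat_adjoint (M x y) = M x y"
  using re_im_mat_cnj[OF assms(1)] re_im_mat_carrier[OF assms(1)]
  by (auto intro!: eq_matI simp: M_def)

text \<open>The list \<open>[\<lambda>\<^sub>1(M), \<dots>, \<lambda>\<^sub>n(M)]\<close> in weakly decreasing order, each eigenvalue repeated
  according to its multiplicity. It is only meaningful for Hermitian \<open>M\<close>; see the lemma
  \<open>eigenvalue_list_hermitian\<close> below for existence and uniqueness.\<close>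

definition eigenvalue_list :: "complex mat \<Rightarrow> real list" where
  "eigenvalue_list M = (THE es. sorted_wrt (\<ge>) es \<and>
     char_poly M = (\<Prod>e\<leftarrow>es. [:- complex_of_real e, 1:]))"

lemma hermitian_eigenvalue_real:
  fixes M :: "complex mat"
  assumes M: "M \<in> carrier_mat n n" and herm: "mat_adjoint M = M" and e: "eigenvalue M e"
  shows "e \<in> \<real>"
proof -
  from e obtain v where v: "v \<in> carrier_vec n" "v \<noteq> 0\<^sub>v n" "M *\<^sub>v v = e \<cdot>\<^sub>v v"
    using M unfolding eigenvalue_def eigenvector_def by auto
  define s where "s = (\<Sum>i<n. v $ i * cnj (v $ i))"
  have row: "(\<Sum>j<n. M $$ (i, j) * v $ j) = e * v $ i" if "i < n" for i
  proof -
    have "(M *\<^sub>v v) $ i = (\<Sum>j<n. M $$ (i, j) * v $ j)"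
      using that M v(1) by (simp add: scalar_prod_def lessThan_atLeast0)
    thus ?thesis using v that by simp
  qed
  have sym: "M $$ (i, j) = cnj (M $$ (j, i))" if "i < n" "j < n" for i j
    using that M herm mat_adjoint_index[of i M j] by auto
  have "e * s = (\<Sum>i<n. (\<Sum>j<n. M $$ (i, j) * v $ j) * cnj (v $ i))"
    unfolding s_def by (simp add: row sum_distrib_left mult.assoc)
  also have "\<dots> = (\<Sum>i<n. \<Sum>j<n. M $$ (i, j) * v $ j * cnj (v $ i))"
    by (simp add: sum_distrib_right)
  also have "\<dots> = (\<Sum>j<n. \<Sum>i<n. M $$ (i, j) * v $ j * cnj (v $ i))"
    by (rule sum.swap)
  also have "\<dots> = (\<Sum>j<n. cnj (\<Sum>i<n. M $$ (j, i) * v $ i) * v $ j)"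
    unfolding cnj_sum sum_distrib_right
    by (intro sum.cong refl) (subst sym, auto simp: mult_ac)
  also have "\<dots> = (\<Sum>j<n. cnj (e * v $ j) * v $ j)"
    by (intro sum.cong refl) (simp only: row lessThan_iff)
  also have "\<dots> = cnj e * s"
    unfolding s_def by (simp add: sum_distrib_left mult_ac)
  finally have eq: "e * s = cnj e * s" .
  have s: "s = complex_of_real (\<Sum>i<n. (cmod (v $ i))\<^sup>2)"
    unfolding s_def by (simp add: complex_norm_square [symmetric])
  have "s \<noteq> 0"
  proof
    assume "s = 0"
    hence "(\<Sum>i<n. (cmod (v $ i))\<^sup>2) = 0" using s by (metis of_real_eq_0_iff)
    hence "\<forall>i<n. v $ i = 0" by (subst (asm) sum_nonneg_eq_0_iff) auto
    hence "v = 0\<^sub>v n" using v(1) by (intro eq_vecI) auto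
    thus False using v by simp
  qed
  with eq have "cnj e = e" by simp
  thus ?thesis by (simp add: Reals_cnj_iff)
qed

lemma eigenvalue_list_unique:
  fixes es fs :: "real list"
  assumes "sorted_wrt (\<ge>) es" "sorted_wrt (\<ge>) fs"
    and eq: "(\<Prod>e\<leftarrow>es. [:- complex_of_real e, 1:]) = (\<Prod>e\<leftarrow>fs. [:- complex_of_real e, 1:])"
  shows "es = fs"
proof -
  have ord: "order (complex_of_real a) (\<Prod>e\<leftarrow>xs. [:- complex_of_real e, 1:]) = count (mset xs) a"
    for xs :: "real list" and a
  proof (induction xs)
    case (Cons x xs)
    have nz: "(\<Prod>e\<leftarrow>xs. [:- complex_of_real e, 1:]) \<noteq> 0" by (auto simp: prod_list_zero_iff)
    have "order (complex_of_real a) [:- complex_of_real x, 1:] = (if a = x then 1 else 0)"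
      using order_power_n_n[of "complex_of_real a" 1] by (auto simp: order_0I)
    thus ?case using Cons nz by (simp add: order_mult del: mult_pCons_left)
  qed simp
  have "mset es = mset fs" using ord[of _ es] ord[of _ fs] eq by (intro multiset_eqI) metis
  hence "mset (rev es) = mset (rev fs)" by simp
  moreover have "sorted (rev es)" "sorted (rev fs)" using assms(1,2) by (simp_all add: sorted_wrt_rev)
  ultimately show ?thesis by (metis properties_for_sort rev_rev_ident)
qed

lemma eigenvalue_list_hermitian:
  fixes M :: "complex mat"
  assumes M: "M \<in> carrier_mat n n" and herm: "mat_adjoint M = M"
  shows "sorted_wrt (\<ge>) (eigenvalue_list M)"
    and "char_poly M = (\<Prod>e\<leftarrow>eigenvalue_list M. [:- complex_of_real e, 1:])"
    and "length (eigenvalue_list M) = n"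
proof -
  obtain as where as: "char_poly M = (\<Prod>a\<leftarrow>as. [:- a, 1:])"
    using char_poly_factorized[OF M] by blast
  have real: "complex_of_real (Re a) = a" if "a \<in> set as" for a
  proof -
    have "poly (char_poly M) a = 0" using that unfolding as by (auto simp: poly_prod_list prod_list_zero_iff)
    hence "a \<in> \<real>" using hermitian_eigenvalue_real[OF M herm] eigenvalue_root_char_poly[OF M] by blast
    thus ?thesis by simp
  qed
  define es where "es = rev (sort (map Re as))"
  have s: "sorted_wrt (\<ge>) es" unfolding es_def by (simp add: sorted_wrt_rev)
  have ms: "mset (map complex_of_real es) = mset as"
  proof -
    have "mset (map complex_of_real es) = mset (map complex_of_real (map Re as))"
      unfolding es_def by (simp only: mset_map mset_rev mset_sort)
    also have "map complex_of_real (map Re as) = as" using real by (auto intro: map_idI)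
    finally show ?thesis .
  qed
  have c: "char_poly M = (\<Prod>e\<leftarrow>es. [:- complex_of_real e, 1:])"
  proof -
    have "(\<Prod>a\<leftarrow>as. [:- a, 1:]) = prod_mset (image_mset (\<lambda>a. [:- a, 1:]) (mset as))"
      by (metis mset_map prod_mset_prod_list)
    also have "\<dots> = prod_mset (mset (map (\<lambda>a. [:- a, 1:]) (map complex_of_real es)))"
      using ms by (metis mset_map)
    also have "\<dots> = (\<Prod>e\<leftarrow>es. [:- complex_of_real e, 1:])"
      by (simp only: prod_mset_prod_list map_map o_def)
    finally show ?thesis using as by simp
  qed
  have "eigenvalue_list M = es" unfolding eigenvalue_list_def
    using s c by (intro the_equality) (auto intro!: eigenvalue_list_unique)
  thus "sorted_wrt (\<ge>) (eigenvalue_list M)"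
    and p: "char_poly M = (\<Prod>e\<leftarrow>eigenvalue_list M. [:- complex_of_real e, 1:])"
    using s c by auto
  have "degree (\<Prod>e\<leftarrow>xs. [:- complex_of_real e, 1:]) = length xs" for xs :: "real list"
  proof (induction xs)
    case (Cons x xs)
    have "(\<Prod>e\<leftarrow>xs. [:- complex_of_real e, 1:]) \<noteq> 0" by (auto simp: prod_list_zero_iff)
    thus ?case using Cons by (simp add: degree_mult_eq del: mult_pCons_left)
  qed simp
  thus "length (eigenvalue_list M) = n" using p degree_monic_char_poly[OF M] by metis
qed

text \<open>One-based, as in \<open>\<lambda>\<^sub>1 \<ge> \<dots> \<ge> \<lambda>\<^sub>n\<close>.\<close>

definition eigval :: "nat \<Rightarrow> complex mat \<Rightarrow> real" where
  "eigval j M = eigenvalue_list M ! (j - 1)"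

definition pencil_eigval :: "complex mat \<Rightarrow> nat \<Rightarrow> real \<Rightarrow> real \<Rightarrow> real" where
  "pencil_eigval A j x y =
     eigval j (complex_of_real x \<cdot>\<^sub>m re_mat A + complex_of_real y \<cdot>\<^sub>m im_mat A)"

definition rank_numerical_range :: "nat \<Rightarrow> complex mat \<Rightarrow> complex set" where
  "rank_numerical_range k A = {\<mu>. \<exists>X \<in> carrier_mat (dim_row A) k.
     mat_adjoint X * X = 1\<^sub>m k \<and> mat_adjoint X * A * X = \<mu> \<cdot>\<^sub>m 1\<^sub>m k}"


subsection \<open>The Kippenhahn polynomial\<close>

text \<open>A polynomial ring in \<open>t, x, y\<close> is represented as an iterated univariate polynomial ring, with
  \<open>t\<close> the outermost and \<open>y\<close> the innermost indeterminate.\<close>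

definition kippenhahn_det :: "complex mat \<Rightarrow> complex poly poly poly" where
  "kippenhahn_det A =
     (let t = [:0, 1:]; x = [:[:0, 1:]:]; y = [:[:[:0, 1:]:]:]; const = map_mat (\<lambda>c. [:[:[:c:]:]:])
      in det (t \<cdot>\<^sub>m 1\<^sub>m (dim_row A) + x \<cdot>\<^sub>m const (re_mat A) + y \<cdot>\<^sub>m const (im_mat A)))"

text \<open>The determinant has real coefficients (lemma \<open>kippenhahn_poly_complexify\<close>), so that \<open>Re\<close> merely
  regards it as an element of \<open>\<real>[t, x, y]\<close>.\<close>

definition kippenhahn_poly :: "complex mat \<Rightarrow> real poly poly poly" where
  "kippenhahn_poly A = map_poly (map_poly (map_poly Re)) (kippenhahn_det A)"

lemma kippenhahn_poly_complexify:
  assumes A: "A \<in> carrier_mat n n"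
  shows "map_poly (map_poly (map_poly complex_of_real)) (kippenhahn_poly A) = kippenhahn_det A"
proof -
  interpret c: comm_ring_hom cnj by unfold_locales auto
  interpret c1: map_poly_comm_ring_hom cnj ..
  interpret c2: map_poly_comm_ring_hom "map_poly cnj" ..
  interpret c3: map_poly_comm_ring_hom "map_poly (map_poly cnj)" ..
  define const :: "complex mat \<Rightarrow> complex poly poly poly mat"
    where "const = map_mat (\<lambda>c. [:[:[:c:]:]:])"
  define K where "K = [:0, 1:] \<cdot>\<^sub>m 1\<^sub>m n + [:[:0, 1:]:] \<cdot>\<^sub>m const (re_mat A) + [:[:[:0, 1:]:]:] \<cdot>\<^sub>m const (im_mat A)"
  have K: "K \<in> carrier_mat n n" using re_im_mat_carrier[OF A] unfolding K_def const_def by auto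
  have det: "kippenhahn_det A = det K"
    using A unfolding kippenhahn_det_def K_def const_def Let_def by auto
  have "map_mat (map_poly (map_poly (map_poly cnj))) K = transpose_mat K"
    using re_im_mat_carrier[OF A] re_im_mat_cnj[OF A]
    by (intro eq_matI)
       (auto simp: K_def const_def c.map_poly_pCons_hom c1.map_poly_pCons_hom c2.map_poly_pCons_hom)
  hence inv: "map_poly (map_poly (map_poly cnj)) (det K) = det K"
    using c3.hom_det[of K] det_transpose[OF K] by simp
  have "cnj (coeff (coeff (coeff (det K) i) j) k) = coeff (coeff (coeff (det K) i) j) k" for i j k
    by (subst (2) inv [symmetric]) (simp add: coeff_map_poly)
  hence "coeff (coeff (coeff (det K) i) j) k = complex_of_real (Re (coeff (coeff (coeff (det K) i) j) k))" for i j k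
    by (metis complex_cnj_cancel_iff of_real_Re Reals_cnj_iff)
  thus ?thesis unfolding kippenhahn_poly_def det
    by (intro poly_eqI) (simp add: coeff_map_poly)
qed

text \<open>The irreducible factors are normalised, so this is determined up to a nonzero real constant,
  which is irrelevant for everything below.\<close>

definition squarefree_red :: "real poly poly poly \<Rightarrow> real poly poly poly" where
  "squarefree_red f = \<Prod>(prime_factors f)"

text \<open>Substitution of a triple for \<open>(t, x, y)\<close>, where the coefficients are mapped along \<open>\<phi>\<close>.\<close>

definition subst3 ::
  "(real \<Rightarrow> 'a::comm_semiring_1) \<Rightarrow> real poly poly poly \<Rightarrow> 'a \<times> 'a \<times> 'a \<Rightarrow> 'a" where
  "subst3 \<phi> f = (\<lambda>(t, x, y).
     poly (map_poly (\<lambda>g. poly (map_poly (\<lambda>c. poly (map_poly \<phi> c) y) g) x) f) t)"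

lemma subst3_kippenhahn_poly:
  assumes A: "A \<in> carrier_mat n n"
  shows "subst3 complex_of_real (kippenhahn_poly A) (t, x, y) =
         det (t \<cdot>\<^sub>m 1\<^sub>m n + x \<cdot>\<^sub>m re_mat A + y \<cdot>\<^sub>m im_mat A)"
proof -
  define ev where "ev = (\<lambda>f. poly (map_poly (\<lambda>g. poly (map_poly (\<lambda>c. poly c y) g) x) f) t)"
  interpret e1: comm_ring_hom "\<lambda>c. poly c y" by unfold_locales auto
  interpret m1: map_poly_comm_ring_hom "\<lambda>c. poly c y" ..
  interpret e2: comm_ring_hom "\<lambda>g. poly (map_poly (\<lambda>c. poly c y) g) x"
    by unfold_locales (auto simp: m1.hom_add m1.hom_mult)
  interpret m2: map_poly_comm_ring_hom "\<lambda>g. poly (map_poly (\<lambda>c. poly c y) g) x" ..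
  interpret e3: comm_ring_hom ev
    unfolding ev_def by unfold_locales (auto simp: m2.hom_add m2.hom_mult)
  have "subst3 complex_of_real (kippenhahn_poly A) (t, x, y) =
        ev (map_poly (map_poly (map_poly complex_of_real)) (kippenhahn_poly A))"
    unfolding subst3_def ev_def by (simp add: map_poly_map_poly o_def)
  also have "\<dots> = ev (kippenhahn_det A)" by (simp only: kippenhahn_poly_complexify[OF A])
  also have "\<dots> = det (t \<cdot>\<^sub>m 1\<^sub>m n + x \<cdot>\<^sub>m re_mat A + y \<cdot>\<^sub>m im_mat A)"
    using A re_im_mat_carrier[OF A] carrier_matD[OF re_im_mat_carrier(1)[OF A]]
      carrier_matD[OF re_im_mat_carrier(2)[OF A]]
    unfolding kippenhahn_det_def Let_def e3.hom_det [symmetric]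
    by (intro arg_cong[of _ _ det] eq_matI)
       (auto simp: ev_def poly_hom.map_poly_pCons_hom e2.map_poly_pCons_hom)
  finally show ?thesis .
qed


subsection \<open>Points and lines of the complex projective plane\<close>

text \<open>A point of the projective plane is given by homogeneous coordinates, i.e. by a nonzero triple;
  a line is given by the two-dimensional subspace of \<open>\<complex>\<^sup>3\<close> of all coordinate vectors of its points
  (together with zero). The zero set below consists of all coordinate vectors of the points
  of the curve.\<close>

definition kippenhahn_curve :: "complex mat \<Rightarrow> (complex \<times> complex \<times> complex) set" where
  "kippenhahn_curve A = {p. p \<noteq> (0, 0, 0) \<and> subst3 complex_of_real (kippenhahn_poly A) p = 0}"

definition lincomb3 ::
  "'a::comm_semiring_1 \<Rightarrow> 'a \<times> 'a \<times> 'a \<Rightarrow> 'a \<Rightarrow> 'a \<times> 'a \<times> 'a \<Rightarrow> 'a \<times> 'a \<times> 'a" where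
  "lincomb3 r q s p = (case (q, p) of ((q0, q1, q2), (p0, p1, p2)) \<Rightarrow>
     (r * q0 + s * p0, r * q1 + s * p1, r * q2 + s * p2))"

definition dual_line :: "real \<Rightarrow> real \<Rightarrow> (complex \<times> complex \<times> complex) set" where
  "dual_line a b = {(t, x, y). t + complex_of_real a * x + complex_of_real b * y = 0}"


subsection \<open>\<open>p\<close>-tangent lines\<close>

text \<open>The ring \<open>\<complex>[r, s]\<close> is \<^typ>\<open>complex poly poly\<close> with outer indeterminate \<open>r\<close> and inner
  indeterminate \<open>s\<close>.\<close>

definition const_rs :: "complex \<Rightarrow> complex poly poly" where
  "const_rs c = [:[:c:]:]"

definition var_r :: "complex poly poly" where
  "var_r = [:0, 1:]"

definition var_s :: "complex poly poly" where
  "var_s = [:[:0, 1:]:]"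

text \<open>The polynomial \<open>f(rq + sp)\<close>.\<close>

definition line_restr :: "real poly poly poly \<Rightarrow> complex \<times> complex \<times> complex \<Rightarrow>
    complex \<times> complex \<times> complex \<Rightarrow> complex poly poly" where
  "line_restr f q p = subst3 (\<lambda>c. const_rs (complex_of_real c)) f
     (lincomb3 var_r (map_prod const_rs (map_prod const_rs const_rs) q)
               var_s (map_prod const_rs (map_prod const_rs const_rs) p))"

text \<open>For \<open>f \<noteq> 0\<close> the exponents in question are bounded, since \<open>r\<^sup>d\<close> with \<open>d\<close> larger than the degree
  of \<open>f\<close> can only divide every \<open>f(rq + sp)\<close> if these all vanish.\<close>

definition mult_at :: "real poly poly poly \<Rightarrow> complex \<times> complex \<times> complex \<Rightarrow> nat" where
  "mult_at f p = (GREATEST d. \<forall>q. var_r ^ d dvd line_restr f q p)"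

definition linear_form :: "complex poly poly \<Rightarrow> bool" where
  "linear_form l \<longleftrightarrow> (\<exists>\<alpha> \<beta>. l = const_rs \<alpha> * var_r + const_rs \<beta> * var_s)"

definition p_tangent ::
  "complex mat \<Rightarrow> complex \<times> complex \<times> complex \<Rightarrow> (complex \<times> complex \<times> complex) set \<Rightarrow> bool" where
  "p_tangent A p L \<longleftrightarrow>
     (let f = squarefree_red (kippenhahn_poly A); d = mult_at f p in
      \<exists>q. (\<nexists>c. q = lincomb3 0 p c p) \<and> L = {lincomb3 r q s p | r s. True} \<and>
        ((\<exists>l h. linear_form l \<and> line_restr f q p = var_r ^ d * l ^ 2 * h) \<or>
         (\<exists>h. line_restr f q p = var_r ^ (d + 1) * h)))"

end

(*
  The rank-k numerical range is the set of all a + ib such that a x + b y <= lambda_k(x, y) for all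
  real x, y (Li and Sze). For this one shows that a pencil xH + yG of Hermitian forms, all of whose
  members are nonnegative on some k-dimensional subspace, has a common isotropic subspace of dimension
  k. If some member F of the pencil is not positive on any k-dimensional subspace, then F has a kernel
  vector that is isotropic for the whole pencil, and one passes to its orthogonal complement.
  Otherwise H is replaced by H - cE and by H + cE, with c as large as possible, which produces two
  k-dimensional subspaces on which G vanishes and H is positive and negative, respectively; in their sum,
  an isotropic vector satisfying G(., v) = z H(., v) again lowers the dimension.

  So the rank-k numerical range is compact and convex, and it is the convex hull of its extreme points.
  The hypothesis on p means that the form p_0 + p_1 Re A + p_2 Im A is neither positive nor negative on
  any k-dimensional subspace, which puts the range on the line dual to p. Let a + ib be an extreme point
  of this segment, and consider the pencil G + xH of the forms belonging to the points q + xp of the line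
  t + ax + by = 0. Its k-th eigenvalue is nonnegative and has infimum 0, for one of the two
  directions of q. If the infimum is attained at x_0, then x_0 is a double root of the restriction of
  the square-free part, since near a simple root the eigenvalue would be strictly monotone (case I). If it
  is approached for x tending to infinity, then the lowest homogeneous part at p vanishes on the
  line (case II).
*)
theory Submission
  imports
    Defs
    "HOL-Analysis.Polytope"
    "HOL-Library.Function_Algebras"
    "Jordan_Normal_Form.Spectral_Radius"
begin

unbundle no vec_syntax

subsection \<open>Subspaces of finite dimension\<close>

text \<open>Nonnegativity of the k-th largest eigenvalue is encoded by a k-dimensional subspace on
  which the form is nonnegative (\<open>has_nonneg\<close>). This survives the passage to smaller
  subspaces that drives the induction on k, which would require new coordinates for matrices; hence
  abstract forms with a positive definite reference form E. The negation is again a subspace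
  condition, negative definiteness in dimension n - k + 1, and it is stable under small
  perturbations. This is the source of the limit arguments. If all nonzero members of the pencil are
  positive on k-dimensional subspaces, none of them offers a kernel vector. Subtracting cE with the
  largest admissible c creates one, but the subspace found then satisfies H = cE instead of H = 0;
  the mirror image on the negative side is what permits the return to 0. The square-free part is
  given only as a product of prime factors. It is handled through two divisibilities: it divides f,
  and f divides one of its powers. They carry zeros and, on each line, homogeneity over from the
  determinant.\<close>

locale complex_vector_space = vector_space scale
  for scale :: "complex \<Rightarrow> 'v::ab_group_add \<Rightarrow> 'v" (infixr "*\<^sub>C" 75)
begin

text \<open>A relation instead of the function \<open>dim\<close>, which is 0 also for
  infinite-dimensional subspaces: one fact certifies finiteness, the subspace property and the
  dimension.\<close>

definition has_dim :: "'v set \<Rightarrow> nat \<Rightarrow> bool" where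
  "has_dim S n \<longleftrightarrow> (\<exists>B. finite B \<and> independent B \<and> card B = n \<and> span B = S)"

lemma has_dim_subspace: "has_dim S n \<Longrightarrow> subspace S"
  unfolding has_dim_def by auto

lemma has_dim_unique:
  assumes "has_dim S m" "has_dim S n"
  shows "m = n"
  using assms unfolding has_dim_def by (metis basis_card_eq_dim order_refl span_superset)

lemma has_dim_0_iff [simp]: "has_dim S 0 \<longleftrightarrow> S = {0}"
proof
  show "S = {0} \<Longrightarrow> has_dim S 0"
    unfolding has_dim_def by (intro exI[of _ "{}"]) (simp add: independent_empty)
qed (auto simp: has_dim_def card_eq_0_iff)

lemma has_dim_subset:
  assumes "subspace T" "T \<subseteq> S" "has_dim S n"
  obtains m where "m \<le> n" "has_dim T m"
proof -
  obtain B where B: "finite B" "card B = n" "span B = S"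
    using assms(3) unfolding has_dim_def by auto
  obtain C where C: "C \<subseteq> T" "independent C" "T \<subseteq> span C"
    using maximal_independent_subset .
  have "finite C \<and> card C \<le> card B"
    by (rule independent_span_bound) (use B C assms in auto)
  moreover have "span C = T" using C assms(1) by (simp add: span_subspace)
  ultimately show thesis using that[of "card C"] C B unfolding has_dim_def by auto
qed

lemma span_Un_span: "span (S \<union> span T) = span (S \<union> T)"
proof (rule subset_antisym; rule span_minimal)
  show "S \<union> span T \<subseteq> span (S \<union> T)"
    using span_mono[of T "S \<union> T"] span_superset[of "S \<union> T"] by blast
  show "S \<union> T \<subseteq> span (S \<union> span T)"
    using span_superset[of T] span_superset[of "S \<union> span T"] by blast
qed auto

lemma has_dim_insert:
  assumes "has_dim T m" "s \<notin> T"
  shows "has_dim (span (insert s T)) (Suc m)"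
proof -
  obtain B where B: "finite B" "independent B" "card B = m" "span B = T"
    using assms(1) unfolding has_dim_def by auto
  have "s \<notin> B" using B assms(2) span_base by auto
  moreover have "independent (insert s B)" using B assms(2) by (simp add: independent_insertI)
  moreover have "span (insert s B) = span (insert s T)"
    using span_Un_span[of "{s}" B] B(4) by simp
  ultimately show ?thesis using B unfolding has_dim_def
    by (intro exI[of _ "insert s B"]) auto
qed

lemma has_dim_Suc:
  assumes "has_dim S (Suc n)"
  obtains s where "s \<in> S" "s \<noteq> 0"
proof -
  have "S \<noteq> {0}" using assms has_dim_unique[of S 0 "Suc n"] by auto
  then show thesis using that subspace_0[OF has_dim_subspace[OF assms]] by blast
qed

lemma has_dim_smaller:
  assumes "has_dim S n" "m \<le> n"
  obtains T where "T \<subseteq> S" "has_dim T m"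
proof -
  obtain B where B: "finite B" "independent B" "card B = n" "span B = S"
    using assms(1) unfolding has_dim_def by auto
  obtain C where C: "C \<subseteq> B" "card C = m" using B assms(2) by (metis obtain_subset_with_card_n)
  have "finite C" "independent C" using B C independent_mono[OF B(2) C(1)] by (auto intro: finite_subset)
  then have "has_dim (span C) m" unfolding has_dim_def using C by (intro exI[of _ C]) auto
  moreover have "span C \<subseteq> S" using span_mono[OF C(1)] B by simp
  ultimately show thesis using that by blast
qed

lemma has_dim_mono:
  assumes "T \<subseteq> S" "has_dim T m" "has_dim S n"
  shows "m \<le> n"
  using has_dim_subset[OF has_dim_subspace[OF assms(2)] assms(1,3)] has_dim_unique[OF assms(2)]
  by metis

lemma has_dim_eq:
  assumes "T \<subseteq> S" "has_dim T n" "has_dim S n"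
  shows "T = S"
proof (rule ccontr)
  assume "T \<noteq> S"
  then obtain s where s: "s \<in> S" "s \<notin> T" using assms(1) by auto
  have "span (insert s T) \<subseteq> S"
    using s assms(1) has_dim_subspace[OF assms(3)] by (intro span_minimal) auto
  from has_dim_mono[OF this has_dim_insert[OF assms(2) s(2)] assms(3)] show False by simp
qed

lemma span_insert_subspace:
  assumes "subspace T"
  shows "span (insert s T) = {c *\<^sub>C s + t | c t. t \<in> T}"
proof
  show "span (insert s T) \<subseteq> {c *\<^sub>C s + t | c t. t \<in> T}"
  proof
    fix x assume "x \<in> span (insert s T)"
    then obtain c where "x - c *\<^sub>C s \<in> span T" using span_breakdown_eq by blast
    then have "x - c *\<^sub>C s \<in> T" using assms by (metis span_eq_iff)
    then show "x \<in> {c *\<^sub>C s + t | c t. t \<in> T}"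
      by (intro CollectI exI[of _ c] exI[of _ "x - c *\<^sub>C s"]) auto
  qed
  show "{c *\<^sub>C s + t | c t. t \<in> T} \<subseteq> span (insert s T)"
    by (auto intro!: span_add span_scale intro: span_base)
qed

lemma span_Un_subspace:
  assumes "subspace S" "subspace T"
  shows "span (S \<union> T) = {s + t | s t. s \<in> S \<and> t \<in> T}"
  using assms by (simp add: span_Un) (simp add: span_eq_iff[THEN iffD2])

text \<open>A linear functional costs at most one dimension. The inequality includes the case that
  it vanishes on S, so that users need no case distinction.\<close>

lemma has_dim_hyperplane:
  fixes \<phi> :: "'v \<Rightarrow> complex"
  assumes S: "has_dim S n"
    and add: "\<And>x y. \<phi> (x + y) = \<phi> x + \<phi> y" and scale: "\<And>c x. \<phi> (c *\<^sub>C x) = c * \<phi> x"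
  obtains m where "n \<le> Suc m" "has_dim (S \<inter> {x. \<phi> x = 0}) m"
proof -
  let ?T = "S \<inter> {x. \<phi> x = 0}"
  have S': "subspace S" using S by (rule has_dim_subspace)
  have "\<phi> 0 = 0" using add[of 0 0] by simp
  then have T: "subspace ?T" using S' by (auto simp: subspace_def add scale)
  obtain m where m: "m \<le> n" "has_dim ?T m" using has_dim_subset[OF T _ S] by auto
  have "n \<le> Suc m"
  proof (cases "?T = S")
    case True
    then show ?thesis using m has_dim_unique[OF S, of m] by simp
  next
    case False
    then obtain s where s: "s \<in> S" "\<phi> s \<noteq> 0" by auto
    have "x \<in> span (insert s ?T)" if x: "x \<in> S" for x
    proof -
      have "\<phi> (x - (\<phi> x / \<phi> s) *\<^sub>C s) = 0"
        using s add[of "x - (\<phi> x / \<phi> s) *\<^sub>C s" "(\<phi> x / \<phi> s) *\<^sub>C s"] by (simp add: scale)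
      then have "x - (\<phi> x / \<phi> s) *\<^sub>C s \<in> ?T" using S' s x by (simp add: subspace_diff subspace_scale)
      then show ?thesis unfolding span_insert_subspace[OF T]
        by (intro CollectI exI[of _ "\<phi> x / \<phi> s"] exI[of _ "x - (\<phi> x / \<phi> s) *\<^sub>C s"]) auto
    qed
    moreover have "span (insert s ?T) \<subseteq> S" using s S' by (intro span_minimal) auto
    ultimately have "span (insert s ?T) = S" by blast
    then have "has_dim S (Suc m)" using has_dim_insert[OF m(2), of s] s by simp
    then show ?thesis using has_dim_unique[OF S] by simp
  qed
  with m show thesis using that by blast
qed

lemma has_dim_sum:
  assumes "has_dim U a" "has_dim D b" "U \<inter> D = {0}"
  shows "has_dim (span (U \<union> D)) (a + b)"
  using assms(2,3)
proof (induction b arbitrary: D)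
  case 0
  then have "span (U \<union> D) = U"
    using assms(1) has_dim_subspace[OF assms(1)] subspace_0[of U] by (simp add: insert_absorb)
  then show ?case using assms(1) by simp
next
  case (Suc b)
  obtain B where B: "finite B" "independent B" "card B = Suc b" "span B = D"
    using Suc.prems(1) unfolding has_dim_def by auto
  then obtain s C where C: "B = insert s C" "s \<notin> C" by (metis card_eq_SucD)
  have ind: "independent C" "s \<notin> span C" using B C by (simp_all add: independent_insert)
  have sC: "has_dim (span C) b" unfolding has_dim_def using B C ind by (intro exI[of _ C]) auto
  have CD: "span C \<subseteq> D" using span_mono[of C B] B C by auto
  have int: "U \<inter> span C = {0}" 
    using Suc.prems(2) CD span_zero subspace_0[OF has_dim_subspace[OF assms(1)]] by blast
  note IH = Suc.IH[OF sC int]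
  have "s \<notin> span (U \<union> span C)"
  proof
    assume "s \<in> span (U \<union> span C)"
    then obtain u t where ut: "u \<in> U" "t \<in> span C" "s = u + t"
      unfolding span_Un_subspace[OF has_dim_subspace[OF assms(1)] subspace_span] by blast
    have sD: "s \<in> D" using span_base[of s B] B C by simp
    have "s - t \<in> D"
      using sD ut(2) CD subspace_diff[OF has_dim_subspace[OF Suc.prems(1)]] by blast
    then have "u = 0" using ut Suc.prems(2) by auto
    then show False using ut ind by simp
  qed
  from has_dim_insert[OF IH this] have "has_dim (span (insert s (span (U \<union> span C)))) (Suc (a + b))" .
  also have "span (insert s (span (U \<union> span C))) = span (insert s (U \<union> C))"
    using span_Un_span[of "{s}" "U \<union> span C"] span_Un_span[of "insert s U" C] by simp
  also have "\<dots> = span (U \<union> D)"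
    using span_Un_span[of U B] B(4) C(1) by simp
  finally show ?case by simp
qed

lemma has_dim_inter:
  assumes "has_dim U a" "has_dim D b" "U \<subseteq> S" "D \<subseteq> S" "has_dim S n" "n < a + b"
  obtains x where "x \<in> U" "x \<in> D" "x \<noteq> 0"
proof (rule ccontr)
  assume "\<not> thesis"
  then have "U \<inter> D = {0}"
    using that subspace_0[OF has_dim_subspace[OF assms(1)]] subspace_0[OF has_dim_subspace[OF assms(2)]]
    by blast
  from has_dim_sum[OF assms(1,2) this] have "a + b \<le> n"
    using assms(3,4,5) has_dim_mono span_minimal[OF _ has_dim_subspace[OF assms(5)]]
    by (meson Un_least)
  then show False using assms(6) by simp
qed

lemma has_dim_complement:
  assumes "subspace T" "T \<subseteq> S" "has_dim S n"
  obtains C m c where "C \<subseteq> S" "has_dim T m" "has_dim C c" "m + c = n" "T \<inter> C = {0}"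
    "span (T \<union> C) = S"
proof -
  obtain m where m: "has_dim T m" using has_dim_subset[OF assms] by auto
  then obtain A where A: "finite A" "independent A" "card A = m" "span A = T"
    unfolding has_dim_def by auto
  have "A \<subseteq> S" using span_superset[of A] A assms(2) by simp
  obtain B where B: "A \<subseteq> B" "B \<subseteq> S" "independent B" "S \<subseteq> span B"
    using maximal_independent_subset_extend[OF \<open>A \<subseteq> S\<close> A(2)] .
  have sB: "span B = S" using B has_dim_subspace[OF assms(3)] by (simp add: span_subspace)
  obtain B0 where B0: "finite B0" "card B0 = n" "span B0 = S"
    using assms(3) unfolding has_dim_def by auto
  have fB: "finite B" using independent_span_bound[OF B0(1) B(3)] B B0 by auto
  have "card B = n" using has_dim_unique[OF assms(3)] B fB sB unfolding has_dim_def by blast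
  let ?C = "span (B - A)"
  have iBA: "independent (B - A)" by (rule independent_mono[OF B(3)]) auto
  have C: "has_dim ?C (n - m)" unfolding has_dim_def
    using B fB A iBA \<open>card B = n\<close> by (intro exI[of _ "B - A"]) (auto simp: card_Diff_subset)
  have mn: "m \<le> n" using A B fB \<open>card B = n\<close> card_mono by blast
  have sp: "span (T \<union> ?C) = S" 
    using A(4) sB B(1) span_Un_span[of T "B - A"] span_Un_span[of "B - A" A]
    by (simp add: Un_commute Un_absorb1)
  have int: "T \<inter> ?C = {0}"
  proof (rule ccontr)
    assume "T \<inter> ?C \<noteq> {0}"
    moreover have "0 \<in> T \<inter> ?C" using assms(1) subspace_0 span_zero by auto
    ultimately obtain x where x: "x \<in> T" "x \<in> ?C" "x \<noteq> 0" by auto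
    obtain f where f: "x = (\<Sum>a\<in>A. f a *\<^sub>C a)" using x(1) A span_finite[OF A(1)] by auto
    obtain g where g: "x = (\<Sum>a\<in>B-A. g a *\<^sub>C a)" using x(2) fB span_finite[of "B - A"] by auto
    define h where "h a = (if a \<in> A then f a else - g a)" for a
    have "(\<Sum>a\<in>B. h a *\<^sub>C a) = (\<Sum>a\<in>A. h a *\<^sub>C a) + (\<Sum>a\<in>B-A. h a *\<^sub>C a)"
      using sum.subset_diff[OF B(1) fB, of "\<lambda>a. h a *\<^sub>C a"] by (simp add: add.commute)
    also have "(\<Sum>a\<in>A. h a *\<^sub>C a) = x" unfolding f h_def by (intro sum.cong) auto
    also have "(\<Sum>a\<in>B-A. h a *\<^sub>C a) = - x" unfolding g h_def
      by (auto simp: sum_negf[symmetric] intro!: sum.cong)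
    finally have "(\<Sum>a\<in>B. h a *\<^sub>C a) = 0" by simp
    then have h: "\<forall>a\<in>B. h a = 0" using B(3) dependent_finite[OF fB] by auto
    have "\<forall>a\<in>A. f a = 0"
    proof
      fix a assume "a \<in> A"
      then show "f a = 0" using h B(1) unfolding h_def by (metis subsetD)
    qed
    then have "x = 0" unfolding f by simp
    then show False using x(3) by contradiction
  qed
  have "?C \<subseteq> span B" by (rule span_mono) auto
  then have "?C \<subseteq> S" unfolding sB .
  from this m C _ int sp show thesis by (rule that) (use mn in simp)
qed

subsection \<open>Hermitian forms\<close>

lemma has_dim_SucE:
  assumes "has_dim S (Suc n)"
  obtains s T where "T \<subseteq> S" "has_dim T n" "s \<in> S" "s \<notin> T" "S = span (insert s T)"
proof -
  obtain T where T: "T \<subseteq> S" "has_dim T n" using has_dim_smaller[OF assms, of n] by auto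
  have "T \<noteq> S" using T assms has_dim_unique[of S n "Suc n"] by auto
  then obtain s where s: "s \<in> S" "s \<notin> T" using T by auto
  have "span (insert s T) \<subseteq> S"
    using s T has_dim_subspace[OF assms] by (intro span_minimal) auto
  then have "span (insert s T) = S" using has_dim_insert[OF T(2) s(2)] assms has_dim_eq by blast
  then show thesis using that T s by blast
qed

text \<open>Forms are total on the ambient space and conjugate-linear in the first argument.
  Restriction to subspaces is left to the predicates on forms, so a form stays the same when the
  induction shrinks the space.\<close>

definition hermitian_form :: "('v \<Rightarrow> 'v \<Rightarrow> complex) \<Rightarrow> bool" where
  "hermitian_form F \<longleftrightarrow> (\<forall>u v w. F u (v + w) = F u v + F u w) \<and>
     (\<forall>u c v. F u (c *\<^sub>C v) = c * F u v) \<and> (\<forall>u v. F v u = cnj (F u v))"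

lemma
  assumes "hermitian_form F"
  shows form_add_right: "F u (v + w) = F u v + F u w"
    and form_scale_right: "F u (c *\<^sub>C v) = c * F u v"
    and form_cnj: "cnj (F u v) = F v u"
    and form_add_left: "F (v + w) u = F v u + F w u"
    and form_scale_left: "F (c *\<^sub>C v) u = cnj c * F v u"
  using assms unfolding hermitian_form_def by (metis complex_cnj_add complex_cnj_mult)+

lemma
  assumes "hermitian_form F"
  shows form_zero_right: "F u 0 = 0" and form_zero_left: "F 0 u = 0"
  using form_scale_right[OF assms, of u 0 0] form_scale_left[OF assms, of 0 0 u] by simp_all

lemma form_sum_right:
  assumes "hermitian_form F"
  shows "F u (sum f I) = (\<Sum>i\<in>I. F u (f i))"
  by (induction I rule: infinite_finite_induct)
     (auto simp: form_zero_right[OF assms] form_add_right[OF assms])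

lemma form_sum_left:
  assumes "hermitian_form F"
  shows "F (sum f I) u = (\<Sum>i\<in>I. F (f i) u)"
  by (induction I rule: infinite_finite_induct)
     (auto simp: form_zero_left[OF assms] form_add_left[OF assms])

lemma form_diag_real:
  assumes "hermitian_form F"
  shows "complex_of_real (Re (F u u)) = F u u"
  by (metis Reals_cnj_iff assms form_cnj of_real_Re)

lemma form_eq_0_commute:
  assumes "hermitian_form F"
  shows "F u v = 0 \<longleftrightarrow> F v u = 0"
  by (metis assms complex_cnj_zero_iff form_cnj)

lemma form_expand:
  assumes "hermitian_form F"
  shows "Re (F (a *\<^sub>C u + v) (a *\<^sub>C u + v)) =
    (cmod a)\<^sup>2 * Re (F u u) + 2 * Re (cnj a * F u v) + Re (F v v)"
proof -
  have "F (a *\<^sub>C u + v) (a *\<^sub>C u + v) = cnj a * a * F u u + cnj a * F u v + a * F v u + F v v"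
    by (simp add: form_add_right[OF assms] form_add_left[OF assms] form_scale_right[OF assms]
        form_scale_left[OF assms] algebra_simps)
  also have "a * F v u = cnj (cnj a * F u v)" by (simp add: form_cnj[OF assms])
  also have "cnj a * a = complex_of_real ((cmod a)\<^sup>2)"
    by (metis complex_norm_square mult.commute of_real_power)
  finally show ?thesis by simp
qed

lemma form_expand_orth:
  assumes "hermitian_form F" "F u v = 0"
  shows "Re (F (a *\<^sub>C u + v) (a *\<^sub>C u + v)) = (cmod a)\<^sup>2 * Re (F u u) + Re (F v v)"
  using form_expand[OF assms(1)] assms(2) by simp

lemma form_scale_diag:
  assumes "hermitian_form F"
  shows "Re (F (a *\<^sub>C u) (a *\<^sub>C u)) = (cmod a)\<^sup>2 * Re (F u u)"
  using form_expand_orth[OF assms, of u 0] by (simp add: form_zero_right[OF assms])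

definition form_comb :: "real \<Rightarrow> ('v \<Rightarrow> 'v \<Rightarrow> complex) \<Rightarrow> real \<Rightarrow> ('v \<Rightarrow> 'v \<Rightarrow> complex) \<Rightarrow>
    'v \<Rightarrow> 'v \<Rightarrow> complex" where
  "form_comb x F y G = (\<lambda>u v. of_real x * F u v + of_real y * G u v)"

lemma hermitian_form_comb [intro, simp]:
  assumes "hermitian_form F" "hermitian_form G"
  shows "hermitian_form (form_comb x F y G)"
  unfolding hermitian_form_def form_comb_def
  by (simp add: form_add_right[OF assms(1)] form_add_right[OF assms(2)] form_cnj[OF assms(1)]
      form_cnj[OF assms(2)] form_scale_right[OF assms(1)] form_scale_right[OF assms(2)] algebra_simps)

lemma Re_form_comb [simp]:
  "Re (form_comb x F y G u v) = x * Re (F u v) + y * Re (G u v)"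
  by (simp add: form_comb_def)

section \<open>Semidefinite and definite subspaces, inertia\<close>

definition nonneg_on :: "('v \<Rightarrow> 'v \<Rightarrow> complex) \<Rightarrow> 'v set \<Rightarrow> bool" where
  "nonneg_on F U \<longleftrightarrow> (\<forall>u\<in>U. 0 \<le> Re (F u u))"

definition pos_on :: "('v \<Rightarrow> 'v \<Rightarrow> complex) \<Rightarrow> 'v set \<Rightarrow> bool" where
  "pos_on F U \<longleftrightarrow> (\<forall>u\<in>U. u \<noteq> 0 \<longrightarrow> 0 < Re (F u u))"

definition neg_on :: "('v \<Rightarrow> 'v \<Rightarrow> complex) \<Rightarrow> 'v set \<Rightarrow> bool" where
  "neg_on F U \<longleftrightarrow> (\<forall>u\<in>U. u \<noteq> 0 \<longrightarrow> Re (F u u) < 0)"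

text \<open>The degenerate case of Cauchy-Schwarz: along v the form has no quadratic term, so a
  nonzero linear term would make it negative far out.\<close>

lemma nonneg_on_isotropic:
  assumes F: "hermitian_form F" and U: "subspace U" "nonneg_on F U"
    and v: "v \<in> U" "Re (F v v) = 0" and u: "u \<in> U"
  shows "F v u = 0"
proof (rule ccontr)
  assume nz: "F v u \<noteq> 0"
  define z where "z = F v u"
  \<comment> \<open>Chosen so that the value at \<open>a *\<^sub>C v + u\<close> is exactly
    -1.\<close>
  define t where "t = (Re (F u u) + 1) / (2 * (cmod z)\<^sup>2)"
  define a where "a = - complex_of_real t * z"
  have z: "(cmod z)\<^sup>2 > 0" using nz z_def by simp
  have "a *\<^sub>C v + u \<in> U" using U v u by (simp add: subspace_add subspace_scale)
  then have "0 \<le> Re (F (a *\<^sub>C v + u) (a *\<^sub>C v + u))" using U by (simp add: nonneg_on_def)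
  also have "\<dots> = 2 * Re (cnj a * z) + Re (F u u)" using form_expand[OF F] v by (simp add: z_def)
  also have "cnj a * z = - complex_of_real (t * (cmod z)\<^sup>2)"
    unfolding a_def using complex_norm_square[of z] by (simp add: mult_ac)
  also have "2 * Re (- complex_of_real (t * (cmod z)\<^sup>2)) + Re (F u u) = - 1"
    using z by (simp add: t_def field_simps)
  finally show False by simp
qed

text \<open>The two subspaces meet only in 0. This is how a negative subspace certifies that there
  is no large nonnegative one.\<close>

lemma neg_nonneg_disjoint:
  assumes "neg_on F D" "nonneg_on F U" "has_dim D d" "has_dim U k" "D \<subseteq> S" "U \<subseteq> S" "has_dim S n"
  shows "d + k \<le> n"
proof (rule ccontr)
  assume "\<not> d + k \<le> n"
  then obtain x where "x \<in> D" "x \<in> U" "x \<noteq> 0"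
    using has_dim_inter[OF assms(3,4,5,6,7)] by auto
  then show False using assms(1,2) unfolding neg_on_def nonneg_on_def by force
qed

text \<open>Each basis vector of D imposes one linear condition. As F may be degenerate, only a
  lower bound for the dimension is available.\<close>

lemma orthogonal_complement:
  assumes F: "hermitian_form F" and "has_dim D d" "has_dim S n"
  obtains U m where "U \<subseteq> S" "has_dim U m" "n \<le> m + d" "\<And>u w. u \<in> U \<Longrightarrow> w \<in> D \<Longrightarrow> F w u = 0"
proof -
  have "\<exists>U m. U \<subseteq> S \<and> has_dim U m \<and> n \<le> m + d \<and> (\<forall>u\<in>U. \<forall>w\<in>D. F w u = 0)"
    using assms(2)
  proof (induction d arbitrary: D)
    case 0
    then show ?case using assms(3) form_zero_left[OF F] by auto
  next
    case (Suc d)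
    obtain s T where T: "T \<subseteq> D" "has_dim T d" "s \<in> D" "s \<notin> T" "D = span (insert s T)"
      using has_dim_SucE[OF Suc.prems] .
    obtain U m where U: "U \<subseteq> S" "has_dim U m" "n \<le> m + d" "\<forall>u\<in>U. \<forall>w\<in>T. F w u = 0"
      using Suc.IH[OF T(2)] by blast
    obtain m' where m': "m \<le> Suc m'" "has_dim (U \<inter> {x. F s x = 0}) m'"
      using has_dim_hyperplane[OF U(2), of "F s"] form_add_right[OF F] form_scale_right[OF F] by metis
    have "F w u = 0" if "u \<in> U \<inter> {x. F s x = 0}" "w \<in> D" for u w
      using that U(4) unfolding T(5) span_insert_subspace[OF has_dim_subspace[OF T(2)]]
      by (auto simp: form_add_left[OF F] form_scale_left[OF F])
    then show ?case using U m'
      by (intro exI[of _ "U \<inter> {x. F s x = 0}"] exI[of _ m']) auto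
  qed
  then show thesis using that by blast
qed

text \<open>If D is negative of largest dimension, then its orthogonal complement U is nonnegative,
  since a negative vector of U could be added to D. An isotropic vector of U lies in the kernel of F
  on S: it is orthogonal to D by construction and to U by Cauchy-Schwarz.\<close>

lemma maximal_negative:
  assumes F: "hermitian_form F" and S: "has_dim S n"
  obtains D d U m where "D \<subseteq> S" "has_dim D d" "neg_on F D" "U \<subseteq> S" "has_dim U m" "d + m = n"
    "nonneg_on F U" "\<And>u w. u \<in> U \<Longrightarrow> Re (F u u) = 0 \<Longrightarrow> w \<in> S \<Longrightarrow> F u w = 0"
proof -
  define P where "P d \<longleftrightarrow> (\<exists>D\<subseteq>S. has_dim D d \<and> neg_on F D)" for d
  have "P 0" unfolding P_def neg_on_def
    using subspace_0[OF has_dim_subspace[OF S]] by (intro exI[of _ "{0}"]) auto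
  moreover have bd: "d \<le> n" if "P d" for d
    using that has_dim_mono[OF _ _ S] unfolding P_def by blast
  ultimately have "P (GREATEST d. P d)" and max: "\<And>d. P d \<Longrightarrow> d \<le> (GREATEST d. P d)"
    by (auto intro: GreatestI_nat Greatest_le_nat)
  then obtain d D where D: "D \<subseteq> S" "has_dim D d" "neg_on F D" and max: "\<And>e. P e \<Longrightarrow> e \<le> d"
    unfolding P_def by blast
  obtain U m where U: "U \<subseteq> S" "has_dim U m" "n \<le> m + d" and orth: "\<And>u w. u \<in> U \<Longrightarrow> w \<in> D \<Longrightarrow> F w u = 0"
    using orthogonal_complement[OF F D(2) S] by metis
  have nonneg: "nonneg_on F U" unfolding nonneg_on_def
  proof (rule ballI, rule ccontr)
    fix u assume u: "u \<in> U" "\<not> 0 \<le> Re (F u u)"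
    have "u \<notin> D" using orth[OF u(1)] u(2) by force
    from has_dim_insert[OF D(2) this] have "has_dim (span (insert u D)) (Suc d)" .
    moreover have "span (insert u D) \<subseteq> S"
      using u U D by (intro span_minimal has_dim_subspace[OF S]) auto
    moreover have "neg_on F (span (insert u D))"
      unfolding neg_on_def span_insert_subspace[OF has_dim_subspace[OF D(2)]]
    proof clarify
      fix a w assume w: "w \<in> D" and nz: "a *\<^sub>C u + w \<noteq> 0"
      have "F u w = 0" using orth[OF u(1) w] form_eq_0_commute[OF F] by blast
      note ex = form_expand_orth[OF F this, of a]
      show "Re (F (a *\<^sub>C u + w) (a *\<^sub>C u + w)) < 0"
      proof (cases "a = 0")
        case True
        then show ?thesis using nz w D(3) by (simp add: neg_on_def)
      next
        case False
        then have "(cmod a)\<^sup>2 * Re (F u u) < 0" using u(2) by (simp add: mult_pos_neg)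
        moreover have "Re (F w w) \<le> 0"
          using D(3) w form_zero_left[OF F] unfolding neg_on_def by (cases "w = 0") (auto intro: less_imp_le)
        ultimately show ?thesis unfolding ex by simp
      qed
    qed
    ultimately have "P (Suc d)" unfolding P_def by blast
    then show False using max by fastforce
  qed
  have "d + m \<le> n" using neg_nonneg_disjoint[OF D(3) nonneg D(2) U(2) D(1) U(1) S] .
  then have dm: "d + m = n" using U(3) by simp
  have sub: "subspace D" "subspace U" using D(2) U(2) has_dim_subspace by auto
  have int: "D \<inter> U = {0}"
    using D(3) nonneg subspace_0[OF sub(1)] subspace_0[OF sub(2)] unfolding neg_on_def nonneg_on_def by force
  have "span (D \<union> U) \<subseteq> S" using D U has_dim_subspace[OF S] by (intro span_minimal) auto
  then have spS: "span (D \<union> U) = S"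
    using has_dim_eq[OF _ _ S] has_dim_sum[OF D(2) U(2) int] unfolding dm by blast
  have "F u w = 0" if u: "u \<in> U" "Re (F u u) = 0" and w: "w \<in> S" for u w
  proof -
    obtain a b where ab: "a \<in> D" "b \<in> U" "w = a + b"
      using w unfolding spS[symmetric] span_Un_subspace[OF sub] by blast
    have "F u a = 0" using orth[OF u(1) ab(1)] form_eq_0_commute[OF F, of u a] by simp
    moreover have "F u b = 0" by (rule nonneg_on_isotropic[OF F sub(2) nonneg u ab(2)])
    ultimately show ?thesis by (simp add: ab(3) form_add_right[OF F])
  qed
  with D U(1,2) dm nonneg show thesis by (rule that)
qed

text \<open>Turns the absence of a nonnegative subspace into the presence of a negative one, a
  condition that survives small perturbations.\<close>

lemma nonneg_or_neg:
  assumes F: "hermitian_form F" and S: "has_dim S n" and k: "k \<le> n"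
    and no: "\<not> (\<exists>U\<subseteq>S. has_dim U k \<and> nonneg_on F U)"
  obtains D where "D \<subseteq> S" "has_dim D (Suc (n - k))" "neg_on F D"
proof -
  obtain D d U m where DU: "D \<subseteq> S" "has_dim D d" "neg_on F D" "U \<subseteq> S" "has_dim U m" "d + m = n"
    "nonneg_on F U"
    using maximal_negative[OF F S] by metis
  have "\<not> k \<le> m"
  proof
    assume "k \<le> m"
    then obtain U' where "U' \<subseteq> U" "has_dim U' k" using has_dim_smaller[OF DU(5)] by auto
    then show False using no DU by (meson nonneg_on_def subset_iff)
  qed
  then have "Suc (n - k) \<le> d" using DU(6) k by linarith
  then obtain D' where "D' \<subseteq> D" "has_dim D' (Suc (n - k))" using has_dim_smaller[OF DU(2)] by auto
  then show thesis using that DU by (meson neg_on_def subset_iff)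
qed

section \<open>Eigenvectors of one form relative to another\<close>

lemma pencil_eigenvector:
  assumes H: "hermitian_form H" and G: "hermitian_form G" and S: "has_dim S n" and n: "n > 0"
    and nondeg: "\<And>v. v \<in> S \<Longrightarrow> (\<And>w. w \<in> S \<Longrightarrow> H w v = 0) \<Longrightarrow> v = 0"
  obtains z v where "v \<in> S" "v \<noteq> 0" "\<And>w. w \<in> S \<Longrightarrow> G w v = z * H w v"
proof -
  obtain B where B: "finite B" "independent B" "card B = n" "span B = S"
    using S unfolding has_dim_def by auto
  obtain e where e: "bij_betw e {..<n} B"
    using ex_bij_betw_nat_finite[OF B(1)] B(3) by (metis lessThan_atLeast0)
  define M where "M F = Matrix.mat n n (\<lambda>(i, j). F (e i) (e j))" for F :: "'v \<Rightarrow> 'v \<Rightarrow> complex"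
  have M[simp]: "M F \<in> carrier_mat n n" for F by (simp add: M_def)
  define vec_of where "vec_of c = (\<Sum>i<n. c $ i *\<^sub>C e i)" for c
  have vS: "vec_of c \<in> S" for c
    using e B(4) unfolding vec_of_def
    by (auto intro!: subspace_sum subspace_scale has_dim_subspace[OF S] simp: bij_betw_def intro: span_base)
  have ind: "c = 0\<^sub>v n" if c: "c \<in> carrier_vec n" "vec_of c = 0" for c
  proof -
    define u where "u b = c $ (inv_into {..<n} e b)" for b
    have "(\<Sum>b\<in>B. u b *\<^sub>C b) = (\<Sum>i<n. u (e i) *\<^sub>C e i)"
      using sum.reindex_bij_betw[OF e, of "\<lambda>b. u b *\<^sub>C b"] by simp
    also have "\<dots> = vec_of c" unfolding vec_of_def u_def
      using e by (intro sum.cong refl) (simp add: bij_betw_inv_into_left)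
    finally have "\<forall>b\<in>B. u b = 0" using c(2) B(2) dependent_finite[OF B(1)] by auto
    then have "c $ i = 0" if "i < n" for i
      using e that by (metis bij_betw_apply bij_betw_inv_into_left lessThan_iff u_def)
    then show ?thesis using c(1) by (intro eq_vecI) auto
  qed
  have app: "F (e i) (vec_of c) = (M F *\<^sub>v c) $ i"
    if "hermitian_form F" "i < n" "c \<in> carrier_vec n" for F i c
    using that unfolding vec_of_def M_def
    by (auto simp: form_sum_right[OF that(1)] form_scale_right[OF that(1)] scalar_prod_def
        lessThan_atLeast0 mult.commute intro!: sum.cong)
  have all: "F w (vec_of c) = x * F' w (vec_of c)"
    if F: "hermitian_form F" "hermitian_form F'" and c: "c \<in> carrier_vec n"
      and eq: "M F *\<^sub>v c = x \<cdot>\<^sub>v (M F' *\<^sub>v c)" and w: "w \<in> S" for F F' c x w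
  proof -
    have b: "F b (vec_of c) = x * F' b (vec_of c)" if b: "b \<in> B" for b
    proof -
      obtain i where i: "i < n" "b = e i" using e b by (auto simp: bij_betw_def)
      show ?thesis unfolding i(2) app[OF F(1) i(1) c] app[OF F(2) i(1) c] eq
        using i c by (simp add: M_def)
    qed
    from w B(4) obtain u where w: "w = (\<Sum>b\<in>B. u b *\<^sub>C b)" using span_finite[OF B(1)] by auto
    show ?thesis unfolding w
      by (simp add: form_sum_left[OF F(1)] form_sum_left[OF F(2)] form_scale_left[OF F(1)]
          form_scale_left[OF F(2)] b sum_distrib_left mult_ac)
  qed
  have det: "det (M H) \<noteq> 0"
  proof
    assume "det (M H) = 0"
    then obtain c where c: "c \<in> carrier_vec n" "c \<noteq> 0\<^sub>v n" "M H *\<^sub>v c = 0\<^sub>v n"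
      using det_0_iff_vec_prod_zero[of "M H" n] by auto
    have "M H *\<^sub>v c = 0 \<cdot>\<^sub>v (M H *\<^sub>v c)" using c by auto
    then have "H w (vec_of c) = 0" if "w \<in> S" for w using all[OF H H c(1) _ that, of 0] by simp
    then have "vec_of c = 0" using nondeg[OF vS] by blast
    then show False using ind c by blast
  qed
  \<comment> \<open>The adjugate stands in for the inverse: \<open>M H * A\<close> is
    \<open>det (M H)\<close> times \<open>M G\<close>, so an eigenvector of A for x yields the
    relative eigenvalue \<open>x / det (M H)\<close>.\<close>
  define A where "A = adj_mat (M H) * M G"
  note adj = adj_mat[OF M[of H]]
  have A: "A \<in> carrier_mat n n" unfolding A_def by (intro mult_carrier_mat[OF adj(1)]) simp
  obtain x where "eigenvalue A x" using spectrum_non_empty[OF A n] unfolding spectrum_def by auto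
  then obtain c where c: "c \<in> carrier_vec n" "c \<noteq> 0\<^sub>v n" "A *\<^sub>v c = x \<cdot>\<^sub>v c"
    using A unfolding eigenvalue_def eigenvector_def by auto
  have "M H * A = det (M H) \<cdot>\<^sub>m M G" unfolding A_def
    by (subst assoc_mult_mat[symmetric, of _ n n _ n _ n]) (simp_all add: adj mult_smult_assoc_mat[of _ n n _ n] left_mult_one_mat[OF M])
  then have "det (M H) \<cdot>\<^sub>v (M G *\<^sub>v c) = (M H * A) *\<^sub>v c"
    using c by (auto intro!: eq_vecI simp: scalar_prod_def sum_distrib_left M_def mult_ac)
  also have "\<dots> = M H *\<^sub>v (x \<cdot>\<^sub>v c)" using c A by (simp add: assoc_mult_mat_vec[of _ n n _ n])
  also have "\<dots> = x \<cdot>\<^sub>v (M H *\<^sub>v c)" using c(1) M by (rule mult_mat_vec[rotated])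
  finally have eq: "det (M H) \<cdot>\<^sub>v (M G *\<^sub>v c) = x \<cdot>\<^sub>v (M H *\<^sub>v c)" .
  have "M G *\<^sub>v c = (x / det (M H)) \<cdot>\<^sub>v (M H *\<^sub>v c)"
  proof (rule eq_vecI)
    fix i assume i: "i < dim_vec ((x / det (M H)) \<cdot>\<^sub>v (M H *\<^sub>v c))"
    then have "(det (M H) \<cdot>\<^sub>v (M G *\<^sub>v c)) $ i = (x \<cdot>\<^sub>v (M H *\<^sub>v c)) $ i" using eq by simp
    then show "(M G *\<^sub>v c) $ i = ((x / det (M H)) \<cdot>\<^sub>v (M H *\<^sub>v c)) $ i"
      using i det by (simp add: M_def field_simps)
  qed (simp add: M_def)
  then have "G w (vec_of c) = x / det (M H) * H w (vec_of c)" if "w \<in> S" for w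
    using all[OF G H c(1) _ that] by blast
  then show thesis using that[OF vS[of c]] ind[OF c(1)] c(2) by blast
qed

lemma has_dim_orthonormal:
  assumes Q: "hermitian_form Q" and I: "finite I"
    and e: "\<And>i j. i \<in> I \<Longrightarrow> j \<in> I \<Longrightarrow> Q (e i) (e j) = (if i = j then 1 else 0)"
  shows "has_dim (span (e ` I)) (card I)"
  using I e
proof (induction I rule: finite_induct)
  case (insert k I)
  have IH: "has_dim (span (e ` I)) (card I)" using insert by simp
  have "subspace {u. Q (e k) u = 0}"
    by (auto simp: subspace_def form_zero_right[OF Q] form_add_right[OF Q] form_scale_right[OF Q])
  then have "span (e ` I) \<subseteq> {u. Q (e k) u = 0}"
    using insert.hyps(2) insert.prems by (intro span_minimal) auto
  moreover have "Q (e k) (e k) = 1" using insert.prems by simp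
  ultimately have "e k \<notin> span (e ` I)" by auto
  from has_dim_insert[OF IH this] show ?case
    using insert.hyps span_Un_span[of "{e k}" "e ` I"] by simp
qed simp

lemma span_image_sum:
  assumes "finite I" "u \<in> span (e ` I)"
  shows "\<exists>a. u = (\<Sum>i\<in>I. a i *\<^sub>C e i)"
proof -
  let ?L = "range (\<lambda>a. \<Sum>i\<in>I. a i *\<^sub>C e i)"
  have "subspace ?L"
  proof (rule subspaceI)
    show "0 \<in> ?L" by (rule image_eqI[of _ _ "\<lambda>_. 0"]) simp_all
  next
    fix x y assume "x \<in> ?L" "y \<in> ?L"
    then obtain a b where "x = (\<Sum>i\<in>I. a i *\<^sub>C e i)" "y = (\<Sum>i\<in>I. b i *\<^sub>C e i)" by blast
    then show "x + y \<in> ?L"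
      by (intro image_eqI[of _ _ "\<lambda>i. a i + b i"]) (simp_all add: scale_left_distrib sum.distrib)
  next
    fix c x assume "x \<in> ?L"
    then obtain a where "x = (\<Sum>i\<in>I. a i *\<^sub>C e i)" by blast
    then show "c *\<^sub>C x \<in> ?L"
      by (intro image_eqI[of _ _ "\<lambda>i. c * a i"]) (simp_all add: scale_sum_right)
  qed
  moreover have "e j \<in> ?L" if "j \<in> I" for j
  proof (rule image_eqI[of _ _ "\<lambda>i. if i = j then 1 else 0"])
    have "(\<Sum>i\<in>I. (if i = j then 1 else 0) *\<^sub>C e i) = (\<Sum>i\<in>I. if i = j then e i else 0)"
      by (intro sum.cong) auto
    then show "e j = (\<Sum>i\<in>I. (if i = j then 1 else 0) *\<^sub>C e i)" using assms(1) that by simp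
  qed simp
  ultimately have "span (e ` I) \<subseteq> ?L" by (intro span_minimal) auto
  with assms(2) show ?thesis by blast
qed

text \<open>Induction on the dimension: a relative eigenvector s satisfies
  \<open>F w s = z * E w s\<close>, so whatever is E-orthogonal to s is F-orthogonal to s as
  well.\<close>

lemma simultaneous_diagonalization:
  assumes E: "hermitian_form E" "pos_on E S" and S: "has_dim S n" and F: "hermitian_form F"
  obtains e :: "nat \<Rightarrow> 'v" and l :: "nat \<Rightarrow> real" where "\<And>i. i < n \<Longrightarrow> e i \<in> S"
    "\<And>i j. i < n \<Longrightarrow> j < n \<Longrightarrow> E (e i) (e j) = (if i = j then 1 else 0)"
    "\<And>i j. i < n \<Longrightarrow> j < n \<Longrightarrow> F (e i) (e j) = (if i = j then of_real (l i) else 0)"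
proof -
  have "\<exists>e l. (\<forall>i<n. e i \<in> S) \<and> (\<forall>i<n. \<forall>j<n. E (e i) (e j) = (if i = j then 1 else 0)) \<and>
      (\<forall>i<n. \<forall>j<n. F (e i) (e j) = (if i = j then complex_of_real (l i) else 0))"
    using E(2) S
  proof (induction n arbitrary: S)
    case (Suc n)
    have sub: "subspace S" using Suc.prems(2) has_dim_subspace by blast
    have "v = 0" if "v \<in> S" "\<And>w. w \<in> S \<Longrightarrow> E w v = 0" for v
      using Suc.prems(1) that unfolding pos_on_def by force
    then obtain z v where v: "v \<in> S" "v \<noteq> 0" "\<And>w. w \<in> S \<Longrightarrow> F w v = z * E w v"
      using pencil_eigenvector[OF E(1) F Suc.prems(2)] by (metis zero_less_Suc)
    define r where "r = Re (E v v)"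
    have r: "r > 0" "E v v = of_real r" using Suc.prems(1) v form_diag_real[OF E(1), of v] by (auto simp: pos_on_def r_def)
    define s where "s = complex_of_real (1 / sqrt r) *\<^sub>C v"
    have s: "s \<in> S" using v(1) sub by (simp add: s_def subspace_scale)
    have "complex_of_real (1 / sqrt r) * complex_of_real (1 / sqrt r) * complex_of_real r
        = complex_of_real (1 / sqrt r * (1 / sqrt r) * r)" by (simp only: of_real_mult)
    also have "1 / sqrt r * (1 / sqrt r) * r = 1" using r by simp
    finally have ss: "E s s = 1"
      by (simp add: s_def form_scale_left[OF E(1)] form_scale_right[OF E(1)] r(2) mult_ac)
    have Fs: "F w s = z * E w s" if "w \<in> S" for w
      using v(3)[OF that] by (simp add: s_def form_scale_right[OF E(1)] form_scale_right[OF F])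
    have Fss: "F s s = of_real (Re z)"
      using Fs[OF s] ss form_diag_real[OF F, of s] by simp
    let ?T = "S \<inter> {x. E s x = 0}"
    obtain m where m: "Suc n \<le> Suc m" "has_dim ?T m"
      using has_dim_hyperplane[OF Suc.prems(2), of "E s"] form_add_right[OF E(1)] form_scale_right[OF E(1)] by metis
    obtain T where T: "T \<subseteq> ?T" "has_dim T n" using has_dim_smaller[OF m(2), of n] m(1) by auto
    have "pos_on E T" using Suc.prems(1) T(1) by (auto simp: pos_on_def)
    from Suc.IH[OF this T(2)] obtain e l where e: "\<forall>i<n. e i \<in> T"
      "\<forall>i<n. \<forall>j<n. E (e i) (e j) = (if i = j then 1 else 0)"
      "\<forall>i<n. \<forall>j<n. F (e i) (e j) = (if i = j then complex_of_real (l i) else 0)" by blast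
    have es: "e i \<in> S" "E s (e i) = 0" "E (e i) s = 0" if "i < n" for i
      using e(1) that T(1) form_eq_0_commute[OF E(1), of s] by auto
    then have fs: "F (e i) s = 0" "F s (e i) = 0" if "i < n" for i
      using Fs[of "e i"] that form_eq_0_commute[OF F, of s] by auto
    show ?case
      using e(2,3) es fs s ss Fss
      by (intro exI[of _ "e(n := s)"] exI[of _ "l(n := Re z)"]) (auto simp: less_Suc_eq)
  qed simp
  then show thesis using that by blast
qed

lemma orthonormal_basis:
  assumes Q: "hermitian_form Q" and "pos_on Q U" "has_dim U m"
  obtains e :: "nat \<Rightarrow> 'v" where "\<And>i. i < m \<Longrightarrow> e i \<in> U"
    "\<And>i j. i < m \<Longrightarrow> j < m \<Longrightarrow> Q (e i) (e j) = (if i = j then 1 else 0)"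
    "\<And>u. u \<in> U \<Longrightarrow> \<exists>a. u = (\<Sum>i<m. a i *\<^sub>C e i)"
proof -
  obtain e where e: "\<And>i. i < m \<Longrightarrow> e i \<in> U"
    "\<And>i j. i < m \<Longrightarrow> j < m \<Longrightarrow> Q (e i) (e j) = (if i = j then 1 else 0)"
    by (rule simultaneous_diagonalization[OF assms Q]) (rule that)
  have "has_dim (span (e ` {..<m})) m" using has_dim_orthonormal[OF Q, of "{..<m}" e] e(2) by simp
  moreover have "span (e ` {..<m}) \<subseteq> U"
    using e(1) has_dim_subspace[OF assms(3)] by (intro span_minimal) auto
  ultimately have "span (e ` {..<m}) = U" using has_dim_eq assms(3) by blast
  then show thesis using that[OF e] span_image_sum[of "{..<m}" _ e] by blast
qed

text \<open>In a Q-orthonormal basis the product of any two coordinates of u is at most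
  \<open>Q u u\<close> in modulus. This replaces compactness of a unit sphere; the summand 1 in C
  makes it positive.\<close>

lemma form_bounded:
  assumes Q: "hermitian_form Q" "pos_on Q U" "has_dim U m" and R: "hermitian_form R"
  obtains C where "C > 0" "\<And>u. u \<in> U \<Longrightarrow> \<bar>Re (R u u)\<bar> \<le> C * Re (Q u u)"
proof -
  obtain e where e: "\<And>i. i < m \<Longrightarrow> e i \<in> U"
    "\<And>i j. i < m \<Longrightarrow> j < m \<Longrightarrow> Q (e i) (e j) = (if i = j then 1 else 0)"
    "\<And>u. u \<in> U \<Longrightarrow> \<exists>a. u = (\<Sum>i<m. a i *\<^sub>C e i)"
    using orthonormal_basis[OF Q] by metis
  define C where "C = 1 + (\<Sum>i<m. \<Sum>j<m. cmod (R (e i) (e j)))"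
  have C: "C > 0" unfolding C_def by (smt (verit) norm_ge_zero sum_nonneg)
  have "\<bar>Re (R u u)\<bar> \<le> C * Re (Q u u)" if uU: "u \<in> U" for u
  proof -
    obtain a where a: "u = (\<Sum>i<m. a i *\<^sub>C e i)" using e(3)[OF uU] by blast
    have gen: "F u u = (\<Sum>i<m. \<Sum>j<m. cnj (a i) * a j * F (e i) (e j))" if "hermitian_form F" for F
      unfolding a by (simp add: form_sum_right[OF that] form_sum_left[OF that] form_scale_left[OF that]
          form_scale_right[OF that] sum_distrib_left mult_ac) (subst sum.swap, simp)
    have "Q u u = (\<Sum>i<m. \<Sum>j<m. if j = i then cnj (a i) * a j else 0)"
      unfolding gen[OF Q(1)] using e(2) by (intro sum.cong) auto
    also have "\<dots> = (\<Sum>i<m. cnj (a i) * a i)" by simp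
    also have "\<dots> = complex_of_real (\<Sum>i<m. (cmod (a i))\<^sup>2)"
      by (simp add: mult.commute complex_norm_square[symmetric])
    finally have Qu: "Re (Q u u) = (\<Sum>i<m. (cmod (a i))\<^sup>2)" by simp
    have ai: "(cmod (a i))\<^sup>2 \<le> Re (Q u u)" if "i < m" for i
      unfolding Qu using that by (intro member_le_sum) auto
    have "\<bar>Re (R u u)\<bar> \<le> cmod (R u u)" by (rule abs_Re_le_cmod)
    also have "\<dots> \<le> (\<Sum>i<m. \<Sum>j<m. cmod (cnj (a i) * a j * R (e i) (e j)))"
      unfolding gen[OF R] by (intro order_trans[OF norm_sum] sum_mono) auto
    also have "\<dots> \<le> (\<Sum>i<m. \<Sum>j<m. cmod (R (e i) (e j)) * Re (Q u u))"
    proof (intro sum_mono)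
      fix i j assume "i \<in> {..<m}" "j \<in> {..<m}"
      then have "(cmod (a i))\<^sup>2 \<le> Re (Q u u)" "(cmod (a j))\<^sup>2 \<le> Re (Q u u)" using ai by auto
      then have "cmod (a i) * cmod (a j) \<le> Re (Q u u)"
        using sum_squares_bound[of "cmod (a i)" "cmod (a j)"] by linarith
      then have "cmod (R (e i) (e j)) * (cmod (a i) * cmod (a j)) \<le> cmod (R (e i) (e j)) * Re (Q u u)"
        by (intro mult_left_mono) auto
      then show "cmod (cnj (a i) * a j * R (e i) (e j)) \<le> cmod (R (e i) (e j)) * Re (Q u u)"
        by (simp add: norm_mult mult_ac)
    qed
    also have "\<dots> = (C - 1) * Re (Q u u)" by (simp add: C_def sum_distrib_right)
    also have "\<dots> \<le> C * Re (Q u u)" using Qu by (simp add: sum_nonneg algebra_simps)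
    finally show ?thesis .
  qed
  then show thesis using that C by blast
qed

subsection \<open>Common isotropic subspaces of Hermitian pencils\<close>

definition isotropic_on :: "('v \<Rightarrow> 'v \<Rightarrow> complex) \<Rightarrow> 'v set \<Rightarrow> bool" where
  "isotropic_on F L \<longleftrightarrow> (\<forall>u\<in>L. \<forall>v\<in>L. F u v = 0)"

lemma isotropic_on_insert:
  assumes F: "hermitian_form F" and L: "subspace L" "isotropic_on F L"
    and v: "F v v = 0" "\<And>w. w \<in> L \<Longrightarrow> F v w = 0"
  shows "isotropic_on F (span (insert v L))"
proof -
  have "F w v = 0" if "w \<in> L" for w using v(2)[OF that] form_eq_0_commute[OF F] by blast
  then show ?thesis
    using L(2) v unfolding isotropic_on_def span_insert_subspace[OF L(1)]
    by (auto simp: form_add_left[OF F] form_add_right[OF F] form_scale_left[OF F] form_scale_right[OF F])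
qed

text \<open>For v = a + b in the kernel, pairing with a and with b gives
  \<open>F a a = - F a b\<close> and \<open>F b b = - F b a\<close>. The real parts on the right
  agree, so a nonnegative number equals a nonpositive one and both vanish.\<close>

lemma definite_sum_nondegenerate:
  assumes F: "hermitian_form F" and V: "subspace V1" "subspace V2"
    and pos: "pos_on F V1" and neg: "neg_on F V2"
    and v: "v \<in> span (V1 \<union> V2)" "\<And>w. w \<in> span (V1 \<union> V2) \<Longrightarrow> F w v = 0"
  shows "v = 0"
proof -
  obtain a b where ab: "a \<in> V1" "b \<in> V2" "v = a + b" using v(1) unfolding span_Un_subspace[OF V] by blast
  have "F a v = 0" "F b v = 0" using ab v(2) by (auto intro: span_base)
  then have eq: "F a a + F a b = 0" "F b a + F b b = 0" unfolding ab(3) form_add_right[OF F] by auto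
  have "Re (F b a) = Re (F a b)" by (metis F cnj.sel(1) form_cnj)
  then have "Re (F a a) = Re (F b b)" using arg_cong[OF eq(1), of Re] arg_cong[OF eq(2), of Re] by simp
  then have "a = 0" "b = 0" using pos neg ab form_zero_left[OF F]
    unfolding pos_on_def neg_on_def by (metis less_asym less_irrefl zero_complex.sel(1))+
  then show ?thesis using ab by simp
qed

text \<open>A square matrix with a nonzero kernel has a nonzero cokernel: a complement of a in V1
  imposes only k - 1 conditions on V2, and the condition from a holds for free.\<close>

lemma kernel_transfer:
  assumes G: "hermitian_form G" and V: "has_dim V1 k" "has_dim V2 k"
    and a: "a \<in> V1" "a \<noteq> 0" "\<And>w. w \<in> V2 \<Longrightarrow> G w a = 0"
  obtains b where "b \<in> V2" "b \<noteq> 0" "\<And>w. w \<in> V1 \<Longrightarrow> G w b = 0"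
proof -
  have T: "has_dim (span {a}) (Suc 0)" using has_dim_insert[of "{0}" 0 a] a(2) by (simp add: insert_commute)
  have "span {a} \<subseteq> V1" using a has_dim_subspace[OF V(1)] by (intro span_minimal) auto
  then obtain D m c where D: "has_dim (span {a}) m" "has_dim D c" "m + c = k" "span (span {a} \<union> D) = V1"
    using has_dim_complement[OF _ _ V(1), of "span {a}"] subspace_span by metis
  have "m = Suc 0" using has_dim_unique[OF D(1) T] .
  obtain U m' where U: "U \<subseteq> V2" "has_dim U m'" "k \<le> m' + c" "\<And>u w. u \<in> U \<Longrightarrow> w \<in> D \<Longrightarrow> G w u = 0"
    using orthogonal_complement[OF G D(2) V(2)] by metis
  obtain m'' where "m' = Suc m''" using U(3) D(3) \<open>m = Suc 0\<close> by (cases m') auto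
  then obtain b where b: "b \<in> U" "b \<noteq> 0" using has_dim_Suc[of U m''] U(2) by auto
  have ab: "G a b = 0" using a(3)[of b] b(1) U(1) form_eq_0_commute[OF G] by blast
  have "subspace {w. G w b = 0}"
    by (auto simp: subspace_def form_zero_left[OF G] form_add_left[OF G] form_scale_left[OF G])
  moreover from this have "span {a} \<subseteq> {w. G w b = 0}" using ab by (intro span_minimal) auto
  ultimately have "span (span {a} \<union> D) \<subseteq> {w. G w b = 0}"
    using U(4)[OF b(1)] by (intro span_minimal) auto
  then show thesis using that b U(1) D(4) by blast
qed

lemma isotropic_combination:
  assumes H: "hermitian_form H" and "0 < Re (H a a)" "Re (H b b) < 0"
  obtains c where "Re (H (c *\<^sub>C b + a) (c *\<^sub>C b + a)) = 0"
proof -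
  define \<alpha> where "\<alpha> = Re (H a a)"
  define \<beta> where "\<beta> = Re (H b a)"
  define \<gamma> where "\<gamma> = - Re (H b b)"
  \<comment> \<open>The larger root of the quadratic
    \<open>\<gamma> * c\<^sup>2 - 2 * \<beta> * c - \<alpha>\<close>, real because \<alpha> and
    \<gamma> are positive.\<close>
  define c where "c = (\<beta> + sqrt (\<beta>\<^sup>2 + \<alpha> * \<gamma>)) / \<gamma>"
  have pos: "\<alpha> > 0" "\<gamma> > 0" using assms by (simp_all add: \<alpha>_def \<gamma>_def)
  have "(\<gamma> * c - \<beta>)\<^sup>2 = \<beta>\<^sup>2 + \<alpha> * \<gamma>" using pos by (simp add: c_def)
  then have "\<gamma> * (c\<^sup>2 * (- \<gamma>) + 2 * c * \<beta> + \<alpha>) = 0" by (simp add: power2_eq_square algebra_simps)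
  then have "c\<^sup>2 * (- \<gamma>) + 2 * c * \<beta> + \<alpha> = 0" using pos by simp
  then have "Re (H (of_real c *\<^sub>C b + a) (of_real c *\<^sub>C b + a)) = 0"
    using form_expand[OF H, of "of_real c" b a] by (simp add: \<alpha>_def \<beta>_def \<gamma>_def)
  then show thesis by (rule that)
qed

text \<open>If z is not real, then v is H-isotropic because \<open>G v v\<close> and
  \<open>H v v\<close> are both real. A real z can occur only if G pairs V1 and V2 degenerately;
  then there are kernel vectors of G on both sides, and they combine to an H-isotropic vector with z
  = 0.\<close>

lemma isotropic_pencil_vector:
  assumes H: "hermitian_form H" and G: "hermitian_form G"
    and V: "has_dim V1 (Suc k)" "has_dim V2 (Suc k)" "pos_on H V1" "neg_on H V2"
    and iso: "isotropic_on G V1" "isotropic_on G V2"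
  obtains z v where "v \<in> span (V1 \<union> V2)" "v \<noteq> 0" "Re (H v v) = 0"
    "\<And>w. w \<in> span (V1 \<union> V2) \<Longrightarrow> G w v = z * H w v"
proof -
  let ?V = "span (V1 \<union> V2)"
  have sub: "subspace V1" "subspace V2" using V has_dim_subspace by auto
  have int: "V1 \<inter> V2 = {0}"
    using V(3,4) sub subspace_0 unfolding pos_on_def neg_on_def by (auto dest: less_asym)
  have memV: "w \<in> ?V \<longleftrightarrow> (\<exists>s t. s \<in> V1 \<and> t \<in> V2 \<and> w = s + t)" for w
    unfolding span_Un_subspace[OF sub] by blast
  show thesis
  proof (cases "\<exists>a\<in>V1. \<exists>b\<in>V2. a \<noteq> 0 \<and> b \<noteq> 0 \<and> (\<forall>w\<in>V2. G w a = 0) \<and> (\<forall>w\<in>V1. G w b = 0)")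
    case True
    then obtain a b where ab: "a \<in> V1" "b \<in> V2" "a \<noteq> 0" "b \<noteq> 0"
      "\<forall>w\<in>V2. G w a = 0" "\<forall>w\<in>V1. G w b = 0" by blast
    have "0 < Re (H a a)" "Re (H b b) < 0" using ab V(3,4) by (auto simp: pos_on_def neg_on_def)
    from isotropic_combination[OF H this]
    obtain c where c: "Re (H (c *\<^sub>C b + a) (c *\<^sub>C b + a)) = 0" by metis
    let ?v = "c *\<^sub>C b + a"
    have "?v \<in> ?V" using ab by (auto intro!: span_add span_scale intro: span_base)
    moreover have "?v \<noteq> 0"
    proof
      assume "?v = 0"
      then have "a = (- c) *\<^sub>C b" by (simp add: add_eq_0_iff2)
      then have "a \<in> V2" using ab sub by (metis subspace_scale)
      then show False using ab int by auto
    qed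
    moreover have "G w ?v = 0 * H w ?v" if "w \<in> ?V" for w
      using that ab iso unfolding memV isotropic_on_def
      by (auto simp: form_add_left[OF G] form_add_right[OF G] form_scale_right[OF G])
    ultimately show thesis using that c by blast
  next
    case False
    have A: "\<not> (a \<in> V1 \<and> a \<noteq> 0 \<and> (\<forall>w\<in>V2. G w a = 0))" for a
      using kernel_transfer[OF G V(1,2), of a] False by metis
    have B: "\<not> (b \<in> V2 \<and> b \<noteq> 0 \<and> (\<forall>w\<in>V1. G w b = 0))" for b
      using kernel_transfer[OF G V(2,1), of b] False by metis
    obtain z v where v: "v \<in> ?V" "v \<noteq> 0" "\<And>w. w \<in> ?V \<Longrightarrow> G w v = z * H w v"
      using pencil_eigenvector[OF H G has_dim_sum[OF V(1,2) int]]
        definite_sum_nondegenerate[OF H sub V(3,4)] by (metis add_Suc zero_less_Suc)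
    have "Im z \<noteq> 0"
    proof
      assume "Im z = 0"
      then obtain x where z: "z = of_real x" by (metis complex_is_Real_iff of_real_Re)
      obtain a b where ab: "a \<in> V1" "b \<in> V2" "v = a + b" using v(1) memV by blast
      have G0: "G w t = 0" if "w \<in> V1 \<and> t \<in> V1 \<or> w \<in> V2 \<and> t \<in> V2" for w t
        using that iso unfolding isotropic_on_def by blast
      have eq: "G w a + G w b = z * (H w a + H w b)" if "w \<in> V1 \<union> V2" for w
        using v(3)[of w] that ab(3) by (auto simp: form_add_right[OF G] form_add_right[OF H] span_base)
      show False
      proof (cases "x = 0")
        case True
        then have "G w a + G w b = 0" if "w \<in> V1 \<union> V2" for w using eq[OF that] z by simp
        then have "a = 0" "b = 0" using A[of a] B[of b] ab(1,2) G0[of _ a] G0[of _ b] by fastforce+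
        then show False using ab(3) v(2) by simp
      next
        case False
        \<comment> \<open>Testing the eigenvector equation on a and on b, where \<open>G a a\<close>
          and \<open>G b b\<close> vanish, yields \<open>H a a = H b b\<close> although the two have
          opposite signs.\<close>
        have "Re (G b a) = Re (G a b)" "Re (H b a) = Re (H a b)"
          by (metis G cnj.sel(1) form_cnj) (metis H cnj.sel(1) form_cnj)
        moreover have "Re (G a b) = x * (Re (H a a) + Re (H a b))" "Re (G b a) = x * (Re (H b a) + Re (H b b))"
          using arg_cong[OF eq[of a], of Re] arg_cong[OF eq[of b], of Re] ab(1,2) G0[of a a] G0[of b b] z by simp_all
        ultimately have "Re (H a a) = Re (H b b)" using False by simp
        then have "a = 0" "b = 0" using V(3,4) ab(1,2) form_zero_left[OF H]
          unfolding pos_on_def neg_on_def by (metis less_asym less_irrefl zero_complex.sel(1))+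
        then show False using ab(3) v(2) by simp
      qed
    qed
    have "Im (H v v) = 0" "Im (G v v) = 0"
      using form_diag_real[OF H, of v] form_diag_real[OF G, of v] by (metis Im_complex_of_real)+
    moreover have "G v v = z * H v v" using v(3)[OF v(1)] .
    ultimately have "Re (H v v) = 0" using \<open>Im z \<noteq> 0\<close> by simp
    then show thesis using that v by blast
  qed
qed

text \<open>This is convexity of the rank-\<open>k\<close> numerical range in disguise: the compressions to \<open>V1\<close> and \<open>V2\<close>
  are scalar, with values on opposite sides of \<open>0\<close>. The hyperplane \<open>H\<close>-orthogonal to an isotropic
  vector \<open>v\<close> satisfying \<open>G(\<cdot>, v) = z H(\<cdot>, v)\<close> is also \<open>G\<close>-orthogonal to \<open>v\<close>, which lowers the
  dimension by one on both sides.\<close>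

lemma common_isotropic_of_pair:
  assumes H: "hermitian_form H" and G: "hermitian_form G"
    and "has_dim V1 k" "has_dim V2 k" "pos_on H V1" "neg_on H V2"
    and "isotropic_on G V1" "isotropic_on G V2"
  obtains L where "L \<subseteq> span (V1 \<union> V2)" "has_dim L k" "isotropic_on H L" "isotropic_on G L"
proof -
  have "\<exists>L\<subseteq>span (V1 \<union> V2). has_dim L k \<and> isotropic_on H L \<and> isotropic_on G L"
    using assms(3-8)
  proof (induction k arbitrary: V1 V2)
    case 0
    show ?case
      by (intro exI[of _ "{0}"]) (auto simp: isotropic_on_def form_zero_left[OF H] form_zero_left[OF G] span_zero)
  next
    case (Suc k)
    let ?V = "span (V1 \<union> V2)"
    obtain z v where v: "v \<in> ?V" "v \<noteq> 0" "Re (H v v) = 0" "\<And>w. w \<in> ?V \<Longrightarrow> G w v = z * H w v"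
      using isotropic_pencil_vector[OF H G Suc.prems] by metis
    have cut: "\<exists>U'\<subseteq>U. has_dim U' k \<and> (\<forall>u\<in>U'. H v u = 0)" if U: "has_dim U (Suc k)" for U
    proof -
      obtain m where m: "Suc k \<le> Suc m" "has_dim (U \<inter> {x. H v x = 0}) m"
        using has_dim_hyperplane[OF U, of "H v"] form_add_right[OF H] form_scale_right[OF H] by metis
      then obtain U' where "U' \<subseteq> U \<inter> {x. H v x = 0}" "has_dim U' k"
        using has_dim_smaller[OF m(2), of k] by auto
      then show ?thesis by blast
    qed
    obtain U1 where U1: "U1 \<subseteq> V1" "has_dim U1 k" "\<forall>u\<in>U1. H v u = 0" using cut[OF Suc.prems(1)] by blast
    obtain U2 where U2: "U2 \<subseteq> V2" "has_dim U2 k" "\<forall>u\<in>U2. H v u = 0" using cut[OF Suc.prems(2)] by blast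
    have def: "pos_on H U1" "neg_on H U2" using Suc.prems(3,4) U1 U2 by (auto simp: pos_on_def neg_on_def)
    have "isotropic_on G U1" "isotropic_on G U2" using Suc.prems(5,6) U1 U2 unfolding isotropic_on_def by blast+
    from Suc.IH[OF U1(2) U2(2) def this]
    obtain L where L: "L \<subseteq> span (U1 \<union> U2)" "has_dim L k" "isotropic_on H L" "isotropic_on G L" by blast
    have UV: "span (U1 \<union> U2) \<subseteq> ?V" using U1 U2 by (intro span_mono) auto
    have "subspace {u. H v u = 0}"
      by (auto simp: subspace_def form_zero_right[OF H] form_add_right[OF H] form_scale_right[OF H])
    then have "span (U1 \<union> U2) \<subseteq> {u. H v u = 0}" using U1 U2 by (intro span_minimal) auto
    then have orth: "H v u = 0" if "u \<in> span (U1 \<union> U2)" for u using that by auto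
    have "v \<notin> span (U1 \<union> U2)"
    proof
      assume "v \<in> span (U1 \<union> U2)"
      then have "v = 0"
        using definite_sum_nondegenerate[OF H has_dim_subspace[OF U1(2)] has_dim_subspace[OF U2(2)] def]
          orth form_eq_0_commute[OF H, of v] by blast
      then show False using v by simp
    qed
    then have "v \<notin> L" using L by blast
    have Hvv: "H v v = 0" using v(3) form_diag_real[OF H, of v] by simp
    have "G v w = 0" if "w \<in> L" for w
    proof -
      have "H w v = 0" using orth L(1) that form_eq_0_commute[OF H, of v w] by blast
      then have "G w v = 0" using v(4)[of w] L(1) UV that by auto
      then show ?thesis using form_eq_0_commute[OF G, of v w] by blast
    qed
    then have "isotropic_on G (span (insert v L))"
      using isotropic_on_insert[OF G has_dim_subspace[OF L(2)] L(4)] v(4)[OF v(1)] Hvv by simp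
    moreover have "isotropic_on H (span (insert v L))"
      using isotropic_on_insert[OF H has_dim_subspace[OF L(2)] L(3) Hvv] orth L(1) by blast
    moreover have "span (insert v L) \<subseteq> ?V" using v(1) L(1) UV by (intro span_minimal) auto
    ultimately show ?case using has_dim_insert[OF L(2) \<open>v \<notin> L\<close>] by blast
  qed
  then show thesis using that by blast
qed

section \<open>Stability of definite subspaces under perturbation\<close>

lemma neg_on_eventually:
  assumes H: "hermitian_form H" and G: "hermitian_form G" and E: "hermitian_form E"
    and D: "has_dim D d" "neg_on (form_comb 1 (form_comb a H b G) c E) D"
    and lim: "(a' \<longlongrightarrow> a) \<F>" "(b' \<longlongrightarrow> b) \<F>" "(c' \<longlongrightarrow> c) \<F>"
  shows "\<forall>\<^sub>F m in \<F>. neg_on (form_comb 1 (form_comb (a' m) H (b' m) G) (c' m) E) D"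
proof -
  let ?F = "form_comb 1 (form_comb a H b G) c E"
  \<comment> \<open>Minus the limiting form is an inner product on D that bounds H, G and E; small
    changes of the coefficients therefore cost less than Q itself.\<close>
  define Q where "Q = form_comb (- 1) ?F 0 ?F"
  have Q: "hermitian_form Q" using H G E by (simp add: Q_def)
  have pos: "pos_on Q D" using D(2) by (force simp: pos_on_def neg_on_def Q_def)
  obtain A where A: "\<And>u. u \<in> D \<Longrightarrow> \<bar>Re (H u u)\<bar> \<le> A * Re (Q u u)" using form_bounded[OF Q pos D(1) H] by metis
  obtain B where B: "\<And>u. u \<in> D \<Longrightarrow> \<bar>Re (G u u)\<bar> \<le> B * Re (Q u u)" using form_bounded[OF Q pos D(1) G] by metis
  obtain C where C: "\<And>u. u \<in> D \<Longrightarrow> \<bar>Re (E u u)\<bar> \<le> C * Re (Q u u)" using form_bounded[OF Q pos D(1) E] by metis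
  have "((\<lambda>m. \<bar>a' m - a\<bar> * A + \<bar>b' m - b\<bar> * B + \<bar>c' m - c\<bar> * C) \<longlongrightarrow>
      \<bar>a - a\<bar> * A + \<bar>b - b\<bar> * B + \<bar>c - c\<bar> * C) \<F>"
    by (intro tendsto_intros lim)
  then have "\<forall>\<^sub>F m in \<F>. \<bar>a' m - a\<bar> * A + \<bar>b' m - b\<bar> * B + \<bar>c' m - c\<bar> * C < 1"
    by (rule order_tendstoD) simp
  then show ?thesis
  proof eventually_elim
    case (elim m)
    show ?case unfolding neg_on_def
    proof (intro ballI impI)
      fix u assume u: "u \<in> D" "u \<noteq> 0"
      let ?q = "Re (Q u u)"
      have q: "?q > 0" using pos u by (simp add: pos_on_def)
      have 1: "(a' m - a) * Re (H u u) \<le> \<bar>a' m - a\<bar> * (A * ?q)"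
        by (rule order_trans[OF abs_ge_self]) (simp add: abs_mult A[OF u(1)] mult_left_mono)
      have 2: "(b' m - b) * Re (G u u) \<le> \<bar>b' m - b\<bar> * (B * ?q)"
        by (rule order_trans[OF abs_ge_self]) (simp add: abs_mult B[OF u(1)] mult_left_mono)
      have 3: "(c' m - c) * Re (E u u) \<le> \<bar>c' m - c\<bar> * (C * ?q)"
        by (rule order_trans[OF abs_ge_self]) (simp add: abs_mult C[OF u(1)] mult_left_mono)
      have "(\<bar>a' m - a\<bar> * A + \<bar>b' m - b\<bar> * B + \<bar>c' m - c\<bar> * C) * ?q < 1 * ?q"
        by (rule mult_strict_right_mono[OF elim q])
      then have "(a' m - a) * Re (H u u) + (b' m - b) * Re (G u u) + (c' m - c) * Re (E u u) < ?q"
        using 1 2 3 by (simp add: algebra_simps)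
      then show "Re (form_comb 1 (form_comb (a' m) H (b' m) G) (c' m) E u u) < 0"
        by (simp add: Q_def algebra_simps)
    qed
  qed
qed

text \<open>By Courant-Fischer: the k-th largest eigenvalue of F on S is nonnegative. Its sign does
  not depend on the inner product, so none appears here.\<close>

definition has_nonneg :: "'v set \<Rightarrow> nat \<Rightarrow> ('v \<Rightarrow> 'v \<Rightarrow> complex) \<Rightarrow> bool" where
  "has_nonneg S k F \<longleftrightarrow> (\<exists>U\<subseteq>S. has_dim U k \<and> nonneg_on F U)"

definition has_pos :: "'v set \<Rightarrow> nat \<Rightarrow> ('v \<Rightarrow> 'v \<Rightarrow> complex) \<Rightarrow> bool" where
  "has_pos S k F \<longleftrightarrow> (\<exists>U\<subseteq>S. has_dim U k \<and> pos_on F U)"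

lemma has_nonneg_cong:
  assumes "\<And>u. Re (F u u) = Re (G u u)"
  shows "has_nonneg S k F = has_nonneg S k G"
  using assms by (simp add: has_nonneg_def nonneg_on_def)

lemma has_pos_cong:
  assumes "\<And>u. Re (F u u) = Re (G u u)"
  shows "has_pos S k F = has_pos S k G"
  using assms by (simp add: has_pos_def pos_on_def)

lemma has_nonneg_scale:
  assumes "r > 0" "\<And>u. Re (F u u) = r * Re (G u u)"
  shows "has_nonneg S k F = has_nonneg S k G"
  using assms by (simp add: has_nonneg_def nonneg_on_def zero_le_mult_iff)

lemma has_nonneg_of_larger:
  assumes "U \<subseteq> S" "has_dim U m" "nonneg_on F U" "k \<le> m"
  shows "has_nonneg S k F"
proof -
  obtain U' where "U' \<subseteq> U" "has_dim U' k" using has_dim_smaller[OF assms(2,4)] .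
  then show ?thesis using assms unfolding has_nonneg_def nonneg_on_def by blast
qed

lemma has_pos_of_larger:
  assumes "U \<subseteq> S" "has_dim U m" "pos_on F U" "k \<le> m"
  shows "has_pos S k F"
proof -
  obtain U' where "U' \<subseteq> U" "has_dim U' k" using has_dim_smaller[OF assms(2,4)] .
  then show ?thesis using assms unfolding has_pos_def pos_on_def by blast
qed

lemma has_nonneg_le:
  assumes "has_nonneg S k F" "has_dim S n"
  shows "k \<le> n"
  using assms has_dim_mono unfolding has_nonneg_def by blast

text \<open>If the limit failed, a negative subspace of dimension n - k + 1 would persist nearby and
  leave no room for a nonnegative one of dimension k. Three coefficients are allowed to vary so that
  directions of the pencil and shifts by E are treated alike.\<close>

lemma has_nonneg_limit:
  assumes H: "hermitian_form H" and G: "hermitian_form G" and E: "hermitian_form E"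
    and S: "has_dim S n" and k: "k \<le> n"
    and lim: "(a' \<longlongrightarrow> a) \<F>" "(b' \<longlongrightarrow> b) \<F>" "(c' \<longlongrightarrow> c) \<F>" and ne: "\<F> \<noteq> bot"
    and ev: "\<forall>\<^sub>F m in \<F>. has_nonneg S k (form_comb 1 (form_comb (a' m) H (b' m) G) (c' m) E)"
  shows "has_nonneg S k (form_comb 1 (form_comb a H b G) c E)"
proof (rule ccontr)
  let ?F = "form_comb 1 (form_comb a H b G) c E"
  assume "\<not> has_nonneg S k ?F"
  moreover have F: "hermitian_form ?F" using H G E by simp
  ultimately obtain D where D: "D \<subseteq> S" "has_dim D (Suc (n - k))" "neg_on ?F D"
    using nonneg_or_neg[OF F S k] unfolding has_nonneg_def by blast
  have "\<forall>\<^sub>F m in \<F>. False"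
    using neg_on_eventually[OF H G E D(2,3) lim] ev
  proof eventually_elim
    case (elim m)
    then obtain U where U: "U \<subseteq> S" "has_dim U k"
      "nonneg_on (form_comb 1 (form_comb (a' m) H (b' m) G) (c' m) E) U"
      unfolding has_nonneg_def by blast
    from neg_nonneg_disjoint[OF elim(1) U(3) D(2) U(2) D(1) U(1) S] show False using k by simp
  qed
  then show False using ne by simp
qed

text \<open>A vector in the kernel of \<open>F0\<close> that is isotropic for \<open>F1\<close> has the same orthogonal complement
  with respect to all members of the pencil except \<open>F0\<close> itself, which is treated by a limit.\<close>

lemma reduce_pencil:
  assumes E: "hermitian_form E" "pos_on E S" and S: "has_dim S n"
    and F0: "hermitian_form F0" and F1: "hermitian_form F1"
    and v: "v \<in> S" "v \<noteq> 0" "F1 v v = 0" "\<And>w. w \<in> S \<Longrightarrow> F0 v w = 0"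
    and nn: "\<And>x y. has_nonneg S (Suc k) (form_comb x F0 y F1)"
  obtains W m where "W \<subseteq> S" "has_dim W m" "v \<notin> W" "\<And>w. w \<in> W \<Longrightarrow> F1 v w = 0"
    "\<And>x y. has_nonneg W k (form_comb x F0 y F1)"
proof -
  \<comment> \<open>F1-orthogonality lets v be added to isotropic subspaces of W later;
    E-orthogonality keeps v itself out of W.\<close>
  let ?W = "S \<inter> {w. F1 v w = 0} \<inter> {w. E v w = 0}"
  have hyp: "\<exists>m. k \<le> Suc m \<and> has_dim (U \<inter> {w. F v w = 0}) m" if "has_dim U k" "hermitian_form F" for U k F
    using has_dim_hyperplane[OF that(1), of "F v"] form_add_right[OF that(2)] form_scale_right[OF that(2)]
    by metis
  obtain m where W: "has_dim ?W m" using hyp[OF S F1] hyp[OF _ E(1)] by meson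
  have vW: "v \<notin> ?W" using E(2) v(1,2) unfolding pos_on_def by force
  have nz: "has_nonneg ?W k (form_comb x F0 y F1)" if y: "y \<noteq> 0" for x y
  proof -
    let ?F = "form_comb x F0 y F1"
    have F: "hermitian_form ?F" using F0 F1 by simp
    obtain U where U: "U \<subseteq> S" "has_dim U (Suc k)" "nonneg_on ?F U" using nn unfolding has_nonneg_def by blast
    let ?U = "U \<inter> {w. F1 v w = 0}"
    obtain m0 where m0: "Suc k \<le> Suc m0" "has_dim ?U m0" using hyp[OF U(2) F1] by blast
    have Fv: "?F v w = y * F1 v w" if "w \<in> S" for w using v(4)[OF that] by (simp add: form_comb_def)
    \<comment> \<open>The cut by \<open>F1 v\<close> may lose one dimension, but adding v restores
      it. If v already lies in the cut, it is isotropic for a form nonnegative on U, so that nothing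
      was cut off.\<close>
    obtain m1 where m1: "Suc k \<le> m1" "has_dim (span (insert v ?U)) m1"
    proof (cases "v \<in> ?U")
      case True
      have "Re (?F v v) = 0" using Fv[OF v(1)] v(3) by simp
      then have "?F v u = 0" if "u \<in> U" for u
        using nonneg_on_isotropic[OF F has_dim_subspace[OF U(2)] U(3), of v u] True that by simp
      then have "complex_of_real y * F1 v u = 0" if "u \<in> U" for u
        using Fv[of u] U(1) that by auto
      then have "U \<subseteq> {w. F1 v w = 0}" using y by auto
      then have "?U = U" by blast
      have "insert v ?U = ?U" using True by blast
      then have "span (insert v ?U) = U"
        using \<open>?U = U\<close> span_eq_iff[THEN iffD2, OF has_dim_subspace[OF U(2)]] by simp
      then show thesis using that[of "Suc k"] U(2) by simp
    next
      case False
      then show thesis using that has_dim_insert[OF m0(2)] m0(1) by blast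
    qed
    obtain m2 where m2: "m1 \<le> Suc m2" "has_dim (span (insert v ?U) \<inter> {w. E v w = 0}) m2"
      using hyp[OF m1(2) E(1)] by blast
    have sp: "span (insert v ?U) = {c *\<^sub>C v + t | c t. t \<in> ?U}"
      by (rule span_insert_subspace[OF has_dim_subspace[OF m0(2)]])
    have "nonneg_on ?F (span (insert v ?U))" unfolding nonneg_on_def
    proof
      fix w assume "w \<in> span (insert v ?U)"
      then obtain c t where ct: "t \<in> ?U" "w = c *\<^sub>C v + t" unfolding sp by blast
      then have "?F v t = 0" using Fv[of t] U(1) by auto
      from form_expand_orth[OF F this, of c] have "Re (?F w w) = Re (?F t t)"
        unfolding ct(2) using Fv[OF v(1)] v(3) by simp
      then show "0 \<le> Re (?F w w)" using U(3) ct(1) by (simp add: nonneg_on_def)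
    qed
    then have "nonneg_on ?F (span (insert v ?U) \<inter> {w. E v w = 0})" by (simp add: nonneg_on_def)
    moreover have "span (insert v ?U) \<inter> {w. E v w = 0} \<subseteq> ?W"
      using U(1) has_dim_subspace[OF S] v(1,3) unfolding sp
      by (auto simp: form_add_right[OF F1] form_scale_right[OF F1] intro: subspace_add subspace_scale)
    ultimately show ?thesis using m1(1) m2 by (intro has_nonneg_of_larger[OF _ m2(2)]) auto
  qed
  have "has_nonneg ?W k (form_comb x F0 y F1)" for x y
  proof (cases "y = 0")
    case True
    have "k \<le> m" using has_nonneg_le[OF nz[of 1] W] by simp
    have "has_nonneg ?W k (form_comb 1 (form_comb x F0 0 F1) 0 E)"
    proof (rule has_nonneg_limit[OF F0 F1 E(1) W \<open>k \<le> m\<close>, where \<F> = sequentially])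
      show "(\<lambda>m. 1 / real (Suc m)) \<longlonglongrightarrow> 0" by (rule LIMSEQ_Suc) (rule lim_1_over_n)
      have "has_nonneg ?W k (form_comb 1 (form_comb x F0 (1 / real (Suc m)) F1) 0 E)" for m
        using nz[of "1 / real (Suc m)" x] has_nonneg_cong[of "form_comb 1 (form_comb x F0 (1 / real (Suc m)) F1) 0 E" "form_comb x F0 (1 / real (Suc m)) F1"]
        by simp
      then show "\<forall>\<^sub>F m in sequentially. has_nonneg ?W k (form_comb 1 (form_comb x F0 (1 / real (Suc m)) F1) 0 E)"
        by simp
    qed auto
    then show ?thesis
      using has_nonneg_cong[of "form_comb 1 (form_comb x F0 0 F1) 0 E" "form_comb x F0 y F1"] True by simp
  qed (rule nz)
  then show thesis by (intro that[OF _ W vW]) blast+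
qed

text \<open>Two vectors of opposite sign combine to an isotropic one. It is nonzero, because
  proportional vectors cannot have opposite signs.\<close>

lemma definite_if_no_isotropic:
  assumes F: "hermitian_form F" and K: "subspace K" and no: "\<And>v. v \<in> K \<Longrightarrow> v \<noteq> 0 \<Longrightarrow> F v v \<noteq> 0"
  shows "pos_on F K \<or> neg_on F K"
proof (rule ccontr)
  assume "\<not> ?thesis"
  then obtain a b where ab: "a \<in> K" "a \<noteq> 0" "Re (F a a) \<ge> 0" "b \<in> K" "b \<noteq> 0" "Re (F b b) \<le> 0"
    unfolding pos_on_def neg_on_def by (meson not_le)
  have Re: "Re (F v v) \<noteq> 0" if "v \<in> K" "v \<noteq> 0" for v
    using no[OF that] form_diag_real[OF F, of v] by auto
  then have pos: "0 < Re (F a a)" "Re (F b b) < 0" using ab by (metis order_le_less)+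
  then obtain c where c: "Re (F (c *\<^sub>C b + a) (c *\<^sub>C b + a)) = 0" using isotropic_combination[OF F] by metis
  moreover have "c *\<^sub>C b + a \<in> K" using ab K by (simp add: subspace_add subspace_scale)
  ultimately have "c *\<^sub>C b + a = 0" using Re by blast
  then have "a = (- c) *\<^sub>C b" by (simp add: add_eq_0_iff2)
  then have "Re (F a a) = (cmod c)\<^sup>2 * Re (F b b)" using form_scale_diag[OF F, of "- c" b] by simp
  then show False using pos by (smt (verit) mult_nonneg_nonpos zero_le_power2)
qed

text \<open>If \<open>F1\<close> were definite on the kernel of \<open>F0\<close>, then a small multiple of \<open>F1\<close> added to \<open>F0\<close> would
  turn the whole kernel negative.\<close>

lemma isotropic_kernel_vector:
  assumes S: "has_dim S n" and F0: "hermitian_form F0" and F1: "hermitian_form F1"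
    and nn: "\<And>x y. has_nonneg S (Suc k) (form_comb x F0 y F1)"
    and tight: "\<not> has_pos S (Suc k) F0"
  obtains v where "v \<in> S" "v \<noteq> 0" "F1 v v = 0" "\<And>w. w \<in> S \<Longrightarrow> F0 v w = 0"
proof (rule ccontr)
  assume none: "\<not> thesis"
  obtain D d U m where DU: "D \<subseteq> S" "has_dim D d" "neg_on F0 D" "U \<subseteq> S" "has_dim U m" "d + m = n"
    "nonneg_on F0 U" and kernel: "\<And>u w. u \<in> U \<Longrightarrow> Re (F0 u u) = 0 \<Longrightarrow> w \<in> S \<Longrightarrow> F0 u w = 0"
    using maximal_negative[OF F0 S] by metis
  have sub: "subspace D" "subspace U" using DU has_dim_subspace by auto
  define K where "K = {u \<in> U. \<forall>w\<in>S. F0 u w = 0}"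
  have K: "subspace K" "K \<subseteq> U" using sub unfolding K_def
    by (auto simp: subspace_def form_add_left[OF F0] form_scale_left[OF F0] form_zero_left[OF F0])
  have DUint: "D \<inter> U = {0}"
    using DU(3,7) subspace_0[OF sub(1)] subspace_0[OF sub(2)] unfolding neg_on_def nonneg_on_def by force
  have ker: "F0 u w = 0" if "u \<in> K" "w \<in> S" for u w using that by (simp add: K_def)
  obtain P \<kappa> p where P: "P \<subseteq> U" "has_dim K \<kappa>" "has_dim P p" "\<kappa> + p = m" "K \<inter> P = {0}"
    using has_dim_complement[OF K DU(5)] by metis
  have "pos_on F0 P" unfolding pos_on_def
  proof (intro ballI impI)
    fix u assume u: "u \<in> P" "u \<noteq> 0"
    have "Re (F0 u u) \<noteq> 0"
    proof
      assume "Re (F0 u u) = 0"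
      then have "u \<in> K" using kernel[of u] u(1) P(1) unfolding K_def by blast
      then show False using u P(5) by blast
    qed
    moreover have "0 \<le> Re (F0 u u)" using DU(7) u(1) P(1) unfolding nonneg_on_def by blast
    ultimately show "0 < Re (F0 u u)" by simp
  qed
  moreover have "P \<subseteq> S" using P(1) DU(4) by (rule order_trans)
  ultimately have "\<not> Suc k \<le> p" using has_pos_of_larger[of P S p F0 "Suc k"] tight P(3) by metis
  \<comment> \<open>P is positive and so has dimension at most k. Hence D and K together reach
    dimension n - k, one more than a nonnegative subspace of dimension k + 1 permits for a negative
    one.\<close>
  then have dk: "n \<le> d + \<kappa> + k" using DU(6) P(4) by simp
  have "pos_on F1 K \<or> neg_on F1 K"
  proof (rule definite_if_no_isotropic[OF F1 K(1)])
    fix v assume v: "v \<in> K" "v \<noteq> 0"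
    then have "v \<in> S" using K(2) DU(4) by blast
    then show "F1 v v \<noteq> 0" using none that[OF _ v(2) _ ker[OF v(1)]] by blast
  qed
  then obtain \<sigma> :: real where \<sigma>: "pos_on (form_comb \<sigma> F1 0 F1) K"
  proof
    assume "pos_on F1 K"
    then show thesis using that[of 1] by (simp add: pos_on_def)
  next
    assume "neg_on F1 K"
    then show thesis using that[of "- 1"] by (simp add: pos_on_def neg_on_def)
  qed
  define R where "R = form_comb \<sigma> F1 0 F1"
  have R: "hermitian_form R" "pos_on R K" using F1 \<sigma> by (simp_all add: R_def)
  have DKint: "D \<inter> K = {0}" using DUint K(2) subspace_0[OF K(1)] subspace_0[OF sub(1)] by auto
  have DK: "has_dim (span (D \<union> K)) (d + \<kappa>)" by (rule has_dim_sum[OF DU(2) P(2) DKint])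
  \<comment> \<open>D need not be R-orthogonal to K. The R-orthogonal complement of K in D + K
    avoids cross terms of R, and F0 is still negative there because K lies in its kernel.\<close>
  obtain U' q where U': "U' \<subseteq> span (D \<union> K)" "has_dim U' q" "d + \<kappa> \<le> q + \<kappa>"
    and Uorth: "\<And>u w. u \<in> U' \<Longrightarrow> w \<in> K \<Longrightarrow> R w u = 0"
    using orthogonal_complement[OF R(1) P(2) DK] by metis
  have DKS: "span (D \<union> K) \<subseteq> S" using K(2) DU(1,4) has_dim_subspace[OF S] by (intro span_minimal) auto
  have subU': "subspace U'" using U'(2) has_dim_subspace by blast
  have UKint: "U' \<inter> K = {0}"
  proof -
    have "x = 0" if "x \<in> U'" "x \<in> K" for x
      using Uorth[OF that] R(2) that(2) unfolding pos_on_def by force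
    then show ?thesis using subspace_0[OF K(1)] subspace_0[OF subU'] by blast
  qed
  have negU': "neg_on F0 U'" unfolding neg_on_def
  proof (intro ballI impI)
    fix w assume w: "w \<in> U'" "w \<noteq> 0"
    then obtain a b where ab: "a \<in> D" "b \<in> K" "w = a + b"
      using U'(1) unfolding span_Un_subspace[OF sub(1) K(1)] by blast
    have "a \<noteq> 0"
    proof
      assume "a = 0"
      then have "w \<in> U' \<inter> K" using ab(2,3) w(1) by simp
      then show False using w(2) UKint by blast
    qed
    then have "Re (F0 a a) < 0" using DU(3) ab by (simp add: neg_on_def)
    moreover have "F0 b a = 0" "F0 b b = 0" using ker[OF ab(2)] ab(1,2) DU(1,4) K(2) by auto
    ultimately show "Re (F0 w w) < 0"
      using form_eq_0_commute[OF F0, of b a] unfolding ab(3)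
      by (simp add: form_add_left[OF F0] form_add_right[OF F0])
  qed
  define Q where "Q = form_comb (- 1) F0 0 F0"
  have Q: "hermitian_form Q" "pos_on Q U'" using F0 negU' by (simp_all add: Q_def pos_on_def neg_on_def)
  obtain C where C: "C > 0" "\<And>u. u \<in> U' \<Longrightarrow> \<bar>Re (R u u)\<bar> \<le> C * Re (Q u u)"
    using form_bounded[OF Q U'(2) R(1)] by metis
  \<comment> \<open>With \<open>t * C = 1 / 2\<close> the perturbation consumes at most half of F0
    on U'.\<close>
  define t where "t = 1 / (2 * C)"
  have t: "t > 0" "t * C = 1 / 2" using C(1) by (simp_all add: t_def)
  let ?F = "form_comb 1 F0 (- t) R"
  let ?M = "span (U' \<union> K)"
  have neg: "neg_on ?F ?M" unfolding neg_on_def span_Un_subspace[OF subU' K(1)]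
  proof clarify
    fix u b assume u: "u \<in> U'" and b: "b \<in> K" and nz: "u + b \<noteq> 0"
    have "u \<in> S" using u U'(1) DKS by blast
    moreover have "b \<in> S" using b K(2) DU(4) by blast
    ultimately have "F0 b u = 0" "F0 b b = 0" using ker[OF b] by auto
    then have 1: "Re (F0 (u + b) (u + b)) = Re (F0 u u)"
      using form_eq_0_commute[OF F0, of b u] by (simp add: form_add_left[OF F0] form_add_right[OF F0])
    have "R b u = 0" using Uorth u b by blast
    then have 2: "Re (R (u + b) (u + b)) = Re (R u u) + Re (R b b)"
      using form_eq_0_commute[OF R(1), of b u] by (simp add: form_add_left[OF R(1)] form_add_right[OF R(1)])
    have "- Re (R u u) \<le> C * Re (Q u u)" using C(2)[OF u] by linarith
    then have "t * (- Re (R u u)) \<le> t * (C * Re (Q u u))" using t by (intro mult_left_mono) auto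
    also have "\<dots> = - Re (F0 u u) / 2" using t(2) by (simp add: Q_def mult.assoc[symmetric])
    finally have 3: "Re (F0 u u) - t * Re (R u u) \<le> Re (F0 u u) / 2" by simp
    have 4: "Re (F0 u u) \<le> 0" "u \<noteq> 0 \<Longrightarrow> Re (F0 u u) < 0"
      using negU' u form_zero_left[OF F0] unfolding neg_on_def by (cases "u = 0", auto intro: less_imp_le)
    have 5: "t * Re (R b b) \<ge> 0" "b \<noteq> 0 \<Longrightarrow> t * Re (R b b) > 0"
      using R(2) b t(1) form_zero_left[OF R(1)] unfolding pos_on_def by (cases "b = 0", auto intro: less_imp_le)
    have "Re (?F (u + b) (u + b)) = Re (F0 u u) - t * Re (R u u) - t * Re (R b b)"
      unfolding Re_form_comb 1 2 by (simp add: algebra_simps)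
    moreover have "u \<noteq> 0 \<or> b \<noteq> 0" using nz by auto
    ultimately show "Re (?F (u + b) (u + b)) < 0"
      using 3 4 5 by (elim disjE) linarith+
  qed
  have "has_nonneg S (Suc k) ?F"
    using nn[of 1 "- t * \<sigma>"] has_nonneg_cong[of "form_comb 1 F0 (- t * \<sigma>) F1" ?F] by (simp add: R_def)
  then obtain V where V: "V \<subseteq> S" "has_dim V (Suc k)" "nonneg_on ?F V" unfolding has_nonneg_def by blast
  have "?M \<subseteq> S" using U'(1) DKS K(2) DU(4) has_dim_subspace[OF S] by (intro span_minimal) auto
  from neg_nonneg_disjoint[OF neg V(3) has_dim_sum[OF U'(2) P(2) UKint] V(2) this V(1) S]
  show False using dk U'(3) by simp
qed

text \<open>Here c is the largest shift for which every member keeps its nonnegative subspace. It is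
  attained because the condition is closed, finite because the member H - cE itself is bounded above
  in c, and positive because all members are strict at c = 0.\<close>

lemma shift_to_tight:
  assumes H: "hermitian_form H" and G: "hermitian_form G" and E: "hermitian_form E" "pos_on E S"
    and S: "has_dim S n" and k: "k > 0"
    and strict: "\<And>x y. (x, y) \<noteq> (0, 0) \<Longrightarrow> has_pos S k (form_comb x H y G)"
    and nn: "\<And>x y. has_nonneg S k (form_comb x H y G)"
  obtains c where "c > 0" "\<And>x y. has_nonneg S k (form_comb x (form_comb 1 H (- c) E) y G)"
    "\<exists>x y. (x, y) \<noteq> (0, 0) \<and> \<not> has_pos S k (form_comb x (form_comb 1 H (- c) E) y G)"
proof -
  define F where "F c x y = form_comb 1 (form_comb x H y G) (- (c * x)) E" for c x y
  have Re_F [simp]: "Re (F c x y u u) = x * Re (H u u) + y * Re (G u u) - c * x * Re (E u u)" for c x y u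
    by (simp add: F_def)
  define T where "T c \<longleftrightarrow> (\<forall>x y. has_nonneg S k (F c x y))" for c
  define X where "X = {c. 0 \<le> c \<and> T c}"
  have kn: "k \<le> n" using has_nonneg_le[OF nn S] .
  have "T 0" unfolding T_def
    by (intro allI) (rule has_nonneg_cong[THEN iffD2, OF _ nn], simp)
  then have "0 \<in> X" by (simp add: X_def)
  obtain C where C: "\<And>u. u \<in> S \<Longrightarrow> \<bar>Re (H u u)\<bar> \<le> C * Re (E u u)" using form_bounded[OF E S H] by metis
  have bd: "c \<le> C" if "c \<in> X" for c
  proof -
    have "has_nonneg S k (F c 1 0)" using that unfolding X_def T_def by blast
    then obtain U where U: "U \<subseteq> S" "has_dim U k" "nonneg_on (F c 1 0) U"
      unfolding has_nonneg_def by blast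
    obtain u where u: "u \<in> U" "u \<noteq> 0" using has_dim_Suc[of U "k - 1"] U(2) k by auto
    have "c * Re (E u u) \<le> Re (H u u)" using U(3) u by (simp add: nonneg_on_def)
    also have "\<dots> \<le> C * Re (E u u)" using C[of u] u U by auto
    finally show ?thesis using E(2) u U(1) unfolding pos_on_def by (auto dest!: bspec)
  qed
  then have bdd: "bdd_above X" by (auto simp: bdd_above_def)
  define c where "c = Sup X"
  have c0: "c \<ge> 0" unfolding c_def using \<open>0 \<in> X\<close> bdd by (rule cSup_upper)
  have above: "\<not> T c'" if "c' > c" for c'
    using that cSup_upper[OF _ bdd, of c'] c0 unfolding c_def X_def by force
  obtain cs where cs: "\<And>m. cs m \<in> X" "cs \<longlonglongrightarrow> c"
    using closure_contains_Sup[OF _ bdd] \<open>0 \<in> X\<close> unfolding closure_sequential c_def by blast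
  have "T c" unfolding T_def
  proof (intro allI)
    fix x y
    show "has_nonneg S k (F c x y)" unfolding F_def
    proof (rule has_nonneg_limit[OF H G E(1) S kn, where \<F> = sequentially])
      show "(\<lambda>m. - (cs m * x)) \<longlonglongrightarrow> - (c * x)" by (intro tendsto_intros cs)
    qed (use cs(1) in \<open>auto simp: X_def T_def F_def[symmetric]\<close>)
  qed
  have tight: "\<exists>x y. (x, y) \<noteq> (0, 0) \<and> \<not> has_pos S k (F c x y)"
  proof (rule ccontr)
    assume "\<not> ?thesis"
    then have pos: "has_pos S k (F c x y)" if "(x, y) \<noteq> (0, 0)" for x y
      using that by blast
    \<comment> \<open>Every value above the supremum fails in some direction (x, y), which can be
      scaled to the unit circle. At a limit direction, the positive subspace available for c
      persists, a contradiction.\<close>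
    define c' where "c' m = c + 1 / real (Suc m)" for m
    have "\<exists>p. norm p = 1 \<and> \<not> has_nonneg S k (F (c' m) (fst p) (snd p))" for m
    proof -
      have "c' m > c" by (simp add: c'_def)
      then obtain x y where xy: "\<not> has_nonneg S k (F (c' m) x y)"
        using above unfolding T_def by blast
      define r where "r = norm (x, y)"
      have "(x, y) \<noteq> (0, 0)"
      proof
        assume "(x, y) = (0, 0)"
        then have "has_nonneg S k (F (c' m) x y)"
          using has_nonneg_of_larger[OF order_refl S _ kn] by (simp add: nonneg_on_def)
        then show False using xy by simp
      qed
      then have r: "r > 0" by (simp add: r_def zero_prod_def)
      have "norm (x / r, y / r) = 1"
      proof -
        have "(x / r, y / r) = (1 / r) *\<^sub>R (x, y)" by simp
        then show ?thesis using r unfolding r_def by (simp del: scaleR_Pair)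
      qed
      moreover have "\<not> has_nonneg S k (F (c' m) (x / r) (y / r))"
        using xy has_nonneg_scale[of "1 / r" "F (c' m) (x / r) (y / r)"
            "F (c' m) x y"] r
        by (simp add: field_simps)
      ultimately show ?thesis by (intro exI[of _ "(x / r, y / r)"]) simp
    qed
    then obtain p where p: "\<And>m. norm (p m) = 1"
      "\<And>m. \<not> has_nonneg S k (F (c' m) (fst (p m)) (snd (p m)))"
      by metis
    have "compact (sphere (0 :: real \<times> real) 1)" by simp
    then obtain l r where l: "l \<in> sphere 0 1" "strict_mono r" "(p \<circ> r) \<longlonglongrightarrow> l"
      using p(1) unfolding compact_def by (metis mem_sphere_0)
    have "(fst l, snd l) \<noteq> (0, 0)" using l(1) by (auto simp: zero_prod_def)
    from pos[OF this] obtain U where U: "U \<subseteq> S" "has_dim U k"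
      "pos_on (F c (fst l) (snd l)) U" unfolding has_pos_def by blast
    have lim: "(\<lambda>m. fst (p (r m))) \<longlonglongrightarrow> fst l" "(\<lambda>m. snd (p (r m))) \<longlonglongrightarrow> snd l"
      using tendsto_fst[OF l(3)] tendsto_snd[OF l(3)] by (simp_all add: o_def)
    have "c' \<longlonglongrightarrow> c + 0" unfolding c'_def by (intro tendsto_intros LIMSEQ_Suc lim_1_over_n)
    then have lim': "(\<lambda>m. c' (r m)) \<longlonglongrightarrow> c" using l(2) LIMSEQ_subseq_LIMSEQ[of c' c r] by (simp add: o_def)
    have "\<forall>\<^sub>F m in sequentially. neg_on (form_comb 1 (form_comb (- fst (p (r m))) H (- snd (p (r m))) G)
        (c' (r m) * fst (p (r m))) E) U"
    proof (rule neg_on_eventually[OF H G E(1) U(2)])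
      show "neg_on (form_comb 1 (form_comb (- fst l) H (- snd l) G) (c * fst l) E) U"
        using U(3) by (force simp: neg_on_def pos_on_def)
    qed (intro tendsto_intros lim lim')+
    then obtain m where m: "neg_on (form_comb 1 (form_comb (- fst (p (r m))) H (- snd (p (r m))) G)
        (c' (r m) * fst (p (r m))) E) U" using eventually_happens by force
    have "nonneg_on (F (c' (r m)) (fst (p (r m))) (snd (p (r m)))) U"
      unfolding nonneg_on_def
    proof
      fix u assume "u \<in> U"
      then show "0 \<le> Re (F (c' (r m)) (fst (p (r m))) (snd (p (r m))) u u)"
        using m form_zero_left[OF H] form_zero_left[OF G] form_zero_left[OF E(1)]
        unfolding neg_on_def by (cases "u = 0") (auto dest!: bspec)
    qed
    then show False using p(2)[of "r m"] U(1,2) unfolding has_nonneg_def by blast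
  qed
  have eq: "has_nonneg S k (form_comb x (form_comb 1 H (- c) E) y G) =
      has_nonneg S k (F c x y)"
    "has_pos S k (form_comb x (form_comb 1 H (- c) E) y G) =
      has_pos S k (F c x y)" for x y
    by (rule has_nonneg_cong has_pos_cong; simp add: algebra_simps)+
  have "c \<noteq> 0"
  proof
    assume c: "c = 0"
    obtain x y where xy: "(x, y) \<noteq> (0, 0)" "\<not> has_pos S k (F c x y)"
      using tight by blast
    moreover have "has_pos S k (F c x y) = has_pos S k (form_comb x H y G)"
      by (rule has_pos_cong) (simp add: c)
    ultimately show False using strict[OF xy(1)] by simp
  qed
  with c0 have "c > 0" by simp
  then show thesis
  proof (rule that)
    show "has_nonneg S k (form_comb x (form_comb 1 H (- c) E) y G)" for x y
      using \<open>T c\<close> unfolding eq T_def by blast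
    show "\<exists>x y. (x, y) \<noteq> (0, 0) \<and> \<not> has_pos S k (form_comb x (form_comb 1 H (- c) E) y G)"
      unfolding eq by (rule tight)
  qed
qed

theorem common_isotropic_subspace:
  assumes E: "hermitian_form E" "pos_on E S" and S: "has_dim S n"
    and H: "hermitian_form H" and G: "hermitian_form G"
    and nn: "\<And>x y. has_nonneg S k (form_comb x H y G)"
  obtains L where "L \<subseteq> S" "has_dim L k" "isotropic_on H L" "isotropic_on G L"
proof -
  have "\<exists>L\<subseteq>S. has_dim L k \<and> isotropic_on H L \<and> isotropic_on G L"
    using assms
  proof (induction k arbitrary: S n H G)
    case 0
    then show ?case using subspace_0[OF has_dim_subspace[OF "0.prems"(3)]]
      by (intro exI[of _ "{0}"]) (auto simp: isotropic_on_def form_zero_left)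
  next
    case (Suc k)
    note S = Suc.prems(3) and E = Suc.prems(1,2)
    have tight_case: "\<exists>L\<subseteq>S. has_dim L (Suc k) \<and> isotropic_on H' L \<and> isotropic_on G L"
      if H': "hermitian_form H'" and nn': "\<And>x y. has_nonneg S (Suc k) (form_comb x H' y G)"
        and tight: "(a, b) \<noteq> (0, 0)" "\<not> has_pos S (Suc k) (form_comb a H' b G)" for H' a b
    proof -
      note G = Suc.prems(5)
      \<comment> \<open>F0 and F1 span the same pencil, turned so that the tight member comes first;
        \<open>a\<^sup>2 + b\<^sup>2\<close> times H' and G are recovered from them below.\<close>
      define F0 where "F0 = form_comb a H' b G"
      define F1 where "F1 = form_comb (- b) H' a G"
      have F: "hermitian_form F0" "hermitian_form F1" using H' G by (simp_all add: F0_def F1_def)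
      have "form_comb x F0 y F1 = form_comb (x * a - y * b) H' (x * b + y * a) G" for x y
        by (intro ext) (simp add: F0_def F1_def form_comb_def algebra_simps)
      then have nnF: "has_nonneg S (Suc k) (form_comb x F0 y F1)" for x y using nn' by simp
      obtain v where v: "v \<in> S" "v \<noteq> 0" "F1 v v = 0" "\<And>w. w \<in> S \<Longrightarrow> F0 v w = 0"
        using isotropic_kernel_vector[OF S F nnF] tight(2) unfolding F0_def[symmetric] by metis
      obtain W m where W: "W \<subseteq> S" "has_dim W m" "v \<notin> W" "\<And>w. w \<in> W \<Longrightarrow> F1 v w = 0"
        "\<And>x y. has_nonneg W k (form_comb x F0 y F1)"
        using reduce_pencil[OF E S F v nnF] by metis
      have "pos_on E W" using E(2) W(1) by (auto simp: pos_on_def)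
      from Suc.IH[OF E(1) this W(2) F W(5)]
      obtain L where L: "L \<subseteq> W" "has_dim L k" "isotropic_on F0 L" "isotropic_on F1 L" by blast
      let ?L = "span (insert v L)"
      have "has_dim ?L (Suc k)" using has_dim_insert[OF L(2)] L(1) W(3) by blast
      moreover have "?L \<subseteq> S" using v(1) L(1) W(1) has_dim_subspace[OF S] by (intro span_minimal) auto
      moreover have "isotropic_on F0 ?L"
        using isotropic_on_insert[OF F(1) has_dim_subspace[OF L(2)] L(3) v(4)[OF v(1)]] v(4) L(1) W(1) by blast
      moreover have "isotropic_on F1 ?L"
        using isotropic_on_insert[OF F(2) has_dim_subspace[OF L(2)] L(4) v(3)] L(1) W(4) by blast
      moreover have "isotropic_on H' ?L" "isotropic_on G ?L"
        if iso: "isotropic_on F0 ?L" "isotropic_on F1 ?L"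
      proof -
        have ab: "complex_of_real (a\<^sup>2 + b\<^sup>2) \<noteq> 0"
          using tight(1) by (simp add: sum_power2_eq_zero_iff del: of_real_add of_real_power)
        have "of_real a * F0 u w - of_real b * F1 u w = of_real (a\<^sup>2 + b\<^sup>2) * H' u w"
          "of_real b * F0 u w + of_real a * F1 u w = of_real (a\<^sup>2 + b\<^sup>2) * G u w" for u w
          by (simp_all add: F0_def F1_def form_comb_def power2_eq_square algebra_simps)
        then show "isotropic_on H' ?L" "isotropic_on G ?L"
          using iso ab unfolding isotropic_on_def by (metis (no_types, lifting) add_0 diff_self mult_eq_0_iff mult_zero_right)+
      qed
      ultimately show ?thesis by blast
    qed
    show ?case
    proof (cases "\<forall>x y. (x, y) \<noteq> (0, 0) \<longrightarrow> has_pos S (Suc k) (form_comb x H y G)")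
      case False
      then show ?thesis using tight_case[OF Suc.prems(4,6)] by blast
    next
      case True
      note G = Suc.prems(5)
      \<comment> \<open>On a subspace isotropic for H' - cE the form H' coincides with cE, which is
        positive.\<close>
      have side: "\<exists>V\<subseteq>S. has_dim V (Suc k) \<and> pos_on H' V \<and> isotropic_on G V"
        if H': "hermitian_form H'" and str: "\<And>x y. (x, y) \<noteq> (0, 0) \<Longrightarrow> has_pos S (Suc k) (form_comb x H' y G)"
          and nn': "\<And>x y. has_nonneg S (Suc k) (form_comb x H' y G)" for H'
      proof -
        obtain c where c: "c > 0" "\<And>x y. has_nonneg S (Suc k) (form_comb x (form_comb 1 H' (- c) E) y G)"
          "\<exists>x y. (x, y) \<noteq> (0, 0) \<and> \<not> has_pos S (Suc k) (form_comb x (form_comb 1 H' (- c) E) y G)"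
          using shift_to_tight[OF H' G E S _ str nn'] by (metis zero_less_Suc)
        have "hermitian_form (form_comb 1 H' (- c) E)" using H' E by simp
        from tight_case[OF this c(2)] c(3) obtain L where L: "L \<subseteq> S" "has_dim L (Suc k)"
          "isotropic_on (form_comb 1 H' (- c) E) L" "isotropic_on G L" by blast
        have "pos_on H' L" unfolding pos_on_def
        proof (intro ballI impI)
          fix u assume u: "u \<in> L" "u \<noteq> 0"
          then have "form_comb 1 H' (- c) E u u = 0" using L(3) unfolding isotropic_on_def by blast
          then have "Re (form_comb 1 H' (- c) E u u) = 0" by simp
          then have "Re (H' u u) = c * Re (E u u)" by simp
          moreover have "Re (E u u) > 0" using E(2) u L(1) by (auto simp: pos_on_def)
          ultimately show "0 < Re (H' u u)" using c(1) by simp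
        qed
        then show ?thesis using L by blast
      qed
      obtain V1 where V1: "V1 \<subseteq> S" "has_dim V1 (Suc k)" "pos_on H V1" "isotropic_on G V1"
        using side[OF Suc.prems(4)] True Suc.prems(6) by blast
      \<comment> \<open>Applied to -H, the shift yields -(H + cE), hence a subspace on which H
        equals -cE for the constant c belonging to -H.\<close>
      define H' where "H' = form_comb (- 1) H 0 H"
      have H': "hermitian_form H'" using Suc.prems(4) by (simp add: H'_def)
      have eq: "has_nonneg S (Suc k) (form_comb x H' y G) = has_nonneg S (Suc k) (form_comb (- x) H y G)"
        "has_pos S (Suc k) (form_comb x H' y G) = has_pos S (Suc k) (form_comb (- x) H y G)" for x y
        by (rule has_nonneg_cong has_pos_cong; simp add: H'_def)+
      obtain V2 where V2: "V2 \<subseteq> S" "has_dim V2 (Suc k)" "pos_on H' V2" "isotropic_on G V2"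
      proof -
        have "has_pos S (Suc k) (form_comb x H' y G)" if "(x, y) \<noteq> (0, 0)" for x y
          unfolding eq using True that by simp
        then show thesis using side[OF H'] that Suc.prems(6) unfolding eq by blast
      qed
      have "neg_on H V2" using V2(3) by (simp add: H'_def pos_on_def neg_on_def)
      from common_isotropic_of_pair[OF Suc.prems(4) G V1(2) V2(2) V1(3) this V1(4) V2(4)]
      obtain L where L: "L \<subseteq> span (V1 \<union> V2)" "has_dim L (Suc k)" "isotropic_on H L" "isotropic_on G L" by metis
      have "span (V1 \<union> V2) \<subseteq> S" using V1 V2 has_dim_subspace[OF S] by (intro span_minimal) auto
      then show ?thesis using L by blast
    qed
  qed
  then show thesis using that by blast
qed

subsection \<open>Relative eigenvalues\<close>

lemma isotropic_on_span:
  assumes F: "hermitian_form F" and e: "\<And>i j. i \<in> I \<Longrightarrow> j \<in> I \<Longrightarrow> F (e i) (e j) = 0"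
  shows "isotropic_on F (span (e ` I))"
proof -
  have sub: "subspace {u. \<forall>w\<in>A. F w u = 0}" for A
    by (auto simp: subspace_def form_zero_right[OF F] form_add_right[OF F] form_scale_right[OF F])
  have "span (e ` I) \<subseteq> {u. \<forall>w\<in>e ` I. F w u = 0}" using e by (intro span_minimal sub) auto
  then have "e ` I \<subseteq> {u. \<forall>w\<in>span (e ` I). F w u = 0}" using form_eq_0_commute[OF F] by blast
  then have "span (e ` I) \<subseteq> {u. \<forall>w\<in>span (e ` I). F w u = 0}" by (intro span_minimal sub)
  then show ?thesis unfolding isotropic_on_def by blast
qed

lemma nonneg_on_comb_isotropic:
  assumes "isotropic_on F U" "isotropic_on G U"
  shows "nonneg_on (form_comb x F y G) U"
  using assms by (simp add: nonneg_on_def isotropic_on_def)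

text \<open>F is nonpositive on the span of the \<open>e i\<close>, which is large enough to meet
  every k-dimensional subspace of S.\<close>

lemma not_has_pos_of_nonpos_diagonal:
  assumes Q: "hermitian_form Q" and F: "hermitian_form F" and S: "has_dim S n"
    and I: "finite I" "n < k + card I" "\<And>i. i \<in> I \<Longrightarrow> e i \<in> S"
    and e: "\<And>i j. i \<in> I \<Longrightarrow> j \<in> I \<Longrightarrow> Q (e i) (e j) = (if i = j then 1 else 0)"
    and f: "\<And>i j. i \<in> I \<Longrightarrow> j \<in> I \<Longrightarrow> F (e i) (e j) = (if i = j then complex_of_real (f i) else 0)"
      "\<And>i. i \<in> I \<Longrightarrow> f i \<le> 0"
  shows "\<not> has_pos S k F"
proof
  assume "has_pos S k F"
  then obtain U where U: "U \<subseteq> S" "has_dim U k" "pos_on F U" unfolding has_pos_def by blast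
  have N: "has_dim (span (e ` I)) (card I)" using has_dim_orthonormal[OF Q I(1), of e] e by blast
  have NS: "span (e ` I) \<subseteq> S" using I(3) has_dim_subspace[OF S] by (intro span_minimal) auto
  obtain u where u: "u \<in> U" "u \<in> span (e ` I)" "u \<noteq> 0"
    using has_dim_inter[OF U(2) N U(1) NS S I(2)] by blast
  obtain a where a: "u = (\<Sum>i\<in>I. a i *\<^sub>C e i)" using span_image_sum[OF I(1) u(2)] by blast
  have left: "F u w = (\<Sum>i\<in>I. cnj (a i) * F (e i) w)" for w
    unfolding a form_sum_left[OF F] form_scale_left[OF F] ..
  have right: "F w u = (\<Sum>j\<in>I. a j * F w (e j))" for w
    unfolding a form_sum_right[OF F] form_scale_right[OF F] ..
  have "F u u = (\<Sum>i\<in>I. cnj (a i) * F (e i) u)" by (rule left)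
  also have "\<dots> = (\<Sum>i\<in>I. cnj (a i) * (\<Sum>j\<in>I. a j * F (e i) (e j)))"
    by (simp only: right)
  also have "\<dots> = (\<Sum>i\<in>I. cnj (a i) * (\<Sum>j\<in>I. if j = i then a i * of_real (f i) else 0))"
    using f(1) by (intro sum.cong arg_cong2[of _ _ _ _ "(*)"]) auto
  also have "\<dots> = (\<Sum>i\<in>I. (a i * cnj (a i)) * of_real (f i))"
    using I(1) by (intro sum.cong) (simp_all add: mult_ac)
  also have "\<dots> = complex_of_real (\<Sum>i\<in>I. (cmod (a i))\<^sup>2 * f i)"
    unfolding complex_norm_square[symmetric] by simp
  finally have "Re (F u u) = (\<Sum>i\<in>I. (cmod (a i))\<^sup>2 * f i)" by simp
  also have "\<dots> \<le> 0" using f(2) by (intro sum_nonpos) (simp add: mult_nonneg_nonpos)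
  finally show False using U(3) u(1,3) unfolding pos_on_def by force
qed

lemma has_nonneg_mono:
  assumes "has_nonneg S k F" "\<And>u. u \<in> S \<Longrightarrow> Re (F u u) \<le> Re (G u u)"
  shows "has_nonneg S k G"
  using assms unfolding has_nonneg_def nonneg_on_def by (meson order_trans subsetD)

text \<open>The \<open>k\<close>-th largest eigenvalue of \<open>F\<close> relative to the inner product \<open>E\<close>, by the
  Courant--Fischer principle.\<close>

definition kth_eigenvalue :: "'v set \<Rightarrow> nat \<Rightarrow> ('v \<Rightarrow> 'v \<Rightarrow> complex) \<Rightarrow> ('v \<Rightarrow> 'v \<Rightarrow> complex) \<Rightarrow> real" where
  "kth_eigenvalue S k E F = Sup {c. has_nonneg S k (form_comb 1 F (- c) E)}"

text \<open>The admissible c form a bounded set that is closed by \<open>has_nonneg_limit\<close>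
  and downward closed because E is nonnegative; so the supremum is attained.\<close>

lemma has_nonneg_iff_le_kth_eigenvalue:
  assumes E: "hermitian_form E" "pos_on E S" and S: "has_dim S n" and k: "0 < k" "k \<le> n"
    and F: "hermitian_form F"
  shows "has_nonneg S k (form_comb 1 F (- c) E) \<longleftrightarrow> c \<le> kth_eigenvalue S k E F"
proof -
  let ?X = "{c. has_nonneg S k (form_comb 1 F (- c) E)}"
  obtain C where C: "\<And>u. u \<in> S \<Longrightarrow> \<bar>Re (F u u)\<bar> \<le> C * Re (E u u)" using form_bounded[OF E S F] by metis
  have nonneg: "Re (E u u) \<ge> 0" if "u \<in> S" for u
    using E(2) that form_zero_left[OF E(1)] unfolding pos_on_def by (cases "u = 0") (auto intro: less_imp_le)
  have "nonneg_on (form_comb 1 F (- (- C)) E) S"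
    unfolding nonneg_on_def Re_form_comb using C by (force simp: abs_le_iff)
  then have ne: "- C \<in> ?X" using has_nonneg_of_larger[OF order_refl S _ k(2)] by simp
  have bdd: "c \<le> C" if "c \<in> ?X" for c
  proof -
    obtain U where U: "U \<subseteq> S" "has_dim U k" "nonneg_on (form_comb 1 F (- c) E) U"
      using \<open>c \<in> ?X\<close> unfolding has_nonneg_def by blast
    obtain u where u: "u \<in> U" "u \<noteq> 0" using has_dim_Suc[of U "k - 1"] U(2) k by auto
    have "c * Re (E u u) \<le> Re (F u u)" using U(3) u by (simp add: nonneg_on_def)
    also have "\<dots> \<le> C * Re (E u u)" using C[of u] u U by auto
    finally show ?thesis using E(2) u U(1) unfolding pos_on_def by (auto dest!: bspec)
  qed
  then have bdd': "bdd_above ?X" by (auto simp: bdd_above_def)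
  obtain cs where cs: "\<And>m. cs m \<in> ?X" "cs \<longlonglongrightarrow> Sup ?X"
    using closure_contains_Sup[OF _ bdd'] ne unfolding closure_sequential by blast
  \<comment> \<open>The limit lemma expects a combination of two forms plus a multiple of E; F is
    written as 1 F + 0 F to fit.\<close>
  have "has_nonneg S k (form_comb 1 (form_comb 1 F 0 F) (- Sup ?X) E)"
  proof (rule has_nonneg_limit[OF F F E(1) S k(2), where \<F> = sequentially])
    show "(\<lambda>m. - cs m) \<longlonglongrightarrow> - Sup ?X" by (intro tendsto_intros cs)
    have "has_nonneg S k (form_comb 1 (form_comb 1 F 0 F) (- cs m) E)" for m
      using cs(1)[of m] has_nonneg_cong[of "form_comb 1 (form_comb 1 F 0 F) (- cs m) E" "form_comb 1 F (- cs m) E"]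
      by simp
    then show "\<forall>\<^sub>F m in sequentially. has_nonneg S k (form_comb 1 (form_comb 1 F 0 F) (- cs m) E)" by simp
  qed auto
  then have "has_nonneg S k (form_comb 1 F (- Sup ?X) E)"
    using has_nonneg_cong[of "form_comb 1 (form_comb 1 F 0 F) (- Sup ?X) E" "form_comb 1 F (- Sup ?X) E"] by simp
  then have "has_nonneg S k (form_comb 1 F (- c) E)" if "c \<le> Sup ?X"
    by (rule has_nonneg_mono) (use that nonneg in \<open>simp add: mult_right_mono\<close>)
  then show ?thesis unfolding kth_eigenvalue_def using cSup_upper[OF _ bdd'] by blast
qed

text \<open>Weyl's perturbation bound: if |H| is at most C times E, the eigenvalue is Lipschitz in x
  with constant C.\<close>

lemma kth_eigenvalue_continuous:
  assumes E: "hermitian_form E" "pos_on E S" and S: "has_dim S n" and k: "0 < k" "k \<le> n"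
    and F: "hermitian_form F" and H: "hermitian_form H"
  shows "continuous_on UNIV (\<lambda>x. kth_eigenvalue S k E (form_comb 1 F x H))"
proof -
  let ?l = "\<lambda>x. kth_eigenvalue S k E (form_comb 1 F x H)"
  have herm: "hermitian_form (form_comb 1 F x H)" for x using F H by simp
  note iff = has_nonneg_iff_le_kth_eigenvalue[OF E S k herm]
  obtain C where C: "C > 0" "\<And>u. u \<in> S \<Longrightarrow> \<bar>Re (H u u)\<bar> \<le> C * Re (E u u)" using form_bounded[OF E S H] by metis
  have lower: "?l y - C * \<bar>x - y\<bar> \<le> ?l x" for x y
  proof -
    have "has_nonneg S k (form_comb 1 (form_comb 1 F y H) (- ?l y) E)" unfolding iff ..
    then have "has_nonneg S k (form_comb 1 (form_comb 1 F x H) (- (?l y - C * \<bar>x - y\<bar>)) E)"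
    proof (rule has_nonneg_mono)
      fix u assume u: "u \<in> S"
      have "(y - x) * Re (H u u) \<le> \<bar>y - x\<bar> * (C * Re (E u u))"
        by (rule order_trans[OF abs_ge_self]) (simp add: abs_mult C(2)[OF u] mult_left_mono)
      then show "Re (form_comb 1 (form_comb 1 F y H) (- ?l y) E u u) \<le>
          Re (form_comb 1 (form_comb 1 F x H) (- (?l y - C * \<bar>x - y\<bar>)) E u u)"
        by (simp add: algebra_simps abs_minus_commute)
    qed
    then show ?thesis unfolding iff .
  qed
  have lip: "\<bar>?l x - ?l y\<bar> \<le> C * \<bar>x - y\<bar>" for x y
    using lower[of y x] lower[of x y] by (simp add: abs_le_iff abs_minus_commute)
  show ?thesis unfolding continuous_on_iff dist_real_def
  proof (intro ballI allI impI)
    fix x \<epsilon> :: real assume "\<epsilon> > 0"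
    then show "\<exists>d>0. \<forall>y\<in>UNIV. \<bar>y - x\<bar> < d \<longrightarrow> \<bar>?l y - ?l x\<bar> < \<epsilon>"
      using C(1) lip by (intro exI[of _ "\<epsilon> / C"]) (auto simp: pos_less_divide_eq mult.commute intro: order_le_less_trans)
  qed
qed

text \<open>Without a kernel vector, a nonnegative subspace from a maximal decomposition would be
  positive, of dimension at least k. There E is bounded by C times the form, so the eigenvalue could
  be raised by 1 / C.\<close>

lemma kth_eigenvalue_degenerate:
  assumes E: "hermitian_form E" "pos_on E S" and S: "has_dim S n" and k: "0 < k" "k \<le> n"
    and F: "hermitian_form F"
  obtains v where "v \<in> S" "v \<noteq> 0" "\<And>w. w \<in> S \<Longrightarrow> form_comb 1 F (- kth_eigenvalue S k E F) E w v = 0"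
proof (rule ccontr)
  note witness = that
  assume "\<not> thesis"
  define \<kappa> where "\<kappa> = kth_eigenvalue S k E F"
  let ?F = "form_comb 1 F (- \<kappa>) E"
  have nondeg: "v = 0" if "v \<in> S" "\<And>w. w \<in> S \<Longrightarrow> ?F w v = 0" for v
    using that \<open>\<not> thesis\<close> witness unfolding \<kappa>_def by blast
  note iff = has_nonneg_iff_le_kth_eigenvalue[OF E S k F, folded \<kappa>_def]
  have F': "hermitian_form ?F" using F E by simp
  obtain D d U m where DU: "D \<subseteq> S" "has_dim D d" "neg_on ?F D" "U \<subseteq> S" "has_dim U m" "d + m = n"
    "nonneg_on ?F U" and kernel: "\<And>u w. u \<in> U \<Longrightarrow> Re (?F u u) = 0 \<Longrightarrow> w \<in> S \<Longrightarrow> ?F u w = 0"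
    using maximal_negative[OF F' S] by metis
  have "has_nonneg S k ?F" unfolding iff ..
  then obtain V where V: "V \<subseteq> S" "has_dim V k" "nonneg_on ?F V" unfolding has_nonneg_def by blast
  have km: "k \<le> m" using neg_nonneg_disjoint[OF DU(3) V(3) DU(2) V(2) DU(1) V(1) S] DU(6) by simp
  have pos: "pos_on ?F U" unfolding pos_on_def
  proof (intro ballI impI)
    fix u assume u: "u \<in> U" "u \<noteq> 0"
    have "Re (?F u u) \<noteq> 0"
    proof
      assume "Re (?F u u) = 0"
      then have "?F w u = 0" if "w \<in> S" for w
        using kernel[OF u(1) _ that] form_eq_0_commute[OF F', of u w] by blast
      then show False using nondeg[of u] u DU(4) by blast
    qed
    moreover have "0 \<le> Re (?F u u)" using DU(7) u(1) unfolding nonneg_on_def by blast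
    ultimately show "0 < Re (?F u u)" by simp
  qed
  obtain C where C: "C > 0" "\<And>u. u \<in> U \<Longrightarrow> \<bar>Re (E u u)\<bar> \<le> C * Re (?F u u)"
    using form_bounded[OF F' pos DU(5) E(1)] by metis
  have "nonneg_on (form_comb 1 F (- (\<kappa> + 1 / C)) E) U" unfolding nonneg_on_def
  proof
    fix u assume "u \<in> U"
    then have "Re (E u u) \<le> C * Re (?F u u)" using C(2)[of u] by simp
    then have "Re (E u u) / C \<le> Re (?F u u)" using C(1) by (simp add: pos_divide_le_eq mult.commute)
    then show "0 \<le> Re (form_comb 1 F (- (\<kappa> + 1 / C)) E u u)" by (simp add: algebra_simps)
  qed
  then have "has_nonneg S k (form_comb 1 F (- (\<kappa> + 1 / C)) E)"
    by (rule has_nonneg_of_larger[OF DU(4,5) _ km])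
  then show False using C(1) unfolding iff by simp
qed

end

subsection \<open>The rank-\<open>k\<close> numerical range\<close>

definition scale_seq :: "complex \<Rightarrow> (nat \<Rightarrow> complex) \<Rightarrow> nat \<Rightarrow> complex" where
  "scale_seq c v = (\<lambda>i. c * v i)"

interpretation seq?: complex_vector_space scale_seq
  by unfold_locales (auto simp: scale_seq_def fun_eq_iff algebra_simps)

text \<open>\<open>\<complex>\<^sup>n\<close> is embedded into the space of all sequences, since \<open>n\<close> is not a type.\<close>

definition coord_space :: "nat \<Rightarrow> (nat \<Rightarrow> complex) set" where
  "coord_space n = {v. \<forall>i\<ge>n. v i = 0}"

definition mat_form :: "complex mat \<Rightarrow> (nat \<Rightarrow> complex) \<Rightarrow> (nat \<Rightarrow> complex) \<Rightarrow> complex" where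
  "mat_form M u v = (\<Sum>i<dim_row M. \<Sum>j<dim_col M. cnj (u i) * M $$ (i, j) * v j)"

lemma subspace_coord_space: "seq.subspace (coord_space n)"
  by (auto simp: seq.subspace_def coord_space_def scale_seq_def)

lemma hermitian_mat_form:
  assumes "M \<in> carrier_mat n n" "mat_adjoint M = M"
  shows "hermitian_form (mat_form M)"
proof -
  have sym: "cnj (M $$ (i, j)) = M $$ (j, i)" if "i < n" "j < n" for i j
    using mat_adjoint_index[of j M i] that assms by simp
  show ?thesis unfolding seq.hermitian_form_def
  proof (intro conjI allI)
    fix u v w c
    show "mat_form M u (v + w) = mat_form M u v + mat_form M u w"
      by (simp add: mat_form_def algebra_simps sum.distrib)
    show "mat_form M u (scale_seq c v) = c * mat_form M u v"
      by (simp add: mat_form_def scale_seq_def sum_distrib_left mult_ac)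
    have "cnj (mat_form M u v) = (\<Sum>i<n. \<Sum>j<n. u i * M $$ (j, i) * cnj (v j))"
      using assms(1) unfolding mat_form_def by (auto simp: sym intro!: sum.cong)
    also have "\<dots> = (\<Sum>j<n. \<Sum>i<n. u i * M $$ (j, i) * cnj (v j))" by (rule sum.swap)
    also have "\<dots> = mat_form M v u"
      using assms(1) unfolding mat_form_def by (auto simp: mult_ac intro!: sum.cong)
    finally show "mat_form M v u = cnj (mat_form M u v)" by simp
  qed
qed

lemma mat_form_add:
  assumes "A \<in> carrier_mat n n" "B \<in> carrier_mat n n"
  shows "mat_form (A + B) u v = mat_form A u v + mat_form B u v"
  using assms by (simp add: mat_form_def algebra_simps sum.distrib)

lemma mat_form_smult: "mat_form (c \<cdot>\<^sub>m A) u v = c * mat_form A u v"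
  by (simp add: mat_form_def sum_distrib_left mult_ac)

lemma mat_form_one: "mat_form (1\<^sub>m n) u v = (\<Sum>i<n. cnj (u i) * v i)"
proof -
  have "mat_form (1\<^sub>m n) u v = (\<Sum>i<n. \<Sum>j<n. if j = i then cnj (u i) * v j else 0)"
    unfolding mat_form_def by (intro sum.cong) auto
  then show ?thesis by simp
qed

lemma mat_form_one_diag: "Re (mat_form (1\<^sub>m n) u u) = (\<Sum>i<n. (cmod (u i))\<^sup>2)"
proof -
  have "mat_form (1\<^sub>m n) u u = complex_of_real (\<Sum>i<n. (cmod (u i))\<^sup>2)"
    unfolding mat_form_one by (simp add: mult.commute complex_norm_square[symmetric])
  then show ?thesis by simp
qed

lemma mat_adjoint_one: "mat_adjoint (1\<^sub>m n :: complex mat) = 1\<^sub>m n"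
  by (rule eq_matI) auto

lemma hermitian_mat_form_one: "hermitian_form (mat_form (1\<^sub>m n))"
  by (rule hermitian_mat_form[of _ n, OF _ mat_adjoint_one]) simp

lemma pos_on_mat_form_one: "pos_on (mat_form (1\<^sub>m n)) (coord_space n)"
  unfolding seq.pos_on_def mat_form_one_diag
proof (intro ballI impI)
  fix u assume "u \<in> coord_space n" "u \<noteq> (0 :: nat \<Rightarrow> complex)"
  then obtain i where "u i \<noteq> 0" "i < n" unfolding coord_space_def fun_eq_iff by (force simp: not_less)
  then show "0 < (\<Sum>i<n. (cmod (u i))\<^sup>2)" by (intro sum_pos2[of _ i]) auto
qed

lemma has_dim_coord_space: "has_dim (coord_space n) n"
proof -
  define e where "e i = (\<lambda>j. if j = i then 1 else 0 :: complex)" for i :: nat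
  have "mat_form (1\<^sub>m n) (e i) (e j) = (if i = j then 1 else 0)" if "i < n" "j < n" for i j
    using that unfolding mat_form_one e_def by (simp add: if_distrib cong: if_cong)
  then have "has_dim (seq.span (e ` {..<n})) n"
    using seq.has_dim_orthonormal[OF hermitian_mat_form_one, of "{..<n}" n e] by simp
  also have "seq.span (e ` {..<n}) = coord_space n"
  proof
    show "seq.span (e ` {..<n}) \<subseteq> coord_space n"
      using subspace_coord_space by (intro seq.span_minimal) (auto simp: coord_space_def e_def)
    show "coord_space n \<subseteq> seq.span (e ` {..<n})"
    proof
      fix v assume v: "v \<in> coord_space n"
      have "v = (\<Sum>i<n. scale_seq (v i) (e i))"
      proof
        fix j
        have "(\<Sum>i<n. scale_seq (v i) (e i)) j = (\<Sum>i<n. if i = j then v i else 0)"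
          by (induction n) (auto simp: scale_seq_def e_def)
        also have "\<dots> = v j" using v by (auto simp: coord_space_def)
        finally show "v j = (\<Sum>i<n. scale_seq (v i) (e i)) j" by simp
      qed
      also have "\<dots> \<in> seq.span (e ` {..<n})"
        by (intro seq.span_sum seq.span_scale) (auto intro: seq.span_base)
      finally show "v \<in> seq.span (e ` {..<n})" .
    qed
  qed
  finally show ?thesis .
qed

lemma det_eq_0_if_degenerate:
  assumes M: "M \<in> carrier_mat n n" and v: "v \<in> coord_space n" "v \<noteq> 0"
    and ker: "\<And>w. w \<in> coord_space n \<Longrightarrow> mat_form M w v = 0"
  shows "det M = 0"
proof -
  have "(\<Sum>j<n. M $$ (i, j) * v j) = 0" if i: "i < n" for i
  proof -
    let ?e = "\<lambda>j. if j = i then 1 else 0 :: complex"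
    have "mat_form M ?e v = (\<Sum>l<n. if l = i then (\<Sum>j<n. M $$ (i, j) * v j) else 0)"
      unfolding mat_form_def carrier_matD[OF M] by (intro sum.cong[OF refl]) auto
    also have "\<dots> = (\<Sum>j<n. M $$ (i, j) * v j)" using i by simp
    finally show ?thesis using ker[of ?e] i by (simp add: coord_space_def)
  qed
  then have "M *\<^sub>v Matrix.vec n v = 0\<^sub>v n"
    using M by (intro eq_vecI) (auto simp: scalar_prod_def lessThan_atLeast0)
  moreover have "Matrix.vec n v \<noteq> 0\<^sub>v n"
  proof
    assume "Matrix.vec n v = 0\<^sub>v n"
    then have "Matrix.vec n v $ i = 0\<^sub>v n $ i" for i by simp
    then have "v i = 0" if "i < n" for i using that by (metis index_vec index_zero_vec(1))
    moreover have "v i = 0" if "\<not> i < n" for i using that v(1) by (simp add: coord_space_def)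
    ultimately have "v = 0" by (intro ext) auto
    then show False using v(2) by contradiction
  qed
  moreover have "Matrix.vec n v \<in> carrier_vec n" by simp
  ultimately show ?thesis using det_0_iff_vec_prod_zero[OF M] by blast
qed

lemma index_mult_mat_sum:
  assumes "A \<in> carrier_mat m n" "B \<in> carrier_mat n l" "i < m" "j < l"
  shows "(A * B) $$ (i, j) = (\<Sum>r<n. A $$ (i, r) * B $$ (r, j))"
  using assms by (simp add: scalar_prod_def lessThan_atLeast0)

lemma adjoint_mult_form:
  fixes e :: "nat \<Rightarrow> nat \<Rightarrow> complex" and k :: nat
  assumes A: "A \<in> carrier_mat n n"
  defines "X \<equiv> Matrix.mat n k (\<lambda>(i, j). e j i)"
  shows "mat_adjoint X * A * X = Matrix.mat k k (\<lambda>(i, j). mat_form A (e i) (e j))"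
proof (rule eq_matI)
  fix i j assume ij: "i < dim_row (Matrix.mat k k (\<lambda>(i, j). mat_form A (e i) (e j)))"
    "j < dim_col (Matrix.mat k k (\<lambda>(i, j). mat_form A (e i) (e j)))"
  have X: "X \<in> carrier_mat n k" "mat_adjoint X \<in> carrier_mat k n" by (auto simp: X_def)
  have ij': "i < k" "j < k" using ij by auto
  have "(mat_adjoint X * A * X) $$ (i, j) = (\<Sum>m<n. (mat_adjoint X * A) $$ (i, m) * X $$ (m, j))"
    by (rule index_mult_mat_sum[OF mult_carrier_mat[OF X(2) A] X(1) ij'])
  also have "\<dots> = (\<Sum>m<n. (\<Sum>l<n. mat_adjoint X $$ (i, l) * A $$ (l, m)) * X $$ (m, j))"
    using index_mult_mat_sum[OF X(2) A ij'(1)] by (intro sum.cong) auto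
  also have "\<dots> = (\<Sum>m<n. (\<Sum>l<n. cnj (e i l) * A $$ (l, m)) * e j m)"
    using ij' unfolding X_def by (intro sum.cong arg_cong2[of _ _ _ _ "(*)"]) auto
  also have "\<dots> = (\<Sum>m<n. \<Sum>l<n. cnj (e i l) * A $$ (l, m) * e j m)" by (simp add: sum_distrib_right)
  also have "\<dots> = mat_form A (e i) (e j)" using A unfolding mat_form_def by (subst sum.swap) simp
  finally show "(mat_adjoint X * A * X) $$ (i, j) = Matrix.mat k k (\<lambda>(i, j). mat_form A (e i) (e j)) $$ (i, j)"
    using ij by simp
qed (auto simp: X_def)

lemma mat_form_re_im:
  assumes A: "A \<in> carrier_mat n n"
  shows "mat_form A u v = mat_form (re_mat A) u v + \<i> * mat_form (im_mat A) u v"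
proof -
  have "A = re_mat A + \<i> \<cdot>\<^sub>m im_mat A"
    using A by (intro eq_matI) (auto simp: re_mat_def im_mat_def field_simps)
  then show ?thesis
    using mat_form_add[of "re_mat A" n "\<i> \<cdot>\<^sub>m im_mat A"] re_im_mat_carrier[OF A] by (simp add: mat_form_smult)
qed

lemma hermitian_re_im:
  assumes "A \<in> carrier_mat n n"
  shows "hermitian_form (mat_form (re_mat A))" "hermitian_form (mat_form (im_mat A))"
  using hermitian_mat_form mat_adjoint_re_im_mat[OF assms] re_im_mat_carrier[OF assms] by blast+

text \<open>The columns of an admissible X are an orthonormal basis of a subspace isotropic for both
  Re A - a and Im A - b, and conversely. Such a subspace is nonnegative for all members of their
  pencil; the reverse implication is \<open>common_isotropic_subspace\<close>.\<close>

theorem rank_numerical_range_iff: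
  assumes A: "A \<in> carrier_mat n n"
  shows "Complex a b \<in> rank_numerical_range k A \<longleftrightarrow>
    (\<forall>x y. has_nonneg (coord_space n) k
      (form_comb x (form_comb 1 (mat_form (re_mat A)) (- a) (mat_form (1\<^sub>m n)))
                 y (form_comb 1 (mat_form (im_mat A)) (- b) (mat_form (1\<^sub>m n)))))"
proof -
  let ?E = "mat_form (1\<^sub>m n)"
  let ?R = "form_comb 1 (mat_form (re_mat A)) (- a) ?E"
  let ?S = "form_comb 1 (mat_form (im_mat A)) (- b) ?E"
  note E = hermitian_mat_form_one[of n] and RS = hermitian_re_im[OF A]
  have R: "hermitian_form ?R" and S: "hermitian_form ?S" using E RS by simp_all
  show ?thesis
  proof
    assume "Complex a b \<in> rank_numerical_range k A"
    then obtain X where X: "X \<in> carrier_mat n k" "mat_adjoint X * X = 1\<^sub>m k"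
      "mat_adjoint X * A * X = Complex a b \<cdot>\<^sub>m 1\<^sub>m k"
      using A unfolding rank_numerical_range_def by auto
    define e where "e j = (\<lambda>i. if i < n then X $$ (i, j) else 0)" for j
    have Xe: "X = Matrix.mat n k (\<lambda>(i, j). e j i)" using X(1) by (intro eq_matI) (auto simp: e_def)
    have "mat_adjoint X * 1\<^sub>m n * X = Matrix.mat k k (\<lambda>(i, j). ?E (e i) (e j))"
      unfolding Xe by (rule adjoint_mult_form) simp
    moreover have "mat_adjoint X * 1\<^sub>m n = mat_adjoint X"
      using X(1) by (intro right_mult_one_mat[of _ k]) auto
    ultimately have 1: "1\<^sub>m k = Matrix.mat k k (\<lambda>(i, j). ?E (e i) (e j))" using X(2) by simp
    have Ee: "?E (e i) (e j) = (if i = j then 1 else 0)" if "i < k" "j < k" for i j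
      using arg_cong[OF 1, of "\<lambda>M. M $$ (i, j)"] that by simp
    have 2: "Complex a b \<cdot>\<^sub>m 1\<^sub>m k = Matrix.mat k k (\<lambda>(i, j). mat_form A (e i) (e j))"
      using X(3) adjoint_mult_form[OF A, of k e] unfolding Xe[symmetric] by simp
    have Ae: "mat_form A (e i) (e j) = (if i = j then Complex a b else 0)" if "i < k" "j < k" for i j
      using arg_cong[OF 2, of "\<lambda>M. M $$ (i, j)"] that by (cases "i = j") auto
    have RSe: "?R (e i) (e j) = 0 \<and> ?S (e i) (e j) = 0" if ij: "i < k" "j < k" for i j
    proof -
      have *: "?R (e i) (e j) + \<i> * ?S (e i) (e j) = 0" if "i < k" "j < k" for i j
        using Ae[OF that] Ee[OF that] mat_form_re_im[OF A, of "e i" "e j"]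
        by (auto simp: seq.form_comb_def Complex_eq algebra_simps)
      \<comment> \<open>Conjugation with i and j exchanged turns R + iS = 0 into R - iS = 0, which
        separates the two Hermitian parts.\<close>
      have "cnj (?R (e j) (e i) + \<i> * ?S (e j) (e i)) = 0" using *[OF ij(2,1)] by simp
      then have "?R (e i) (e j) - \<i> * ?S (e i) (e j) = 0"
        by (simp add: seq.form_cnj[OF R] seq.form_cnj[OF S])
      moreover note *[OF ij]
      ultimately have "2 * ?R (e i) (e j) = 0" "2 * (\<i> * ?S (e i) (e j)) = 0"
        by (auto simp: algebra_simps)
      then show ?thesis by simp
    qed
    let ?U = "seq.span (e ` {..<k})"
    have "has_dim ?U k" using seq.has_dim_orthonormal[OF E, of "{..<k}" e] Ee by simp
    moreover have "?U \<subseteq> coord_space n"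
      using subspace_coord_space by (intro seq.span_minimal) (auto simp: coord_space_def e_def)
    moreover have "isotropic_on ?R ?U" "isotropic_on ?S ?U"
      using RSe by (auto intro!: seq.isotropic_on_span R S)
    then have "nonneg_on (form_comb x ?R y ?S) ?U" for x y
      by (rule seq.nonneg_on_comb_isotropic)
    ultimately show "\<forall>x y. has_nonneg (coord_space n) k (form_comb x ?R y ?S)"
      unfolding seq.has_nonneg_def by blast
  next
    assume nn: "\<forall>x y. has_nonneg (coord_space n) k (form_comb x ?R y ?S)"
    obtain L where L: "L \<subseteq> coord_space n" "has_dim L k" "isotropic_on ?R L" "isotropic_on ?S L"
      using seq.common_isotropic_subspace[OF E pos_on_mat_form_one has_dim_coord_space R S] nn by metis
    have "pos_on ?E L" using pos_on_mat_form_one L(1) unfolding seq.pos_on_def by blast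
    then obtain e where e: "\<And>i. i < k \<Longrightarrow> e i \<in> L"
      "\<And>i j. i < k \<Longrightarrow> j < k \<Longrightarrow> ?E (e i) (e j) = (if i = j then 1 else 0)"
      using seq.orthonormal_basis[OF E _ L(2)] by metis
    define X where "X = Matrix.mat n k (\<lambda>(i, j). e j i)"
    have "mat_adjoint X * 1\<^sub>m n * X = Matrix.mat k k (\<lambda>(i, j). ?E (e i) (e j))"
      unfolding X_def by (rule adjoint_mult_form) simp
    moreover have "mat_adjoint X * 1\<^sub>m n = mat_adjoint X"
      by (intro right_mult_one_mat[of _ k]) (auto simp: X_def)
    ultimately have X1: "mat_adjoint X * X = 1\<^sub>m k" using e(2) by (auto intro!: eq_matI)
    have "mat_form A (e i) (e j) = (if i = j then Complex a b else 0)" if "i < k" "j < k" for i j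
    proof -
      have "?R (e i) (e j) = 0" "?S (e i) (e j) = 0"
        using L(3,4) e(1)[OF that(1)] e(1)[OF that(2)] unfolding seq.isotropic_on_def by blast+
      then have "mat_form (re_mat A) (e i) (e j) = of_real a * ?E (e i) (e j)"
        "mat_form (im_mat A) (e i) (e j) = of_real b * ?E (e i) (e j)"
        by (simp_all add: seq.form_comb_def)
      then show ?thesis using mat_form_re_im[OF A, of "e i" "e j"] e(2)[OF that]
        by (simp add: Complex_eq)
    qed
    then have "mat_adjoint X * A * X = Complex a b \<cdot>\<^sub>m 1\<^sub>m k"
      using adjoint_mult_form[OF A, of k e] unfolding X_def[symmetric] by (auto intro!: eq_matI)
    then show "Complex a b \<in> rank_numerical_range k A"
      using X1 A unfolding rank_numerical_range_def
      by (intro CollectI bexI[of _ X]) (auto simp: X_def)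
  qed
qed

section \<open>The ordered eigenvalue list in terms of forms\<close>

lemma eigenvalue_list_diagonalization:
  assumes M: "M \<in> carrier_mat n n" and herm: "mat_adjoint M = M"
  obtains e :: "nat \<Rightarrow> nat \<Rightarrow> complex" and l :: "nat \<Rightarrow> real"
  where "\<And>i. i < n \<Longrightarrow> e i \<in> coord_space n"
    "\<And>i j. i < n \<Longrightarrow> j < n \<Longrightarrow> mat_form (1\<^sub>m n) (e i) (e j) = (if i = j then 1 else 0)"
    "\<And>i j. i < n \<Longrightarrow> j < n \<Longrightarrow> mat_form M (e i) (e j) = (if i = j then of_real (l i) else 0)"
    "mset (map l [0..<n]) = mset (eigenvalue_list M)"
proof -
  let ?E = "mat_form (1\<^sub>m n)"
  obtain e :: "nat \<Rightarrow> nat \<Rightarrow> complex" and l :: "nat \<Rightarrow> real"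
    where e: "\<And>i. i < n \<Longrightarrow> e i \<in> coord_space n"
      "\<And>i j. i < n \<Longrightarrow> j < n \<Longrightarrow> ?E (e i) (e j) = (if i = j then 1 else 0)"
      "\<And>i j. i < n \<Longrightarrow> j < n \<Longrightarrow> mat_form M (e i) (e j) = (if i = j then of_real (l i) else 0)"
    by (rule seq.simultaneous_diagonalization[OF hermitian_mat_form_one[of n] pos_on_mat_form_one
        has_dim_coord_space hermitian_mat_form[OF M herm]]) (rule that)
  \<comment> \<open>X is unitary, so M is similar to the diagonal matrix D. The order of the basis
    is arbitrary, which is why only multisets of eigenvalues are compared.\<close>
  define X where "X = Matrix.mat n n (\<lambda>(i, j). e j i)"
  define D where "D = Matrix.mat n n (\<lambda>(i, j). if i = j then complex_of_real (l i) else 0)"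
  have X: "X \<in> carrier_mat n n" "mat_adjoint X \<in> carrier_mat n n" by (auto simp: X_def)
  have D: "D \<in> carrier_mat n n" by (simp add: D_def)
  have "mat_adjoint X * 1\<^sub>m n * X = 1\<^sub>m n"
    unfolding X_def adjoint_mult_form[OF one_carrier_mat] using e(2) by (auto intro!: eq_matI)
  then have XX: "mat_adjoint X * X = 1\<^sub>m n" unfolding right_mult_one_mat[OF X(2)] .
  have XX': "X * mat_adjoint X = 1\<^sub>m n" by (rule mat_mult_left_right_inverse[OF X(2,1) XX])
  have XMX: "mat_adjoint X * M * X = D"
    unfolding X_def adjoint_mult_form[OF M] using e(3) by (auto intro!: eq_matI simp: D_def)
  have MX: "M * X \<in> carrier_mat n n" using M X(1) by simp
  have "X * D = X * (mat_adjoint X * (M * X))"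
    unfolding XMX[symmetric] assoc_mult_mat[OF X(2) M X(1)] ..
  also have "\<dots> = X * mat_adjoint X * (M * X)" by (rule assoc_mult_mat[OF X MX, symmetric])
  also have "\<dots> = M * X" unfolding XX' by (rule left_mult_one_mat[OF MX])
  finally have "X * D * mat_adjoint X = M * (X * mat_adjoint X)"
    using assoc_mult_mat[OF M X] by simp
  then have "M = X * D * mat_adjoint X" unfolding XX' using right_mult_one_mat[OF M] by simp
  then have "similar_mat_wit M D X (mat_adjoint X)" by (rule similar_mat_witI[OF XX' XX _ M D X])
  then have "similar_mat M D" unfolding similar_mat_def by blast
  then have "char_poly M = char_poly D" by (rule char_poly_similar)
  also have "\<dots> = (\<Prod>a\<leftarrow>diag_mat D. [:- a, 1:])"
    by (rule char_poly_upper_triangular[OF D]) (auto simp: D_def)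
  also have "diag_mat D = map complex_of_real (map l [0..<n])"
    unfolding diag_mat_def D_def by (auto intro!: nth_equalityI)
  finally have cp: "char_poly M = (\<Prod>x\<leftarrow>map l [0..<n]. [:- complex_of_real x, 1:])" by (simp add: o_def)
  define fs where "fs = rev (sort (map l [0..<n]))"
  have mfs: "mset fs = mset (map l [0..<n])" by (simp add: fs_def)
  have pl: "(\<Prod>x\<leftarrow>xs. [:- complex_of_real x, 1:]) =
      prod_mset (image_mset (\<lambda>x. [:- complex_of_real x, 1:]) (mset xs))" for xs
    by (metis mset_map prod_mset_prod_list)
  note ev = eigenvalue_list_hermitian[OF M herm]
  have "(\<Prod>x\<leftarrow>eigenvalue_list M. [:- complex_of_real x, 1:]) = (\<Prod>x\<leftarrow>fs. [:- complex_of_real x, 1:])"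
    using ev(2) cp unfolding pl mfs by (rule trans[OF sym])
  moreover have "sorted_wrt (\<ge>) fs" by (simp add: fs_def sorted_wrt_rev)
  ultimately have "eigenvalue_list M = fs" by (intro eigenvalue_list_unique ev(1))
  then have "mset (map l [0..<n]) = mset (eigenvalue_list M)" using mfs by simp
  with e show thesis by (rule that)
qed

text \<open>At least n - k + 1 eigenvectors have an eigenvalue no larger than the k-th, and as many
  have one no smaller than the (n - k + 1)-th. Each family spans a space that meets every
  k-dimensional one.\<close>

lemma not_has_pos_of_eigval:
  assumes M: "M \<in> carrier_mat n n" and herm: "mat_adjoint M = M" and k: "1 \<le> k" "k \<le> n"
  shows "\<not> has_pos (coord_space n) k
      (form_comb 1 (mat_form M) (- eigval k M) (mat_form (1\<^sub>m n)))"
    and "\<not> has_pos (coord_space n) k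
      (form_comb (- 1) (mat_form M) (eigval (n - k + 1) M) (mat_form (1\<^sub>m n)))"
proof -
  let ?E = "mat_form (1\<^sub>m n)"
  obtain e l where e: "\<And>i. i < n \<Longrightarrow> e i \<in> coord_space n"
    "\<And>i j. i < n \<Longrightarrow> j < n \<Longrightarrow> ?E (e i) (e j) = (if i = j then 1 else 0)"
    "\<And>i j. i < n \<Longrightarrow> j < n \<Longrightarrow> mat_form M (e i) (e j) = (if i = j then of_real (l i) else 0)"
    and l: "mset (map l [0..<n]) = mset (eigenvalue_list M)"
    by (rule eigenvalue_list_diagonalization[OF M herm]) (rule that)
  let ?es = "eigenvalue_list M"
  have len: "length ?es = n" and sorted: "sorted_wrt (\<ge>) ?es"
    using eigenvalue_list_hermitian[OF M herm] by auto
  \<comment> \<open>The diagonal entries l are not ordered like the list, so positions are compared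
    by counting.\<close>
  have count: "card {i. i < n \<and> P (l i)} = card {i. i < n \<and> P (?es ! i)}" for P
  proof -
    have "length (filter P (map l [0..<n])) = length (filter P ?es)"
      using l by (metis mset_filter size_mset)
    then show ?thesis unfolding length_filter_conv_card len by (simp cong: conj_cong)
  qed
  have mono: "?es ! j \<le> ?es ! i" if "i \<le> j" "j < n" for i j
    using sorted that len by (cases "i = j") (auto simp: sorted_wrt_iff_nth_less)
  note forms = hermitian_mat_form_one[of n] hermitian_mat_form[OF M herm]
  show "\<not> has_pos (coord_space n) k (form_comb 1 (mat_form M) (- eigval k M) ?E)"
  proof (rule seq.not_has_pos_of_nonpos_diagonal[OF forms(1) seq.hermitian_form_comb[OF forms(2,1)] has_dim_coord_space,
        where I = "{i. i < n \<and> l i \<le> eigval k M}" and e = e and f = "\<lambda>i. l i - eigval k M"])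
    \<comment> \<open>List positions start at 0: these are the n - k + 1 positions from the k-th
      eigenvalue to the last.\<close>
    have "{k - 1..<n} \<subseteq> {i. i < n \<and> ?es ! i \<le> eigval k M}"
      using mono[of "k - 1"] by (auto simp: eigval_def)
    then have "card {k - 1..<n} \<le> card {i. i < n \<and> ?es ! i \<le> eigval k M}"
      by (intro card_mono) auto
    then have "card {k - 1..<n} \<le> card {i. i < n \<and> l i \<le> eigval k M}"
      using count[of "\<lambda>x. x \<le> eigval k M"] by simp
    then show "n < k + card {i. i < n \<and> l i \<le> eigval k M}" using k by simp
  qed (use e in \<open>auto simp: seq.form_comb_def\<close>)
  show "\<not> has_pos (coord_space n) k
      (form_comb (- 1) (mat_form M) (eigval (n - k + 1) M) ?E)"
  proof (rule seq.not_has_pos_of_nonpos_diagonal[OF forms(1) seq.hermitian_form_comb[OF forms(2,1)] has_dim_coord_space,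
        where I = "{i. i < n \<and> l i \<ge> eigval (n - k + 1) M}" and e = e
          and f = "\<lambda>i. eigval (n - k + 1) M - l i"])
    have "{..n - k} \<subseteq> {i. i < n \<and> ?es ! i \<ge> eigval (n - k + 1) M}"
      using mono[of _ "n - k"] k by (auto simp: eigval_def)
    then have "card {..n - k} \<le> card {i. i < n \<and> ?es ! i \<ge> eigval (n - k + 1) M}"
      by (intro card_mono) auto
    then have "card {..n - k} \<le> card {i. i < n \<and> l i \<ge> eigval (n - k + 1) M}"
      using count[of "\<lambda>x. x \<ge> eigval (n - k + 1) M"] by simp
    then show "n < k + card {i. i < n \<and> l i \<ge> eigval (n - k + 1) M}" using k by simp
  qed (use e in \<open>auto simp: seq.form_comb_def\<close>)
qed

lemma mat_form_pencil:
  assumes A: "A \<in> carrier_mat n n"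
  shows "mat_form (complex_of_real t \<cdot>\<^sub>m 1\<^sub>m n + complex_of_real x \<cdot>\<^sub>m re_mat A + complex_of_real y \<cdot>\<^sub>m im_mat A) u v =
    of_real t * mat_form (1\<^sub>m n) u v + of_real x * mat_form (re_mat A) u v + of_real y * mat_form (im_mat A) u v"
  using re_im_mat_carrier[OF A] by (simp add: mat_form_add[of _ n] mat_form_smult)

lemma mem_rank_numerical_range_iff:
  assumes A: "A \<in> carrier_mat n n"
  shows "z \<in> rank_numerical_range k A \<longleftrightarrow>
    (\<forall>x y. has_nonneg (coord_space n) k (form_comb 1
      (form_comb x (mat_form (re_mat A)) y (mat_form (im_mat A))) (- (x * Re z + y * Im z)) (mat_form (1\<^sub>m n))))"
proof -
  let ?E = "mat_form (1\<^sub>m n)" and ?R = "mat_form (re_mat A)" and ?S = "mat_form (im_mat A)"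
  have eq: "has_nonneg (coord_space n) k (form_comb x (form_comb 1 ?R (- Re z) ?E)
                 y (form_comb 1 ?S (- Im z) ?E)) =
      has_nonneg (coord_space n) k (form_comb 1 (form_comb x ?R y ?S) (- (x * Re z + y * Im z)) ?E)" for x y
    by (rule seq.has_nonneg_cong) (simp add: algebra_simps)
  show ?thesis using rank_numerical_range_iff[OF A, of "Re z" "Im z" k] unfolding eq by simp
qed

text \<open>In each direction (x, y) the linear functional at a convex combination is at most its
  value at one of the two points, and that point supplies the nonnegative subspace.\<close>

lemma convex_rank_numerical_range:
  assumes A: "A \<in> carrier_mat n n"
  shows "convex (rank_numerical_range k A)"
  unfolding convex_def
proof (intro ballI allI impI)
  fix z w u v assume z: "z \<in> rank_numerical_range k A" and w: "w \<in> rank_numerical_range k A"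
    and uv: "0 \<le> u" "0 \<le> v" "u + v = (1 :: real)"
  let ?c = "u *\<^sub>R z + v *\<^sub>R w"
  have E: "0 \<le> Re (mat_form (1\<^sub>m n) s s)" for s unfolding mat_form_one_diag by (simp add: sum_nonneg)
  show "?c \<in> rank_numerical_range k A" unfolding mem_rank_numerical_range_iff[OF A]
  proof (intro allI)
    fix x y
    define l where "l p = x * Re p + y * Im p" for p
    have "l ?c = u * l z + v * l w" by (simp add: l_def algebra_simps)
    also have "\<dots> \<le> max (l z) (l w)" by (rule convex_bound_le) (use uv in auto)
    finally obtain p where p: "p \<in> rank_numerical_range k A" "l ?c \<le> l p" using z w by (auto simp: max_def split: if_splits)
    show "has_nonneg (coord_space n) k (form_comb 1
      (form_comb x (mat_form (re_mat A)) y (mat_form (im_mat A))) (- (x * Re ?c + y * Im ?c)) (mat_form (1\<^sub>m n)))"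
    proof (rule seq.has_nonneg_mono)
      show "has_nonneg (coord_space n) k (form_comb 1
        (form_comb x (mat_form (re_mat A)) y (mat_form (im_mat A))) (- l p) (mat_form (1\<^sub>m n)))"
        using p(1) unfolding mem_rank_numerical_range_iff[OF A] l_def by blast
      fix s
      have "l ?c * Re (mat_form (1\<^sub>m n) s s) \<le> l p * Re (mat_form (1\<^sub>m n) s s)"
        by (rule mult_right_mono[OF p(2) E])
      then show "Re (form_comb 1 (form_comb x (mat_form (re_mat A)) y (mat_form (im_mat A))) (- l p) (mat_form (1\<^sub>m n)) s s)
        \<le> Re (form_comb 1 (form_comb x (mat_form (re_mat A)) y (mat_form (im_mat A))) (- (x * Re ?c + y * Im ?c)) (mat_form (1\<^sub>m n)) s s)"
        unfolding l_def[symmetric] seq.Re_form_comb by simp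
    qed
  qed
qed

text \<open>Closed by \<open>has_nonneg_limit\<close>; bounded because the k-th eigenvalues in the
  four coordinate directions bound the real and imaginary parts.\<close>

lemma compact_rank_numerical_range:
  assumes A: "A \<in> carrier_mat n n" and k: "0 < k" "k \<le> n"
  shows "compact (rank_numerical_range k A)"
proof -
  let ?E = "mat_form (1\<^sub>m n)" and ?R = "mat_form (re_mat A)" and ?S = "mat_form (im_mat A)"
  note E = hermitian_mat_form_one[of n] pos_on_mat_form_one[of n] and S = has_dim_coord_space[of n]
    and RS = hermitian_re_im[OF A]
  have "closed (rank_numerical_range k A)" unfolding closed_sequential_limits
  proof (intro allI impI, elim conjE)
    fix z l assume z: "\<forall>m. z m \<in> rank_numerical_range k A" and lim: "z \<longlonglongrightarrow> l"
    show "l \<in> rank_numerical_range k A" unfolding mem_rank_numerical_range_iff[OF A]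
    proof (intro allI)
      fix x y
      show "has_nonneg (coord_space n) k (form_comb 1 (form_comb x ?R y ?S) (- (x * Re l + y * Im l)) ?E)"
      proof (rule seq.has_nonneg_limit[OF RS E(1) S k(2), where \<F> = sequentially])
        show "(\<lambda>m. - (x * Re (z m) + y * Im (z m))) \<longlonglongrightarrow> - (x * Re l + y * Im l)"
          by (intro tendsto_intros lim)
      qed (use z in \<open>auto simp: mem_rank_numerical_range_iff[OF A]\<close>)
    qed
  qed
  moreover have "bounded (rank_numerical_range k A)"
  proof -
    have bound: "\<exists>B. \<forall>z\<in>rank_numerical_range k A. x * Re z + y * Im z \<le> B" for x y
    proof (intro exI ballI)
      fix z assume "z \<in> rank_numerical_range k A"
      then show "x * Re z + y * Im z \<le> kth_eigenvalue (coord_space n) k ?E (form_comb x ?R y ?S)"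
        using seq.has_nonneg_iff_le_kth_eigenvalue[OF E S k seq.hermitian_form_comb[OF RS]]
        unfolding mem_rank_numerical_range_iff[OF A] by blast
    qed
    obtain B1 B2 B3 B4 where "\<forall>z\<in>rank_numerical_range k A. 1 * Re z + 0 * Im z \<le> B1"
      "\<forall>z\<in>rank_numerical_range k A. -1 * Re z + 0 * Im z \<le> B2"
      "\<forall>z\<in>rank_numerical_range k A. 0 * Re z + 1 * Im z \<le> B3"
      "\<forall>z\<in>rank_numerical_range k A. 0 * Re z + -1 * Im z \<le> B4" using bound by metis
    then have "\<forall>z\<in>rank_numerical_range k A. norm z \<le> (\<bar>B1\<bar> + \<bar>B2\<bar>) + (\<bar>B3\<bar> + \<bar>B4\<bar>)"
      by (intro ballI order_trans[OF cmod_le] add_mono) (auto simp: abs_le_iff dest!: bspec)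
    then show ?thesis unfolding bounded_iff by blast
  qed
  ultimately show ?thesis by (simp add: compact_eq_bounded_closed)
qed

subsection \<open>The Kippenhahn polynomial on a line\<close>

lemma comm_ring_hom_eval:
  assumes "comm_ring_hom h"
  shows "comm_ring_hom (\<lambda>p. poly (map_poly h p) a)"
proof -
  interpret comm_ring_hom h by fact
  interpret m: map_poly_comm_ring_hom h ..
  show ?thesis by unfold_locales (auto simp: m.hom_add m.hom_mult)
qed

lemma comm_ring_hom_comp:
  assumes "comm_ring_hom g" "comm_ring_hom h"
  shows "comm_ring_hom (\<lambda>x. g (h x))"
proof -
  interpret g: comm_ring_hom g by fact
  interpret h: comm_ring_hom h by fact
  show ?thesis by unfold_locales (auto simp: g.hom_add h.hom_add g.hom_mult h.hom_mult)
qed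

lemma comm_ring_hom_subst3:
  assumes "comm_ring_hom \<phi>"
  shows "comm_ring_hom (\<lambda>f. subst3 \<phi> f P)"
proof (cases P)
  case (fields t x y)
  show ?thesis unfolding fields subst3_def prod.case
    by (intro comm_ring_hom_eval assms)
qed

lemma hom_eval:
  assumes g: "comm_ring_hom g" and h: "h 0 = 0"
  shows "g (poly (map_poly h p) a) = poly (map_poly (\<lambda>c. g (h c)) p) (g a)"
proof -
  interpret g: comm_ring_hom g by fact
  have "g (poly (map_poly h p) a) = poly (map_poly g (map_poly h p)) (g a)" by simp
  also have "map_poly g (map_poly h p) = map_poly (\<lambda>c. g (h c)) p"
    using h by (simp add: map_poly_map_poly o_def)
  finally show ?thesis .
qed

lemma hom_subst3:
  assumes g: "comm_ring_hom g" and \<phi>: "comm_ring_hom \<phi>"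
  shows "g (subst3 \<phi> f (t, x, y)) = subst3 (\<lambda>c. g (\<phi> c)) f (g t, g x, g y)"
proof -
  interpret \<phi>: comm_ring_hom \<phi> by fact
  show ?thesis unfolding subst3_def prod.case
    by (simp add: hom_eval[OF g])
qed

text \<open>The determinant formula for an arbitrary target ring, since \<open>line_restr\<close>
  substitutes polynomials in r and s. The iterated evaluation is a single ring homomorphism, which
  commutes with \<open>det\<close>.\<close>

lemma subst3_kippenhahn_poly_hom:
  assumes A: "A \<in> carrier_mat n n" and \<psi>: "comm_ring_hom \<psi>"
  shows "subst3 (\<lambda>c. \<psi> (complex_of_real c)) (kippenhahn_poly A) (t, x, y) =
    det (t \<cdot>\<^sub>m 1\<^sub>m n + x \<cdot>\<^sub>m map_mat \<psi> (re_mat A) + y \<cdot>\<^sub>m map_mat \<psi> (im_mat A))"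
proof -
  define h1 where "h1 = (\<lambda>c. poly (map_poly \<psi> c) y)"
  define h2 where "h2 = (\<lambda>g. poly (map_poly h1 g) x)"
  define ev where "ev = (\<lambda>f. poly (map_poly h2 f) t)"
  interpret \<psi>: comm_ring_hom \<psi> by fact
  interpret h1: comm_ring_hom h1 unfolding h1_def by (intro comm_ring_hom_eval \<psi>)
  interpret h2: comm_ring_hom h2 unfolding h2_def by (intro comm_ring_hom_eval h1.comm_ring_hom_axioms)
  interpret ev: comm_ring_hom ev unfolding ev_def by (intro comm_ring_hom_eval h2.comm_ring_hom_axioms)
  have "subst3 (\<lambda>c. \<psi> (complex_of_real c)) (kippenhahn_poly A) (t, x, y) =
        ev (map_poly (map_poly (map_poly complex_of_real)) (kippenhahn_poly A))"
    unfolding subst3_def ev_def h2_def h1_def by (simp add: map_poly_map_poly o_def)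
  also have "\<dots> = ev (kippenhahn_det A)" by (simp only: kippenhahn_poly_complexify[OF A])
  also have "\<dots> = det (t \<cdot>\<^sub>m 1\<^sub>m n + x \<cdot>\<^sub>m map_mat \<psi> (re_mat A) + y \<cdot>\<^sub>m map_mat \<psi> (im_mat A))"
    using A re_im_mat_carrier[OF A] carrier_matD[OF re_im_mat_carrier(1)[OF A]]
      carrier_matD[OF re_im_mat_carrier(2)[OF A]]
    unfolding kippenhahn_det_def Let_def ev.hom_det[symmetric]
    by (intro arg_cong[of _ _ det] eq_matI)
       (auto simp: ev_def h2_def h1_def \<psi>.map_poly_pCons_hom
         h1.map_poly_pCons_hom[unfolded h1_def] h2.map_poly_pCons_hom[unfolded h1_def h2_def])
  finally show ?thesis .
qed

lemma comm_ring_hom_of_real: "comm_ring_hom complex_of_real"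
  by unfold_locales auto

lemma kippenhahn_poly_nonzero:
  assumes A: "A \<in> carrier_mat n n"
  shows "kippenhahn_poly A \<noteq> 0" "subst3 complex_of_real (kippenhahn_poly A) (1, 0, 0) = 1"
proof -
  have "1 \<cdot>\<^sub>m 1\<^sub>m n + 0 \<cdot>\<^sub>m re_mat A + 0 \<cdot>\<^sub>m im_mat A = 1\<^sub>m n"
    using carrier_matD[OF re_im_mat_carrier(1)[OF A]] carrier_matD[OF re_im_mat_carrier(2)[OF A]]
    by (intro eq_matI) auto
  then show *: "subst3 complex_of_real (kippenhahn_poly A) (1, 0, 0) = 1"
    unfolding subst3_kippenhahn_poly[OF A] by simp
  interpret comm_ring_hom "\<lambda>f. subst3 complex_of_real f (1, 0, 0)"
    by (rule comm_ring_hom_subst3[OF comm_ring_hom_of_real])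
  show "kippenhahn_poly A \<noteq> 0" using * by auto
qed

section \<open>The square-free part under substitution\<close>

lemma squarefree_red_dvd:
  assumes "f \<noteq> 0"
  shows "squarefree_red f dvd f"
proof -
  let ?M = "prime_factorization f"
  have "squarefree_red f = prod_mset (mset_set (set_mset ?M))"
    by (simp add: squarefree_red_def prod_unfold_prod_mset)
  also have "\<dots> dvd prod_mset ?M" by (intro prod_mset_subset_imp_dvd mset_set_set_mset_msubset)
  also have "prod_mset ?M dvd f"
    using prod_mset_prime_factorization_weak[OF assms] by (metis dvd_refl normalize_dvd_iff dvd_normalize_iff)
  finally show ?thesis .
qed

lemma dvd_squarefree_red_power:
  assumes "f \<noteq> 0"
  obtains N where "f dvd squarefree_red f ^ N"
proof -
  have "prod_mset M dvd d ^ size M" if "\<And>x. x \<in># M \<Longrightarrow> x dvd d" for M and d :: "real poly poly poly"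
    using that by (induction M) (auto intro: mult_dvd_mono)
  moreover have "x dvd squarefree_red f" if "x \<in># prime_factorization f" for x
    unfolding squarefree_red_def using that by (intro dvd_prodI) auto
  ultimately have "prod_mset (prime_factorization f) dvd squarefree_red f ^ size (prime_factorization f)"
    by blast
  moreover have "f dvd prod_mset (prime_factorization f)"
    using prod_mset_prime_factorization_weak[OF assms] by (metis dvd_refl normalize_dvd_iff dvd_normalize_iff)
  ultimately show thesis using that dvd_trans by blast
qed

text \<open>The square-free part divides f, and f divides a power of it; in an integral domain this
  equates the zeros. The target may be the complex numbers or C[r, s], where it settles vanishing on
  a whole line.\<close>

lemma subst3_squarefree_red_eq_0_iff:
  fixes \<phi> :: "real \<Rightarrow> 'a::idom"
  assumes \<phi>: "comm_ring_hom \<phi>" and f: "f \<noteq> 0"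
  shows "subst3 \<phi> (squarefree_red f) P = 0 \<longleftrightarrow> subst3 \<phi> f P = 0"
proof -
  interpret comm_ring_hom "\<lambda>f. subst3 \<phi> f P" by (rule comm_ring_hom_subst3[OF \<phi>])
  obtain N where "f dvd squarefree_red f ^ N" using dvd_squarefree_red_power[OF f] .
  then have "subst3 \<phi> f P dvd subst3 \<phi> (squarefree_red f) P ^ N" using hom_dvd by (simp add: hom_power[symmetric])
  moreover have "subst3 \<phi> (squarefree_red f) P dvd subst3 \<phi> f P"
    using hom_dvd[OF squarefree_red_dvd[OF f]] by simp
  ultimately show ?thesis by auto
qed

section \<open>Homogeneity of the square-free part on a line\<close>

lemma monom_factor:
  fixes P Q :: "'a::idom poly"
  assumes "P * Q = monom c n" "c \<noteq> 0"
  obtains a j where "P = monom a j"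
proof -
  have "\<exists>a j. P = monom a j" using assms(1)
  proof (induction n arbitrary: P Q)
    case 0
    then have "degree (P * Q) = 0" by (simp add: degree_monom_eq assms(2))
    moreover have "P \<noteq> 0" "Q \<noteq> 0" using 0 assms(2) by auto
    ultimately have "degree P = 0" by (simp add: degree_mult_eq)
    then show ?case by (metis degree_eq_zeroE monom_0)
  next
    case (Suc n)
    have shift: "\<exists>R'. R = pCons 0 R'" if "coeff R 0 = 0" for R :: "'a poly"
      using that by (cases R) auto
    have "coeff P 0 * coeff Q 0 = 0" using arg_cong[OF Suc.prems, of "\<lambda>p. coeff p 0"]
      by (simp add: coeff_mult)
    then consider "coeff P 0 = 0" | "coeff Q 0 = 0" by auto
    then show ?case
    proof cases
      case 1
      then obtain R where R: "P = pCons 0 R" using shift by blast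
      then have "R * Q = monom c n" using Suc.prems by (simp add: monom_Suc)
      then obtain a j where "R = monom a j" using Suc.IH by blast
      then have "P = monom a (Suc j)" by (simp add: R monom_Suc)
      then show ?thesis by blast
    next
      case 2
      then obtain R where "Q = pCons 0 R" using shift by blast
      then have "P * R = monom c n" using Suc.prems by (simp add: monom_Suc)
      then show ?thesis using Suc.IH by blast
    qed
  qed
  then show thesis using that by blast
qed

definition homogeneous2 :: "nat \<Rightarrow> complex poly poly \<Rightarrow> bool" where
  "homogeneous2 m F \<longleftrightarrow> (\<forall>i j. coeff (coeff F i) j \<noteq> 0 \<longrightarrow> i + j = m)"

text \<open>\<open>P(zr, zs)\<close> as a polynomial in \<open>z\<close>.\<close>

definition dilate_s :: "complex poly \<Rightarrow> complex poly poly poly" where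
  "dilate_s c = poly (map_poly (\<lambda>a. [:const_rs a:]) c) [:0, var_s:]"

definition dilate :: "complex poly poly \<Rightarrow> complex poly poly poly" where
  "dilate P = poly (map_poly dilate_s P) [:0, var_r:]"

lemma comm_ring_hom_const_rs: "comm_ring_hom const_rs"
  by unfold_locales (auto simp: const_rs_def)

lemma comm_ring_hom_const: "comm_ring_hom (\<lambda>c :: 'a::comm_ring_1. [:c:])"
  by unfold_locales auto

lemma comm_ring_hom_dilate_s: "comm_ring_hom dilate_s"
  unfolding dilate_s_def
  by (intro comm_ring_hom_eval comm_ring_hom_comp[OF comm_ring_hom_const comm_ring_hom_const_rs])

lemma comm_ring_hom_dilate: "comm_ring_hom dilate"
  unfolding dilate_def by (intro comm_ring_hom_eval comm_ring_hom_dilate_s)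

lemma coeff_linear_mult: "coeff ([:0, w:] * Q) N = (case N of 0 \<Rightarrow> 0 | Suc N' \<Rightarrow> w * coeff Q N')"
  by (cases N) simp_all

lemma coeff_dilate_s:
  "coeff (coeff (coeff (dilate_s c) N) i) l = (if i = 0 \<and> l = N then coeff c l else 0)"
proof (induction c arbitrary: N i l)
  case 0
  then show ?case by (simp add: dilate_s_def)
next
  case (pCons a c)
  interpret comm_ring_hom "\<lambda>a. [:const_rs a:]"
    by (rule comm_ring_hom_comp[OF comm_ring_hom_const comm_ring_hom_const_rs])
  have "dilate_s (pCons a c) = [:const_rs a:] + [:0, var_s:] * dilate_s c"
    by (simp add: dilate_s_def map_poly_pCons_hom)
  then show ?case
    unfolding coeff_add coeff_linear_mult
    by (auto simp: const_rs_def var_s_def coeff_pCons pCons.IH split: nat.splits)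
qed

text \<open>The N-th coefficient is the homogeneous component of degree N, so a polynomial is
  homogeneous exactly when its dilation is that polynomial times a power of z.\<close>

lemma coeff_dilate:
  "coeff (coeff (coeff (dilate P) N) i) l = (if i + l = N then coeff (coeff P i) l else 0)"
proof (induction P arbitrary: N i l)
  case 0
  then show ?case by (simp add: dilate_def)
next
  case (pCons c P)
  interpret comm_ring_hom dilate_s by (rule comm_ring_hom_dilate_s)
  have "dilate (pCons c P) = dilate_s c + [:0, var_r:] * dilate P"
    by (simp add: dilate_def map_poly_pCons_hom)
  then show ?case
    unfolding coeff_add coeff_linear_mult
    by (auto simp: var_r_def coeff_pCons pCons.IH coeff_dilate_s split: nat.splits)
qed

lemma dilate_simps:
  "dilate (const_rs a) = [:const_rs a:]" "dilate var_r = [:0, var_r:]" "dilate var_s = [:0, var_s:]"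
proof -
  interpret s: comm_ring_hom dilate_s by (rule comm_ring_hom_dilate_s)
  interpret c: comm_ring_hom "\<lambda>a. [:const_rs a:]"
    by (rule comm_ring_hom_comp[OF comm_ring_hom_const comm_ring_hom_const_rs])
  have "dilate_s [:a:] = [:const_rs a:]" "dilate_s [:0, 1:] = [:0, var_s:]"
    by (simp_all add: dilate_s_def c.map_poly_pCons_hom)
  then show "dilate (const_rs a) = [:const_rs a:]" "dilate var_s = [:0, var_s:]"
    by (simp_all add: dilate_def const_rs_def var_s_def s.map_poly_pCons_hom)
  show "dilate var_r = [:0, var_r:]"
    by (simp add: dilate_def var_r_def s.map_poly_pCons_hom)
qed

lemma line_restr_eq:
  "line_restr f (q0, q1, q2) (p0, p1, p2) = subst3 (\<lambda>c. const_rs (complex_of_real c)) f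
    (var_r * const_rs q0 + var_s * const_rs p0, var_r * const_rs q1 + var_s * const_rs p1,
     var_r * const_rs q2 + var_s * const_rs p2)"
  by (simp add: line_restr_def lincomb3_def)

lemma comm_ring_hom_const_rs_of_real: "comm_ring_hom (\<lambda>c. const_rs (complex_of_real c))"
  by (rule comm_ring_hom_comp[OF comm_ring_hom_const_rs comm_ring_hom_of_real])

text \<open>All matrix entries are linear in r and s, so dilation multiplies the matrix by z and its
  determinant by \<open>z ^ n\<close>.\<close>

lemma dilate_line_restr_kippenhahn_poly:
  assumes A: "A \<in> carrier_mat n n"
  shows "dilate (line_restr (kippenhahn_poly A) q p) = monom (line_restr (kippenhahn_poly A) q p) n"
proof -
  obtain q0 q1 q2 p0 p1 p2 where qp: "q = (q0, q1, q2)" "p = (p0, p1, p2)"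
    by (cases q, cases p) auto
  define t where "t = var_r * const_rs q0 + var_s * const_rs p0"
  define x where "x = var_r * const_rs q1 + var_s * const_rs p1"
  define y where "y = var_r * const_rs q2 + var_s * const_rs p2"
  define M where "M = t \<cdot>\<^sub>m 1\<^sub>m n + x \<cdot>\<^sub>m map_mat const_rs (re_mat A) + y \<cdot>\<^sub>m map_mat const_rs (im_mat A)"
  note dims = re_im_mat_carrier[OF A] carrier_matD[OF re_im_mat_carrier(1)[OF A]]
    carrier_matD[OF re_im_mat_carrier(2)[OF A]]
  have M: "M \<in> carrier_mat n n" using dims by (simp add: M_def)
  have restr: "line_restr (kippenhahn_poly A) q p = det M"
    unfolding qp line_restr_eq M_def t_def x_def y_def
    by (rule subst3_kippenhahn_poly_hom[OF A comm_ring_hom_const_rs])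
  interpret d: comm_ring_hom dilate by (rule comm_ring_hom_dilate)
  interpret c: comm_ring_hom "\<lambda>c :: complex poly poly. [:c:]" by (rule comm_ring_hom_const)
  have txy: "dilate t = [:0, t:]" "dilate x = [:0, x:]" "dilate y = [:0, y:]"
    by (simp_all add: t_def x_def y_def d.hom_add d.hom_mult dilate_simps mult.commute)
  have "map_mat dilate M = [:0, 1:] \<cdot>\<^sub>m map_mat (\<lambda>c. [:c:]) M"
  proof (rule eq_matI)
    fix i j assume "i < dim_row ([:0, 1:] \<cdot>\<^sub>m map_mat (\<lambda>c. [:c:]) M)"
      "j < dim_col ([:0, 1:] \<cdot>\<^sub>m map_mat (\<lambda>c. [:c:]) M)"
    then have ij: "i < n" "j < n" using M by auto
    have entry: "M $$ (i, j) = (if i = j then t else 0) + x * const_rs (re_mat A $$ (i, j)) +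
        y * const_rs (im_mat A $$ (i, j))"
      using ij dims by (simp add: M_def)
    have "dilate (M $$ (i, j)) = [:0, M $$ (i, j):]"
      unfolding entry by (simp add: d.hom_add d.hom_mult txy dilate_simps mult.commute)
    then show "map_mat dilate M $$ (i, j) = ([:0, 1:] \<cdot>\<^sub>m map_mat (\<lambda>c. [:c:]) M) $$ (i, j)"
      using ij M by simp
  qed (use M in auto)
  then have "dilate (det M) = [:0, 1:] ^ n * [:det M:]"
    using M by (simp add: d.hom_det[symmetric] c.hom_det)
  also have "\<dots> = monom (det M) n" by (simp add: monom_altdef mult.commute)
  finally show ?thesis unfolding restr .
qed

text \<open>A product of normalized prime factors is not visibly homogeneous. But its restriction
  divides that of f, whose dilation is a monomial in z, and factors of monomials are monomials. If f
  vanishes on the line, so does its square-free part, and any degree will do.\<close>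

lemma line_restr_squarefree_red_homogeneous:
  assumes A: "A \<in> carrier_mat n n"
  obtains m where "homogeneous2 m (line_restr (squarefree_red (kippenhahn_poly A)) q p)"
proof -
  let ?f = "kippenhahn_poly A"
  obtain q0 q1 q2 p0 p1 p2 where qp: "q = (q0, q1, q2)" "p = (p0, p1, p2)"
    by (cases q, cases p) auto
  note hom = comm_ring_hom_const_rs_of_real
  show thesis
  proof (cases "line_restr ?f q p = 0")
    case True
    then have "line_restr (squarefree_red ?f) q p = 0"
      unfolding qp line_restr_eq subst3_squarefree_red_eq_0_iff[OF hom kippenhahn_poly_nonzero(1)[OF A]] .
    then show thesis using that[of 0] by (simp add: homogeneous2_def)
  next
    case False
    interpret comm_ring_hom "\<lambda>f. line_restr f q p"
      unfolding qp line_restr_eq by (rule comm_ring_hom_subst3[OF hom])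
    interpret d: comm_ring_hom dilate by (rule comm_ring_hom_dilate)
    let ?F = "line_restr (squarefree_red ?f) q p"
    have "?F dvd line_restr ?f q p" using hom_dvd squarefree_red_dvd[OF kippenhahn_poly_nonzero(1)[OF A]] .
    then obtain h where "line_restr ?f q p = ?F * h" by (rule dvdE)
    then have "dilate ?F * dilate h = monom (line_restr ?f q p) n"
      using dilate_line_restr_kippenhahn_poly[OF A, of q p] by (simp add: d.hom_mult)
    then obtain a m where am: "dilate ?F = monom a m" using monom_factor False by blast
    have "homogeneous2 m ?F" unfolding homogeneous2_def
    proof (intro allI impI)
      fix i l assume nz: "coeff (coeff ?F i) l \<noteq> 0"
      then have "coeff (dilate ?F) (i + l) \<noteq> 0" using coeff_dilate[of ?F "i + l" i l] by auto
      then show "i + l = m" unfolding am by (simp split: if_splits)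
    qed
    then show thesis by (rule that)
  qed
qed

section \<open>Evaluation, multiplicity, and factors of binary forms\<close>

definition eval2 :: "complex \<Rightarrow> complex \<Rightarrow> complex poly poly \<Rightarrow> complex" where
  "eval2 r s F = poly (poly F [:r:]) s"

lemma comm_ring_hom_eval2: "comm_ring_hom (eval2 r s)"
  unfolding eval2_def by (rule comm_ring_hom_comp[OF poly_hom.comm_ring_hom_axioms poly_hom.comm_ring_hom_axioms])

lemma eval2_simps [simp]: "eval2 r s var_r = r" "eval2 r s var_s = s" "eval2 r s (const_rs c) = c"
  by (simp_all add: eval2_def var_r_def var_s_def const_rs_def)

lemma eval2_subst3:
  "eval2 r s (subst3 (\<lambda>c. const_rs (complex_of_real c)) f (t, x, y)) =
    subst3 complex_of_real f (eval2 r s t, eval2 r s x, eval2 r s y)"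
  by (simp add: hom_subst3[OF comm_ring_hom_eval2 comm_ring_hom_const_rs_of_real])

lemma eval2_sum: "eval2 r s F = (\<Sum>i\<le>degree F. poly (coeff F i) s * r ^ i)"
  unfolding eval2_def poly_altdef[of F] by (simp add: poly_sum)

lemma var_r_power: "var_r ^ d = monom 1 d"
  by (simp add: var_r_def monom_altdef)

text \<open>\<open>GREATEST\<close> is attained only for a bounded set. The line towards (1, 0, 0),
  where the square-free part does not vanish, bounds the exponents.\<close>

lemma var_r_power_mult_at_dvd:
  assumes A: "A \<in> carrier_mat n n"
  defines "f \<equiv> squarefree_red (kippenhahn_poly A)"
  shows "var_r ^ mult_at f p dvd line_restr f q p"
proof -
  let ?P = "\<lambda>d. \<forall>q. var_r ^ d dvd line_restr f q p"
  obtain p0 p1 p2 where p: "p = (p0, p1, p2)" by (cases p) auto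
  let ?G = "line_restr f (1, 0, 0) p"
  interpret e: comm_ring_hom "eval2 1 0" by (rule comm_ring_hom_eval2)
  have "eval2 1 0 ?G = subst3 complex_of_real f (1, 0, 0)"
    unfolding p line_restr_eq eval2_subst3 by (simp add: e.hom_add e.hom_mult)
  also have "\<dots> \<noteq> 0"
    unfolding f_def subst3_squarefree_red_eq_0_iff[OF comm_ring_hom_of_real kippenhahn_poly_nonzero(1)[OF A]]
    by (simp add: kippenhahn_poly_nonzero(2)[OF A])
  finally have nz: "?G \<noteq> 0" by auto
  have bound: "d \<le> degree ?G" if "?P d" for d
  proof -
    have "degree (var_r ^ d) \<le> degree ?G" using that nz by (intro dvd_imp_degree_le) auto
    then show ?thesis by (simp add: var_r_power degree_monom_eq)
  qed
  have "?P (GREATEST d. ?P d)" by (rule GreatestI_nat[of ?P 0]) (use bound in auto)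
  then show ?thesis unfolding mult_at_def by blast
qed

lemma coeff_homogeneous2:
  assumes "homogeneous2 m F"
  shows "coeff F i = monom (coeff (coeff F i) (m - i)) (m - i)"
proof (rule poly_eqI)
  fix l
  have "coeff (coeff F i) l = 0" if "l \<noteq> m - i"
    using assms that unfolding homogeneous2_def by (metis add_diff_cancel_left')
  then show "coeff (coeff F i) l = coeff (monom (coeff (coeff F i) (m - i)) (m - i)) l" by auto
qed

lemma var_r_power_Suc_dvd:
  assumes F: "homogeneous2 m F" and d: "var_r ^ d dvd F" and c: "poly (coeff F d) 1 = 0"
  obtains h where "F = var_r ^ (d + 1) * h"
proof -
  have "coeff F d = 0" using c by (subst (asm) coeff_homogeneous2[OF F], subst coeff_homogeneous2[OF F])
    (simp add: poly_monom)
  then have "var_r ^ (d + 1) dvd F"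
    using d unfolding var_r_power monom_1_dvd_iff' by (auto simp: less_Suc_eq)
  then show thesis using that by (auto elim: dvdE)
qed

definition homogenize :: "nat \<Rightarrow> complex poly \<Rightarrow> complex poly poly" where
  "homogenize N k = (\<Sum>j\<le>N. const_rs (coeff k j) * var_s ^ j * var_r ^ (N - j))"

lemma homogenize_eq_monom: "homogenize N k = (\<Sum>j\<le>N. monom (monom (coeff k j) j) (N - j))"
proof -
  have "const_rs c * var_s ^ j = [:monom c j:]" for c j
    by (induction j) (simp_all add: const_rs_def var_s_def monom_0 monom_Suc mult.left_commute[of _ "[:[:0, 1:]:]"])
  then have "const_rs c * var_s ^ j * var_r ^ e = monom (monom c j) e" for c j e
    by (simp add: var_r_power smult_monom)
  then show ?thesis by (simp add: homogenize_def)
qed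

text \<open>\<open>poly F 1\<close> sets r = 1 and so forgets powers of r; together with the degree
  m it still determines F.\<close>

lemma homogenize_dehomogenize:
  assumes F: "homogeneous2 m F"
  shows "F = homogenize m (poly F 1)" and "j \<le> m \<Longrightarrow> coeff (poly F 1) j = coeff (coeff F (m - j)) j"
    and "\<not> j \<le> m \<Longrightarrow> coeff (poly F 1) j = 0"
proof -
  have D: "coeff (poly F 1) j = (\<Sum>i\<le>degree F. coeff (coeff F i) j)" for j
    by (simp add: poly_altdef coeff_sum)
  have zero: "coeff (coeff F i) j = 0" if "i + j \<noteq> m" for i j
    using F that unfolding homogeneous2_def by blast
  have D1: "coeff (poly F 1) j = coeff (coeff F (m - j)) j" if "j \<le> m" for j
  proof -
    have "(\<Sum>i\<le>degree F. coeff (coeff F i) j) = (\<Sum>i\<le>degree F. if i = m - j then coeff (coeff F i) j else 0)"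
      using that by (intro sum.cong refl) (auto simp: zero)
    also have "\<dots> = coeff (coeff F (m - j)) j" by (auto simp: coeff_eq_0)
    finally show ?thesis unfolding D .
  qed
  then show "j \<le> m \<Longrightarrow> coeff (poly F 1) j = coeff (coeff F (m - j)) j" .
  show "\<not> j \<le> m \<Longrightarrow> coeff (poly F 1) j = 0" unfolding D by (intro sum.neutral ballI zero) auto
  show "F = homogenize m (poly F 1)"
  proof (intro poly_eqI)
    fix i l
    have "coeff (coeff (homogenize m (poly F 1)) i) l =
        (\<Sum>j\<le>m. if j = l then (if m - l = i then coeff (poly F 1) l else 0) else 0)"
      unfolding homogenize_eq_monom coeff_sum by (intro sum.cong) auto
    also have "\<dots> = (if l \<le> m \<and> m - l = i then coeff (coeff F i) l else 0)" by (auto simp: D1)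
    also have "\<dots> = coeff (coeff F i) l" using zero[of i l] by auto
    finally show "coeff (coeff F i) l = coeff (coeff (homogenize m (poly F 1)) i) l" by simp
  qed
qed

lemma homogenize_add:
  assumes "degree k \<le> N"
  shows "homogenize (d + N) k = var_r ^ d * homogenize N k"
proof -
  have "homogenize (d + N) k = (\<Sum>j\<le>N. const_rs (coeff k j) * var_s ^ j * var_r ^ (d + N - j))"
    unfolding homogenize_def using assms
    by (intro sum.mono_neutral_right) (auto simp: coeff_eq_0 const_rs_def)
  also have "\<dots> = var_r ^ d * homogenize N k"
    unfolding homogenize_def sum_distrib_left by (intro sum.cong refl) (simp add: power_add[symmetric] mult_ac)
  finally show ?thesis .
qed

lemma homogenize_linear_mult:
  assumes "degree k \<le> N"
  shows "homogenize (Suc N) ([:- c, 1:] * k) = (const_rs (- c) * var_r + const_rs 1 * var_s) * homogenize N k"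
proof -
  interpret comm_ring_hom const_rs by (rule comm_ring_hom_const_rs)
  have "homogenize (Suc N) ([:- c, 1:] * k) =
      (\<Sum>j\<le>Suc N. const_rs (- c) * (const_rs (coeff k j) * var_s ^ j * var_r ^ (Suc N - j)) +
        const_rs (case j of 0 \<Rightarrow> 0 | Suc i \<Rightarrow> coeff k i) * var_s ^ j * var_r ^ (Suc N - j))"
    unfolding homogenize_def
  proof (intro sum.cong refl)
    fix j
    have "coeff ([:- c, 1:] * k) j = - c * coeff k j + (case j of 0 \<Rightarrow> 0 | Suc i \<Rightarrow> coeff k i)"
      by (simp add: coeff_pCons split: nat.splits)
    then show "const_rs (coeff ([:- c, 1:] * k) j) * var_s ^ j * var_r ^ (Suc N - j) =
        const_rs (- c) * (const_rs (coeff k j) * var_s ^ j * var_r ^ (Suc N - j)) +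
        const_rs (case j of 0 \<Rightarrow> 0 | Suc i \<Rightarrow> coeff k i) * var_s ^ j * var_r ^ (Suc N - j)"
      by (simp only: hom_add hom_mult) (simp add: algebra_simps)
  qed
  also have "\<dots> = const_rs (- c) * homogenize (Suc N) k +
      (\<Sum>j\<le>Suc N. const_rs (case j of 0 \<Rightarrow> 0 | Suc i \<Rightarrow> coeff k i) * var_s ^ j * var_r ^ (Suc N - j))"
    by (simp only: sum.distrib homogenize_def sum_distrib_left)
  also have "(\<Sum>j\<le>Suc N. const_rs (case j of 0 \<Rightarrow> 0 | Suc i \<Rightarrow> coeff k i) * var_s ^ j * var_r ^ (Suc N - j))
      = var_s * homogenize N k"
    unfolding sum.atMost_Suc_shift homogenize_def sum_distrib_left by (simp add: mult_ac)
  also have "homogenize (Suc N) k = var_r * homogenize N k"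
    using homogenize_add[OF assms, of 1] by simp
  finally show ?thesis by (simp add: algebra_simps)
qed

text \<open>A double root c of F(1, s) produces the factor \<open>(s - c * r) ^ 2\<close> of F.
  Powers of r are invisible at r = 1, so \<open>r ^ d\<close> splits off independently of
  it.\<close>

lemma linear_form_square_dvd:
  assumes F: "homogeneous2 m F" and d: "var_r ^ d dvd F"
    and root: "poly (poly F 1) c = 0" "poly (pderiv (poly F 1)) c = 0"
  obtains l h where "linear_form l" "F = var_r ^ d * l ^ 2 * h"
proof -
  define l where "l = const_rs (- c) * var_r + const_rs 1 * var_s"
  have l: "linear_form l" unfolding linear_form_def l_def by blast
  let ?D = "poly F 1"
  show thesis
  proof (cases "F = 0")
    case True
    then show thesis using that[OF l, of 0] by simp
  next
    case False
    obtain k1 where k1: "?D = [:- c, 1:] * k1" using root(1) by (auto simp: poly_eq_0_iff_dvd elim: dvdE)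
    have "pderiv ?D = k1 + [:- c, 1:] * pderiv k1"
      unfolding k1 pderiv_mult by (simp add: pderiv_pCons)
    then have "poly k1 c = 0" using root(2) by simp
    then obtain k where k: "k1 = [:- c, 1:] * k" by (auto simp: poly_eq_0_iff_dvd elim: dvdE)
    have F_eq: "F = homogenize m ?D" by (rule homogenize_dehomogenize(1)[OF F])
    have D0: "?D \<noteq> 0"
    proof
      assume "?D = 0"
      then have "F = homogenize m 0" using F_eq by simp
      then show False using False by (simp add: homogenize_def const_rs_def)
    qed
    then have k0: "k \<noteq> 0" using k k1 by auto
    have deg: "degree ([:- c, 1:] * p) = Suc (degree p)" if "p \<noteq> 0" for p
      using that by (subst degree_mult_eq) auto
    have "k1 \<noteq> 0" using D0 k1 by auto
    then have "degree ?D = Suc (degree k1)" unfolding k1 by (rule deg)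
    also have "degree k1 = Suc (degree k)" unfolding k by (rule deg[OF k0])
    finally have degD: "degree ?D = Suc (Suc (degree k))" .
    \<comment> \<open>The leading coefficient of F(1, s) belongs to the power of r with exponent m
      minus its degree. Divisibility by \<open>r ^ d\<close> makes this exponent at least d, which
      leaves room for N = m - d - 2.\<close>
    have "coeff ?D (degree ?D) \<noteq> 0" using D0 by simp
    then have dm: "degree ?D \<le> m" and "coeff F (m - degree ?D) \<noteq> 0"
      using homogenize_dehomogenize(2,3)[OF F, of "degree ?D"] by (cases "degree ?D \<le> m"; force)+
    then have "\<not> m - degree ?D < d" using d unfolding var_r_power monom_1_dvd_iff' by blast
    then obtain N where N: "m = d + Suc (Suc N)" "degree k \<le> N"
      using dm unfolding degD
      by (intro that[of "m - d - 2"]) auto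
    have "F = var_r ^ d * homogenize (Suc (Suc N)) ?D"
      using F_eq homogenize_add[of ?D "Suc (Suc N)" d] N degD by simp
    also have "homogenize (Suc (Suc N)) ?D = l * homogenize (Suc N) k1"
      unfolding k1 l_def using N k0 by (intro homogenize_linear_mult) (simp add: k deg[OF k0] del: mult_pCons_left)
    also have "homogenize (Suc N) k1 = l * homogenize N k"
      unfolding k l_def using N by (intro homogenize_linear_mult) simp
    finally show thesis using that[OF l, of "homogenize N k"] by (simp add: power2_eq_square mult.assoc)
  qed
qed

text \<open>The quotient (F(x, b) - F(y, b)) / (x - y) as a polynomial in b, x and y. It is
  continuous across x = y, where it is the derivative, and takes the place of the implicit function
  theorem.\<close>

definition divided_difference :: "complex poly poly \<Rightarrow> complex \<Rightarrow> complex \<Rightarrow> complex \<Rightarrow> complex" where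
  "divided_difference F b x y = (\<Sum>i\<le>degree F. poly (coeff F i) b * (\<Sum>j<i. x ^ j * y ^ (i - Suc j)))"

lemma divided_difference:
  "eval2 x b F - eval2 y b F = (x - y) * divided_difference F b x y"
proof -
  have "eval2 x b F - eval2 y b F = (\<Sum>i\<le>degree F. poly (coeff F i) b * (x ^ i - y ^ i))"
    unfolding eval2_sum by (simp add: sum_subtractf[symmetric] algebra_simps)
  also have "\<dots> = (\<Sum>i\<le>degree F. poly (coeff F i) b * ((x - y) * (\<Sum>j<i. x ^ j * y ^ (i - Suc j))))"
  proof (intro sum.cong refl)
    fix i
    have "x ^ i - y ^ i = (x - y) * (\<Sum>j<i. y ^ (i - Suc j) * x ^ j)" by (rule power_diff_sumr2)
    then show "poly (coeff F i) b * (x ^ i - y ^ i) =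
        poly (coeff F i) b * ((x - y) * (\<Sum>j<i. x ^ j * y ^ (i - Suc j)))" by (simp add: mult.commute)
  qed
  finally show ?thesis unfolding divided_difference_def by (simp add: sum_distrib_left mult_ac)
qed

lemma divided_difference_diag:
  "divided_difference F b x x = poly (pderiv (map_poly (\<lambda>c. poly c b) F)) x"
proof -
  let ?G = "map_poly (\<lambda>c. poly c b) F"
  have pow: "(\<Sum>j<i. x ^ j * x ^ (i - Suc j)) = of_nat i * x ^ (i - 1)" for i
  proof -
    have "(\<Sum>j<i. x ^ j * x ^ (i - Suc j)) = (\<Sum>j<i. x ^ (i - 1))"
      by (intro sum.cong refl) (simp add: power_add[symmetric])
    then show ?thesis by simp
  qed
  have "?G = (\<Sum>i\<le>degree F. monom (poly (coeff F i) b) i)"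
    by (intro poly_eqI) (auto simp: coeff_map_poly coeff_sum coeff_eq_0)
  then have "pderiv ?G = (\<Sum>i\<le>degree F. monom (of_nat i * poly (coeff F i) b) (i - 1))"
    by (simp add: pderiv_sum pderiv_monom)
  then show ?thesis unfolding divided_difference_def pow
    by (simp add: poly_sum poly_monom mult_ac)
qed

text \<open>At a simple root the zero set of \<open>B\<close> is locally the graph of a function of the second variable, so
  that a continuous branch of roots is injective and has no local minimum there.\<close>

lemma double_root_at_minimum:
  fixes g :: "real \<Rightarrow> real"
  assumes cont: "continuous_on UNIV g" and nonneg: "\<And>x. g x \<ge> 0" and min: "g x0 = 0"
    and zero: "\<And>x. eval2 (of_real x) (of_real (g x)) B = 0"
  shows "poly (pderiv (map_poly (\<lambda>c. poly c 0) B)) (of_real x0) = 0"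
proof (rule ccontr)
  assume nz: "\<not> ?thesis"
  define \<Delta> where "\<Delta> = (\<lambda>(b :: real, x :: real, y :: real). divided_difference B (of_real b) (of_real x) (of_real y))"
  have "continuous_on UNIV \<Delta>"
    unfolding \<Delta>_def divided_difference_def case_prod_beta
    by (intro continuous_intros)
  then have "isCont \<Delta> (0, x0, x0)" by (simp add: continuous_on_eq_continuous_at)
  moreover have "\<Delta> (0, x0, x0) \<noteq> 0" using nz by (simp add: \<Delta>_def divided_difference_diag)
  ultimately obtain \<delta> where \<delta>: "\<delta> > 0" "\<And>z. dist (0, x0, x0) z < \<delta> \<Longrightarrow> \<Delta> z \<noteq> 0"
    using continuous_at_avoid by metis
  \<comment> \<open>If g takes the same value b at x and y, both are roots of B(., b), and a nonzero
    divided difference forces x = y.\<close>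
  have inj: "x = y" if "\<bar>x - x0\<bar> < \<delta> / 3" "\<bar>y - x0\<bar> < \<delta> / 3" "g x < \<delta> / 3" "g x = g y" for x y
  proof -
    have "dist (g x, x, y) (0, x0, x0) \<le> dist (g x) 0 + dist (x, y) (x0, x0)"
      unfolding dist_Pair_Pair by (rule sqrt_sum_squares_le_sum) auto
    also have "dist (x, y) (x0, x0) \<le> dist x x0 + dist y x0"
      unfolding dist_Pair_Pair by (rule sqrt_sum_squares_le_sum) auto
    also have "dist (g x) 0 + (dist x x0 + dist y x0) < \<delta>"
      using that nonneg[of x] by (simp add: dist_real_def)
    finally have "divided_difference B (of_real (g x)) (of_real x) (of_real y) \<noteq> 0"
      using \<delta>(2)[of "(g x, x, y)"] by (simp add: \<Delta>_def dist_commute)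
    moreover have "(complex_of_real x - of_real y) * divided_difference B (of_real (g x)) (of_real x) (of_real y) = 0"
      using divided_difference[of "of_real x" "of_real (g x)" B "of_real y"] zero[of x] zero[of y] that(4) by simp
    ultimately show ?thesis by simp
  qed
  have "isCont g x0" using cont by (simp add: continuous_on_eq_continuous_at)
  then obtain \<eta> where \<eta>: "\<eta> > 0" "\<And>x. \<bar>x - x0\<bar> < \<eta> \<Longrightarrow> g x < \<delta> / 3"
    using \<delta>(1) min nonneg unfolding continuous_at_eps_delta dist_real_def
    by (metis abs_of_nonneg diff_zero zero_less_divide_iff zero_less_numeral)
  define \<rho> where "\<rho> = min (\<delta> / 3) \<eta> / 2"
  have \<rho>: "\<rho> > 0" "\<rho> < \<delta> / 3" "\<rho> < \<eta>" using \<delta>(1) \<eta>(1) by (auto simp: \<rho>_def min_def)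
  \<comment> \<open>By the intermediate value theorem v is attained on both sides of x0. Injectivity
    then gives v = 0, so that g has a second zero at x0 - \<rho> or x0 + \<rho>, again against
    injectivity.\<close>
  define v where "v = min (g (x0 - \<rho>)) (g (x0 + \<rho>))"
  have v: "v \<ge> 0" using nonneg by (simp add: v_def)
  have "continuous_on S g" for S using cont continuous_on_subset by blast
  then obtain x y where x: "x0 - \<rho> \<le> x" "x \<le> x0" "g x = v" and y: "x0 \<le> y" "y \<le> x0 + \<rho>" "g y = v"
    using IVT2'[of g x0 v "x0 - \<rho>"] IVT'[of g x0 v "x0 + \<rho>"] \<rho> v min by (auto simp: v_def)
  have near: "\<bar>x - x0\<bar> < \<delta> / 3" "\<bar>y - x0\<bar> < \<delta> / 3" "\<bar>x - x0\<bar> < \<eta>"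
    using x(1,2) y(1,2) \<rho> by linarith+
  have "x = y" by (rule inj[OF near(1,2) \<eta>(2)[OF near(3)]]) (simp add: x(3) y(3))
  then have "x = x0" using x(2) y(1) by linarith
  then have "v = 0" using x(3) min by simp
  then consider "g (x0 - \<rho>) = 0" | "g (x0 + \<rho>) = 0" unfolding v_def by linarith
  then show False
  proof cases
    case 1
    have "x0 - \<rho> = x0" by (rule inj) (use 1 \<rho> \<delta>(1) min in \<open>simp_all\<close>)
    then show False using \<rho>(1) by simp
  next
    case 2
    have "x0 + \<rho> = x0" by (rule inj) (use 2 \<rho> \<delta>(1) min in \<open>simp_all\<close>)
    then show False using \<rho>(1) by simp
  qed
qed

lemma eval_outer:
  assumes "comm_ring_hom \<phi>"
  shows "map_poly (\<lambda>c. poly c b) (subst3 (\<lambda>c. const_rs (\<phi> c)) f (t, x, y)) =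
    subst3 (\<lambda>c. [:\<phi> c:]) f (map_poly (\<lambda>c. poly c b) t, map_poly (\<lambda>c. poly c b) x, map_poly (\<lambda>c. poly c b) y)"
proof -
  interpret m: map_poly_comm_ring_hom "\<lambda>c :: complex poly. poly c b" ..
  show ?thesis
    by (subst hom_subst3[OF m.comm_ring_hom_axioms comm_ring_hom_comp[OF comm_ring_hom_const_rs assms]])
       (simp add: const_rs_def poly_hom.map_poly_pCons_hom)
qed

text \<open>The determinant scales by \<open>c ^ n\<close>, and the square-free part has the same
  zeros.\<close>

lemma subst3_cone:
  assumes A: "A \<in> carrier_mat n n" and z: "c \<noteq> 0"
    and "subst3 complex_of_real (squarefree_red (kippenhahn_poly A)) (c * t, c * x, c * y) = 0"
  shows "subst3 complex_of_real (squarefree_red (kippenhahn_poly A)) (t, x, y) = 0"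
proof -
  note R = carrier_matD[OF re_im_mat_carrier(1)[OF A]] and I = carrier_matD[OF re_im_mat_carrier(2)[OF A]]
  have "(c * t) \<cdot>\<^sub>m 1\<^sub>m n + (c * x) \<cdot>\<^sub>m re_mat A + (c * y) \<cdot>\<^sub>m im_mat A =
      c \<cdot>\<^sub>m (t \<cdot>\<^sub>m 1\<^sub>m n + x \<cdot>\<^sub>m re_mat A + y \<cdot>\<^sub>m im_mat A)"
    using R I by (intro eq_matI) (auto simp: algebra_simps)
  then have "det ((c * t) \<cdot>\<^sub>m 1\<^sub>m n + (c * x) \<cdot>\<^sub>m re_mat A + (c * y) \<cdot>\<^sub>m im_mat A) =
      c ^ n * det (t \<cdot>\<^sub>m 1\<^sub>m n + x \<cdot>\<^sub>m re_mat A + y \<cdot>\<^sub>m im_mat A)"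
    using R I by simp
  then show ?thesis
    using assms(3) z
    unfolding subst3_squarefree_red_eq_0_iff[OF comm_ring_hom_of_real kippenhahn_poly_nonzero(1)[OF A]]
      subst3_kippenhahn_poly[OF A] by simp
qed

text \<open>The points x p + q - g(x) e, with e = (1, 0, 0), form a branch of the curve next to the
  line. Either it touches the line at the point for a zero of g, or g becomes small only for large
  |x|, where the branch approaches p and the lowest-order part at p decides.\<close>

lemma tangent_of_root_branch:
  fixes g :: "real \<Rightarrow> real"
  assumes A: "A \<in> carrier_mat n n"
  defines "f \<equiv> squarefree_red (kippenhahn_poly A)"
  assumes cont: "continuous_on UNIV g" and nonneg: "\<And>x. g x \<ge> 0" and inf: "\<And>\<epsilon>. \<epsilon> > 0 \<Longrightarrow> \<exists>x. g x < \<epsilon>"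
    and zero: "\<And>x. subst3 complex_of_real f
      (of_real x * p0 + q0 - of_real (g x), of_real x * p1 + q1, of_real x * p2 + q2) = 0"
  defines "F \<equiv> line_restr f (q0, q1, q2) (p0, p1, p2)" and "d \<equiv> mult_at f (p0, p1, p2)"
  shows "(\<exists>l h. linear_form l \<and> F = var_r ^ d * l ^ 2 * h) \<or> (\<exists>h. F = var_r ^ (d + 1) * h)"
proof -
  obtain m where hom: "homogeneous2 m F"
    using line_restr_squarefree_red_homogeneous[OF A] unfolding F_def f_def by blast
  have dvd: "var_r ^ d dvd line_restr f q (p0, p1, p2)" for q
    unfolding d_def f_def by (rule var_r_power_mult_at_dvd[OF A])
  note c = comm_ring_hom_of_real
  interpret e: comm_ring_hom "eval2 r s" for r s by (rule comm_ring_hom_eval2)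
  interpret m: map_poly_comm_ring_hom "\<lambda>c :: complex poly. poly c b" for b ..
  have ev_var: "map_poly (\<lambda>c. poly c b) var_r = [:0, 1:]" "map_poly (\<lambda>c. poly c b) var_s = [:b:]"
    "map_poly (\<lambda>c. poly c b) (const_rs z) = [:z:]" for b :: complex and z
    by (simp_all add: var_r_def var_s_def const_rs_def poly_hom.map_poly_pCons_hom)
  show ?thesis
  proof (cases "\<exists>x0. g x0 = 0")
    case True
    then obtain x0 where x0: "g x0 = 0" by blast
    \<comment> \<open>The outer variable is the position x on the line and the inner one the value g
      x; at inner value 0, B becomes F(1, s).\<close>
    define B where "B = subst3 (\<lambda>c. const_rs (complex_of_real c)) f
      (var_r * const_rs p0 + const_rs q0 - var_s, var_r * const_rs p1 + const_rs q1,
       var_r * const_rs p2 + const_rs q2)"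
    have evB: "eval2 (of_real x) (of_real (g x)) B = 0" for x
      unfolding B_def eval2_subst3 using zero[of x] by (simp add: e.hom_add e.hom_mult e.hom_minus)
    have "poly F 1 = subst3 (\<lambda>c. [:complex_of_real c:]) f
        ([:q0, p0:], [:q1, p1:], [:q2, p2:])"
      unfolding F_def line_restr_eq
      by (subst hom_subst3[OF poly_hom.comm_ring_hom_axioms comm_ring_hom_const_rs_of_real])
         (simp add: const_rs_def var_r_def var_s_def)
    also have "\<dots> = map_poly (\<lambda>c. poly c 0) B"
      unfolding B_def eval_outer[OF c]
      by (simp add: m.hom_add m.hom_mult m.hom_minus ev_var)
    finally have F1: "poly F 1 = map_poly (\<lambda>c. poly c 0) B" .
    have "poly (pderiv (poly F 1)) (of_real x0) = 0"
      unfolding F1 by (rule double_root_at_minimum[OF cont nonneg x0 evB])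
    moreover have "poly (poly F 1) (of_real x0) = 0"
    proof -
      have "poly (map_poly (\<lambda>c. poly c 0) B) z = eval2 z 0 B" for z
        unfolding eval2_sum poly_altdef
        by (intro sum.mono_neutral_cong_left) (auto simp: coeff_map_poly degree_map_poly_le coeff_eq_0 intro: le_degree)
      then show ?thesis using evB[of x0] x0 unfolding F1 by simp
    qed
    ultimately obtain l h where "linear_form l" "F = var_r ^ d * l ^ 2 * h"
      using linear_form_square_dvd[OF hom] dvd[of "(q0, q1, q2)"] unfolding F_def[symmetric] by blast
    then show ?thesis by blast
  next
    case False
    then have pos: "g x > 0" for x using nonneg[of x] by (metis order_le_less)
    \<comment> \<open>On a compact interval g has a positive minimum, so still smaller values occur
      only outside.\<close>
    have far: "\<exists>x. \<bar>x\<bar> > real (Suc i) \<and> g x < 1 / real (Suc i)" for i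
    proof -
      have "\<exists>y\<in>{- real (Suc i)..real (Suc i)}. \<forall>x\<in>{- real (Suc i)..real (Suc i)}. g y \<le> g x"
        by (intro continuous_attains_inf) (auto intro: continuous_on_subset[OF cont])
      then obtain y where y: "\<forall>x\<in>{- real (Suc i)..real (Suc i)}. g y \<le> g x" by blast
      obtain x where x: "g x < min (g y) (1 / real (Suc i))" using inf[of "min (g y) (1 / real (Suc i))"] pos[of y] by auto
      then have "x \<notin> {- real (Suc i)..real (Suc i)}" using y by force
      then have "\<bar>x\<bar> > real (Suc i)" by auto
      then show ?thesis using x by (intro exI[of _ x]) simp
    qed
    then obtain x where x: "\<And>i. \<bar>x i\<bar> > real (Suc i)" "\<And>i. g (x i) < 1 / real (Suc i)" by metis
    define u where "u i = 1 / x i" for i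
    have x0: "x i \<noteq> 0" for i using x(1)[of i] by auto
    have inv: "(\<lambda>i. 1 / real (Suc i)) \<longlonglongrightarrow> 0" by (rule LIMSEQ_Suc) (rule lim_1_over_n)
    have u_lim: "u \<longlonglongrightarrow> 0"
    proof (rule Lim_null_comparison[OF _ inv])
      show "\<forall>\<^sub>F i in sequentially. norm (u i) \<le> 1 / real (Suc i)"
        using x(1) by (intro always_eventually allI) (simp add: u_def frac_le less_imp_le)
    qed
    have g_lim: "(\<lambda>i. g (x i)) \<longlonglongrightarrow> 0"
    proof (rule Lim_null_comparison[OF _ inv])
      show "\<forall>\<^sub>F i in sequentially. norm (g (x i)) \<le> 1 / real (Suc i)"
        using x(2) nonneg by (intro always_eventually allI) (simp add: less_imp_le)
    qed
    \<comment> \<open>After rescaling by u = 1 / x the branch is p + u (q - b e) with b = g x. For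
      fixed b this is a line through p, so the coefficients below \<open>r ^ d\<close> vanish.
      Dividing by \<open>u ^ d\<close> and letting u and b tend to 0 isolates the coefficient of
      \<open>r ^ d\<close> on the line through q.\<close>
    define G where "G = subst3 (\<lambda>c. const_rs (complex_of_real c)) f
      (const_rs p0 + var_r * const_rs q0 - var_r * var_s, const_rs p1 + var_r * const_rs q1,
       const_rs p2 + var_r * const_rs q2)"
    have G_restr: "map_poly (\<lambda>c. poly c b) G = map_poly (\<lambda>c. poly c 1) (line_restr f (q0 - b, q1, q2) (p0, p1, p2))" for b
      unfolding G_def line_restr_eq eval_outer[OF c]
      by (simp add: m.hom_add m.hom_mult m.hom_minus ev_var algebra_simps)
    have coeff_G: "poly (coeff G i) b = poly (coeff (line_restr f (q0 - b, q1, q2) (p0, p1, p2)) i) 1" for i b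
      using arg_cong[OF G_restr[of b], of "\<lambda>P. coeff P i"] by (simp add: coeff_map_poly)
    have low: "poly (coeff G i) b = 0" if "i < d" for i b
      using dvd[of "(q0 - b, q1, q2)"] that unfolding coeff_G var_r_power monom_1_dvd_iff' by simp
    have sum0: "(\<Sum>i\<in>{d..max d (degree G)}. poly (coeff G i) (of_real (g (x j))) * of_real (u j) ^ (i - d)) = 0" for j
    proof -
      let ?b = "complex_of_real (g (x j))" and ?u = "complex_of_real (u j)"
      have u: "?u \<noteq> 0" "?u * of_real (x j) = 1" using x0[of j] by (simp_all add: u_def)
      have cancel: "of_real (x j) * (v + ?u * w - ?u * z) = of_real (x j) * v + w - z" for v w z
      proof -
        have "of_real (x j) * (v + ?u * w - ?u * z) =
            of_real (x j) * v + (?u * of_real (x j)) * w - (?u * of_real (x j)) * z"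
          by (simp only: ring_distribs mult_ac)
        then show ?thesis unfolding u(2) by simp
      qed
      have "subst3 complex_of_real f (p0 + ?u * q0 - ?u * ?b, p1 + ?u * q1, p2 + ?u * q2) = 0"
        unfolding f_def
      proof (rule subst3_cone[OF A, of "of_real (x j)"])
        have "of_real (x j) * (p0 + ?u * q0 - ?u * ?b) = of_real (x j) * p0 + q0 - ?b"
          "of_real (x j) * (p1 + ?u * q1) = of_real (x j) * p1 + q1"
          "of_real (x j) * (p2 + ?u * q2) = of_real (x j) * p2 + q2"
          using cancel[of p0 q0 ?b] cancel[of p1 q1 0] cancel[of p2 q2 0] by simp_all
        then show "subst3 complex_of_real (squarefree_red (kippenhahn_poly A))
            (of_real (x j) * (p0 + ?u * q0 - ?u * ?b), of_real (x j) * (p1 + ?u * q1),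
             of_real (x j) * (p2 + ?u * q2)) = 0"
          using zero[of "x j"] by (simp add: f_def)
      qed (use x0 in simp)
      then have "eval2 ?u ?b G = 0"
        unfolding G_def eval2_subst3 by (simp add: e.hom_add e.hom_mult e.hom_minus)
      then have "(\<Sum>i\<le>max d (degree G). poly (coeff G i) ?b * ?u ^ i) = 0"
        unfolding eval2_sum by (subst (asm) sum.mono_neutral_left[of "{..max d (degree G)}"]) (auto simp: coeff_eq_0)
      also have "(\<Sum>i\<le>max d (degree G). poly (coeff G i) ?b * ?u ^ i) =
          (\<Sum>i\<in>{d..max d (degree G)}. poly (coeff G i) ?b * ?u ^ i)"
        by (intro sum.mono_neutral_right) (auto simp: low)
      also have "\<dots> = ?u ^ d * (\<Sum>i\<in>{d..max d (degree G)}. poly (coeff G i) ?b * ?u ^ (i - d))"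
        unfolding sum_distrib_left by (intro sum.cong refl) (auto simp: power_add[symmetric] mult.left_commute)
      finally show ?thesis using u(1) by simp
    qed
    have "(\<lambda>j. \<Sum>i\<in>{d..max d (degree G)}. poly (coeff G i) (of_real (g (x j))) * of_real (u j) ^ (i - d))
        \<longlonglongrightarrow> (\<Sum>i\<in>{d..max d (degree G)}. poly (coeff G i) (of_real 0) * of_real 0 ^ (i - d))"
      by (intro tendsto_intros u_lim g_lim)
    moreover have "(\<Sum>i\<in>{d..max d (degree G)}. poly (coeff G i) (of_real 0) * of_real 0 ^ (i - d)) = poly (coeff G d) 0"
    proof -
      have "(\<Sum>i\<in>{d..max d (degree G)}. poly (coeff G i) (of_real 0) * of_real 0 ^ (i - d)) =
          (\<Sum>i\<in>{d..max d (degree G)}. if i = d then poly (coeff G d) 0 else 0)"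
        by (intro sum.cong refl) (auto simp: power_0_left)
      then show ?thesis by simp
    qed
    ultimately have "poly (coeff G d) 0 = 0" unfolding sum0 using LIMSEQ_unique tendsto_const by metis
    then have "poly (coeff F d) 1 = 0" unfolding coeff_G by (simp add: F_def)
    then obtain h where "F = var_r ^ (d + 1) * h"
      using var_r_power_Suc_dvd[OF hom, of d] dvd[of "(q0, q1, q2)"] unfolding F_def[symmetric] by blast
    then show ?thesis by blast
  qed
qed

subsection \<open>Extreme points\<close>

text \<open>The last two coordinates of q are perpendicular to (p1, p2), and the first is forced by
  the equation of the line. The sign \<sigma> selects one of the two directions, since a gap in the
  k-th eigenvalue is a one-sided condition.\<close>

lemma dual_line_eq:
  assumes "p1 \<noteq> 0 \<or> p2 \<noteq> (0 :: real)" and on: "p0 + p1 * a + p2 * b = 0" and \<sigma>: "\<sigma> * \<sigma> = 1"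
  shows "dual_line a b = {lincomb3 r (complex_of_real (\<sigma> * (a * p2 - b * p1)), of_real (- \<sigma> * p2), of_real (\<sigma> * p1)) s
      (of_real p0, of_real p1, of_real p2) | r s. True}" (is "_ = ?R")
proof
  have p0: "p0 = - (p1 * a) - p2 * b" using on by linarith
  show "?R \<subseteq> dual_line a b"
    by (auto simp: dual_line_def lincomb3_def p0 algebra_simps)
  define D where "D = p1\<^sup>2 + p2\<^sup>2"
  have D: "complex_of_real D \<noteq> 0" using assms(1) by (simp add: D_def sum_power2_eq_zero_iff del: of_real_add of_real_power)
  have s2: "complex_of_real \<sigma> * complex_of_real \<sigma> = 1" using \<sigma> by (metis of_real_1 of_real_mult)
  show "dual_line a b \<subseteq> ?R"
  proof
    fix P assume "P \<in> dual_line a b"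
    then obtain x y where P: "P = (- (of_real a * x) - of_real b * y, x, y)"
      by (auto simp: dual_line_def) (metis add.commute add_eq_0_iff2 minus_add_distrib uminus_add_conv_diff add.assoc)
    \<comment> \<open>Coordinates of (x, y) in the orthogonal basis consisting of \<sigma> (-p2, p1)
      and (p1, p2).\<close>
    define r where "r = of_real \<sigma> * (of_real p1 * y - of_real p2 * x) / of_real D"
    define s where "s = (of_real p1 * x + of_real p2 * y) / complex_of_real D"
    have \<sigma>r: "of_real \<sigma> * r = (of_real p1 * y - of_real p2 * x) / of_real D"
      unfolding r_def times_divide_eq_right mult.assoc[symmetric] s2 by simp
    have "(of_real p1 * x + of_real p2 * y) * of_real p1 - of_real p2 * (of_real p1 * y - of_real p2 * x) = x * of_real D"
      "(of_real p1 * x + of_real p2 * y) * of_real p2 + of_real p1 * (of_real p1 * y - of_real p2 * x) = y * of_real D"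
      by (simp_all add: D_def power2_eq_square algebra_simps)
    then have x: "s * of_real p1 - of_real p2 * (of_real \<sigma> * r) = x"
      and y: "s * of_real p2 + of_real p1 * (of_real \<sigma> * r) = y"
      using D unfolding \<sigma>r s_def
      by (simp_all only: times_divide_eq_left times_divide_eq_right diff_divide_distrib[symmetric]
          add_divide_distrib[symmetric]) simp_all
    have "lincomb3 r (complex_of_real (\<sigma> * (a * p2 - b * p1)), of_real (- \<sigma> * p2), of_real (\<sigma> * p1)) s
      (of_real p0, of_real p1, of_real p2) =
      (- of_real a * (s * of_real p1 - of_real p2 * (of_real \<sigma> * r)) - of_real b * (s * of_real p2 + of_real p1 * (of_real \<sigma> * r)),
       s * of_real p1 - of_real p2 * (of_real \<sigma> * r), s * of_real p2 + of_real p1 * (of_real \<sigma> * r))"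
      by (simp add: lincomb3_def p0 algebra_simps)
    also have "\<dots> = P" unfolding x y P by simp
    finally show "P \<in> ?R" by blast
  qed
qed

text \<open>H and G are the Hermitian forms at p and q. With g(x) the k-th eigenvalue of G + xH, the
  form G + xH - g(x) E is degenerate, so these points make up a branch as in
  \<open>tangent_of_root_branch\<close>.\<close>

lemma p_tangent_of_vanishing_gap:
  assumes A: "A \<in> carrier_mat n n" and k: "0 < k" "k \<le> n"
    and p: "p1 \<noteq> 0 \<or> p2 \<noteq> 0" and on: "p0 + p1 * a + p2 * b = 0" and \<sigma>: "\<sigma> * \<sigma> = 1"
  defines "E \<equiv> mat_form (1\<^sub>m n)" and "V \<equiv> coord_space n"
  defines "H \<equiv> form_comb 1 (form_comb p1 (mat_form (re_mat A)) p2 (mat_form (im_mat A))) p0 E"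
  defines "G \<equiv> form_comb 1 (form_comb (- \<sigma> * p2) (mat_form (re_mat A)) (\<sigma> * p1) (mat_form (im_mat A)))
      (\<sigma> * (a * p2 - b * p1)) E"
  assumes nn: "\<And>x. has_nonneg V k (form_comb 1 G x H)"
    and gap: "\<And>\<epsilon>. \<epsilon> > 0 \<Longrightarrow> \<exists>x. \<not> has_nonneg V k (form_comb 1 (form_comb 1 G x H) (- \<epsilon>) E)"
  shows "p_tangent A (complex_of_real p0, complex_of_real p1, complex_of_real p2) (dual_line a b)"
proof -
  have EV: "hermitian_form E" "pos_on E V" "has_dim V n"
    unfolding E_def V_def by (rule hermitian_mat_form_one pos_on_mat_form_one has_dim_coord_space)+
  note RS = hermitian_re_im[OF A]
  have HG: "hermitian_form H" "hermitian_form G" using RS EV(1) by (simp_all add: H_def G_def)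
  have HG': "hermitian_form (form_comb 1 G x H)" for x using HG by simp
  define g where "g x = kth_eigenvalue V k E (form_comb 1 G x H)" for x
  have iff: "has_nonneg V k (form_comb 1 (form_comb 1 G x H) (- c) E) \<longleftrightarrow> c \<le> g x" for c x
    unfolding g_def by (rule seq.has_nonneg_iff_le_kth_eigenvalue[OF EV k HG'])
  have cont: "continuous_on UNIV g"
    unfolding g_def by (rule seq.kth_eigenvalue_continuous[OF EV k HG(2,1)])
  have nonneg: "g x \<ge> 0" for x
  proof -
    have "has_nonneg V k (form_comb 1 (form_comb 1 G x H) (- 0) E)"
      by (rule seq.has_nonneg_mono[OF nn[of x]]) simp
    then show ?thesis unfolding iff .
  qed
  have inf: "\<exists>x. g x < \<epsilon>" if "\<epsilon> > 0" for \<epsilon> using gap[OF that] unfolding iff by (simp add: not_le)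
  let ?f = "squarefree_red (kippenhahn_poly A)"
  let ?t = "\<sigma> * (a * p2 - b * p1)"
  let ?p = "(complex_of_real p0, complex_of_real p1, complex_of_real p2)"
  let ?q = "(complex_of_real ?t, complex_of_real (- \<sigma> * p2), complex_of_real (\<sigma> * p1))"
  have zero: "subst3 complex_of_real ?f
      (of_real x * of_real p0 + of_real ?t - of_real (g x), of_real x * of_real p1 + of_real (- \<sigma> * p2),
       of_real x * of_real p2 + of_real (\<sigma> * p1)) = 0" for x
  proof -
    obtain v where v: "v \<in> V" "v \<noteq> 0"
      "\<And>w. w \<in> V \<Longrightarrow> form_comb 1 (form_comb 1 G x H) (- g x) E w v = 0"
      using seq.kth_eigenvalue_degenerate[OF EV k HG'] unfolding g_def by metis
    let ?N = "complex_of_real (x * p0 + ?t - g x) \<cdot>\<^sub>m 1\<^sub>m n + complex_of_real (x * p1 + - \<sigma> * p2) \<cdot>\<^sub>m re_mat A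
      + complex_of_real (x * p2 + \<sigma> * p1) \<cdot>\<^sub>m im_mat A"
    have "mat_form ?N w v = form_comb 1 (form_comb 1 G x H) (- g x) E w v" for w
      unfolding mat_form_pencil[OF A] by (simp add: G_def H_def E_def seq.form_comb_def algebra_simps)
    then have "det ?N = 0"
      using v re_im_mat_carrier[OF A] unfolding V_def by (intro det_eq_0_if_degenerate[of _ n v]) auto
    then show ?thesis
      unfolding subst3_squarefree_red_eq_0_iff[OF comm_ring_hom_of_real kippenhahn_poly_nonzero(1)[OF A]]
        subst3_kippenhahn_poly[OF A] by simp
  qed
  have "\<nexists>c. ?q = lincomb3 0 ?p c ?p"
  proof
    assume "\<exists>c. ?q = lincomb3 0 ?p c ?p"
    then obtain c where c: "complex_of_real (- \<sigma> * p2) = c * of_real p1" "complex_of_real (\<sigma> * p1) = c * of_real p2"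
      by (auto simp: lincomb3_def)
    have "complex_of_real (\<sigma> * (p1\<^sup>2 + p2\<^sup>2)) =
        complex_of_real (\<sigma> * p1) * of_real p1 - complex_of_real (- \<sigma> * p2) * of_real p2"
      by (simp add: power2_eq_square algebra_simps)
    also have "\<dots> = 0" unfolding c by simp
    finally have "\<sigma> * (p1\<^sup>2 + p2\<^sup>2) = 0" by (simp only: of_real_eq_0_iff)
    then show False using p \<sigma> by (auto simp: sum_power2_eq_zero_iff)
  qed
  moreover have "dual_line a b = {lincomb3 r ?q s ?p | r s. True}" by (rule dual_line_eq[OF p on \<sigma>])
  ultimately show ?thesis
    unfolding p_tangent_def Let_def
    using tangent_of_root_branch[OF A cont nonneg inf zero] by blast
qed

text \<open>If the line is not p-tangent, the k-th eigenvalue keeps a uniform distance from 0 for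
  both directions q and -q. Then z can be moved both ways along the line dual to p without leaving
  the range, so it is not extreme.\<close>

lemma extreme_point_p_tangent:
  assumes A: "A \<in> carrier_mat n n" and k: "0 < k" "k \<le> n"
    and nz: "(p0, p1, p2) \<noteq> (0, 0, 0)" and extreme: "z extreme_point_of rank_numerical_range k A"
    and eig: "- p0 = pencil_eigval A k p1 p2" "- p0 = pencil_eigval A (n - k + 1) p1 p2"
  shows "p_tangent A (complex_of_real p0, complex_of_real p1, complex_of_real p2) (dual_line (Re z) (Im z))"
proof (rule ccontr)
  assume not_tangent: "\<not> ?thesis"
  define E where "E = mat_form (1\<^sub>m n)"
  define R where "R = mat_form (re_mat A)"
  define S where "S = mat_form (im_mat A)"
  define V where "V = coord_space n"
  define a where "a = Re z"
  define b where "b = Im z"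
  have E: "hermitian_form E" "pos_on E V" "has_dim V n"
    unfolding E_def V_def by (rule hermitian_mat_form_one pos_on_mat_form_one has_dim_coord_space)+
  have RS: "hermitian_form R" "hermitian_form S"
    unfolding R_def S_def by (rule hermitian_re_im[OF A])+
  have mem: "w \<in> rank_numerical_range k A \<longleftrightarrow>
    (\<forall>x y. has_nonneg V k (form_comb 1 (form_comb x R y S) (- (x * Re w + y * Im w)) E))" for w
    unfolding E_def R_def S_def V_def by (rule mem_rank_numerical_range_iff[OF A])
  have z: "z \<in> rank_numerical_range k A" using extreme by (simp add: extreme_point_of_def)
  define H where "H = form_comb 1 (form_comb p1 R p2 S) p0 E"
  define M where "M = complex_of_real p1 \<cdot>\<^sub>m re_mat A + complex_of_real p2 \<cdot>\<^sub>m im_mat A"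
  have M: "M \<in> carrier_mat n n" "mat_adjoint M = M"
    unfolding M_def by (rule pencil_hermitian[OF A])+
  have formM: "mat_form M u v = form_comb p1 R p2 S u v" for u v
    using re_im_mat_carrier[OF A]
    by (simp add: M_def R_def S_def seq.form_comb_def mat_form_add[of _ n] mat_form_smult)
  have eigM: "eigval k M = - p0" "eigval (n - k + 1) M = - p0"
    using eig by (simp_all add: pencil_eigval_def M_def)
  have tight: "\<not> has_pos V k H" "\<not> has_pos V k (form_comb (- 1) H 0 H)"
  proof -
    have "has_pos V k H = has_pos V k (form_comb 1 (mat_form M) (- eigval k M) E)"
      by (rule seq.has_pos_cong) (simp add: H_def formM eigM)
    moreover have "has_pos V k (form_comb (- 1) H 0 H) =
        has_pos V k (form_comb (- 1) (mat_form M) (eigval (n - k + 1) M) E)"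
      unfolding eigM by (rule seq.has_pos_cong) (simp add: H_def formM)
    ultimately show "\<not> has_pos V k H" "\<not> has_pos V k (form_comb (- 1) H 0 H)"
      using not_has_pos_of_eigval[OF M _ k(2)] k(1) unfolding E_def V_def by simp_all
  qed
  have no_gap: False if U: "U \<subseteq> V" "has_dim U k" and c: "c > 0"
    and ge: "(\<forall>u\<in>U. c * Re (E u u) \<le> Re (H u u)) \<or> (\<forall>u\<in>U. c * Re (E u u) \<le> - Re (H u u))" for U c
  proof -
    have "0 < c * Re (E u u)" if "u \<in> U" "u \<noteq> 0" for u
      using E(2) that U(1) c unfolding seq.pos_on_def by (intro mult_pos_pos) auto
    then have "pos_on H U \<or> pos_on (form_comb (- 1) H 0 H) U"
      using ge unfolding seq.pos_on_def by fastforce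
    then show False using tight U unfolding seq.has_pos_def by blast
  qed
  have p: "p1 \<noteq> 0 \<or> p2 \<noteq> 0"
  proof (rule ccontr)
    assume "\<not> ?thesis"
    then have p12: "p1 = 0" "p2 = 0" by auto
    then have "p0 \<noteq> 0" using nz by simp
    have "Re (H u u) = p0 * Re (E u u)" for u by (simp add: H_def p12)
    moreover obtain U where "U \<subseteq> V" "has_dim U k" using seq.has_dim_smaller[OF E(3) k(2)] .
    ultimately show False using no_gap[of U "\<bar>p0\<bar>"] \<open>p0 \<noteq> 0\<close> by (cases "p0 > 0") auto
  qed
  \<comment> \<open>With c the value of the linear form at z, membership in the directions (p1, p2)
    and -(p1, p2) yields k-dimensional subspaces on which H is at least cE and at most cE,
    respectively. Tightness excludes both signs of c.\<close>
  have on: "p0 + p1 * a + p2 * b = 0"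
  proof (rule ccontr)
    define c where "c = p0 + p1 * a + p2 * b"
    assume "p0 + p1 * a + p2 * b \<noteq> 0"
    then consider "c > 0" | "c < 0" unfolding c_def by linarith
    then show False
    proof cases
      case 1
      obtain U where U: "U \<subseteq> V" "has_dim U k"
        "nonneg_on (form_comb 1 (form_comb p1 R p2 S) (- (p1 * Re z + p2 * Im z)) E) U"
        using z unfolding mem seq.has_nonneg_def by blast
      have "\<forall>u\<in>U. c * Re (E u u) \<le> Re (H u u)"
        using U(3) unfolding seq.nonneg_on_def by (force simp: H_def c_def a_def b_def algebra_simps)
      then show False using no_gap[OF U(1,2) 1] by blast
    next
      case 2
      obtain U where U: "U \<subseteq> V" "has_dim U k"
        "nonneg_on (form_comb 1 (form_comb (- p1) R (- p2) S) (- (- p1 * Re z + - p2 * Im z)) E) U"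
        using z unfolding mem seq.has_nonneg_def by blast
      have "\<forall>u\<in>U. (- c) * Re (E u u) \<le> - Re (H u u)"
        using U(3) unfolding seq.nonneg_on_def by (force simp: H_def c_def a_def b_def algebra_simps)
      moreover have "- c > 0" using 2 by simp
      ultimately show False using no_gap[OF U(1,2)] by blast
    qed
  qed
  define G where "G \<sigma> = form_comb 1 (form_comb (- \<sigma> * p2) R (\<sigma> * p1) S) (\<sigma> * (a * p2 - b * p1)) E" for \<sigma>
  have gap: "\<exists>\<epsilon>>0. \<forall>x. has_nonneg V k (form_comb 1 (form_comb 1 (G \<sigma>) x H) (- \<epsilon>) E)"
    if \<sigma>: "\<sigma> * \<sigma> = 1" for \<sigma>
  proof (rule ccontr)
    assume "\<not> ?thesis"
    then have "\<exists>x. \<not> has_nonneg V k (form_comb 1 (form_comb 1 (G \<sigma>) x H) (- \<epsilon>) E)" if "\<epsilon> > 0" for \<epsilon>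
      using that by blast
    moreover have "has_nonneg V k (form_comb 1 (G \<sigma>) x H)" for x
    proof -
      have p0: "p0 = - (p1 * a) - p2 * b" using on by linarith
      have "has_nonneg V k (form_comb 1 (form_comb (x * p1 - \<sigma> * p2) R (x * p2 + \<sigma> * p1) S)
          (- ((x * p1 - \<sigma> * p2) * Re z + (x * p2 + \<sigma> * p1) * Im z)) E)"
        using z unfolding mem by blast
      then show ?thesis
        by (rule seq.has_nonneg_mono) (simp add: G_def H_def p0 a_def b_def algebra_simps)
    qed
    ultimately have "p_tangent A (complex_of_real p0, complex_of_real p1, complex_of_real p2) (dual_line a b)"
      unfolding G_def H_def E_def R_def S_def V_def
      by (intro p_tangent_of_vanishing_gap[OF A k p on \<sigma>])
    then show False using not_tangent by (simp add: a_def b_def)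
  qed
  obtain \<epsilon>1 where e1: "\<epsilon>1 > 0" "\<And>x. has_nonneg V k (form_comb 1 (form_comb 1 (G 1) x H) (- \<epsilon>1) E)"
    using gap[of 1] by auto
  obtain \<epsilon>2 where e2: "\<epsilon>2 > 0" "\<And>x. has_nonneg V k (form_comb 1 (form_comb 1 (G (- 1)) x H) (- \<epsilon>2) E)"
    using gap[of "- 1"] by auto
  have EV0: "0 \<le> Re (E u u)" for u unfolding E_def mat_form_one_diag by (simp add: sum_nonneg)
  define \<epsilon> where "\<epsilon> = min \<epsilon>1 \<epsilon>2"
  have \<epsilon>: "\<epsilon> > 0" using e1(1) e2(1) by (simp add: \<epsilon>_def)
  have e: "has_nonneg V k (form_comb 1 (form_comb 1 (G \<sigma>) x H) (- \<epsilon>) E)" if "\<sigma> = 1 \<or> \<sigma> = - 1" for \<sigma> x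
    using that
  proof
    assume "\<sigma> = 1"
    then show ?thesis using EV0 by (intro seq.has_nonneg_mono[OF e1(2)[of x]]) (auto simp: \<epsilon>_def intro: mult_right_mono)
  next
    assume "\<sigma> = - 1"
    then show ?thesis using EV0 by (intro seq.has_nonneg_mono[OF e2(2)[of x]]) (auto simp: \<epsilon>_def intro: mult_right_mono)
  qed
  define D where "D = p1\<^sup>2 + p2\<^sup>2"
  have D: "D > 0" using p by (simp add: D_def sum_power2_gt_zero_iff)
  \<comment> \<open>Moving z by t times (-p2, p1) changes the form G by tD E, so \<epsilon> / D is
    the step that the gap allows.\<close>
  define s where "s = \<epsilon> / D"
  have s: "s > 0" "s * D = \<epsilon>" using \<epsilon> D by (simp_all add: s_def)
  define w where "w t = Complex (a - t * p2) (b + t * p1)" for t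
  have near: "w t \<in> rank_numerical_range k A" if t: "\<bar>t\<bar> \<le> s" for t
    unfolding mem
  proof (intro allI)
    fix x y
    \<comment> \<open>With (x, y) = \<alpha> (p1, p2) + \<beta> (-p2, p1), the form to be tested at
      \<open>w t\<close> becomes \<alpha> H + \<beta> (G - tD E), where G is taken for \<sigma> =
      1.\<close>
    define \<alpha> where "\<alpha> = (x * p1 + y * p2) / D"
    define \<beta> where "\<beta> = (y * p1 - x * p2) / D"
    have xD: "x * D = (\<alpha> * p1 - \<beta> * p2) * D" and yD: "y * D = (\<alpha> * p2 + \<beta> * p1) * D"
    proof -
      have \<alpha>D: "\<alpha> * D = x * p1 + y * p2" and \<beta>D: "\<beta> * D = y * p1 - x * p2" using D by (simp_all add: \<alpha>_def \<beta>_def)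
      have "(\<alpha> * p1 - \<beta> * p2) * D = (\<alpha> * D) * p1 - (\<beta> * D) * p2" by (simp add: algebra_simps)
      then show "x * D = (\<alpha> * p1 - \<beta> * p2) * D" unfolding \<alpha>D \<beta>D by (simp add: D_def power2_eq_square algebra_simps)
      have "(\<alpha> * p2 + \<beta> * p1) * D = (\<alpha> * D) * p2 + (\<beta> * D) * p1" by (simp add: algebra_simps)
      then show "y * D = (\<alpha> * p2 + \<beta> * p1) * D" unfolding \<alpha>D \<beta>D by (simp add: D_def power2_eq_square algebra_simps)
    qed
    have x: "x = \<alpha> * p1 - \<beta> * p2" and y: "y = \<alpha> * p2 + \<beta> * p1" using xD yD D by simp_all
    have p0: "p0 = - (p1 * a) - p2 * b" using on by linarith
    let ?F = "form_comb 1 (form_comb x R y S) (- (x * Re (w t) + y * Im (w t))) E"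
    have F: "Re (?F u u) = \<alpha> * Re (H u u) + \<beta> * (Re (G 1 u u) - t * D * Re (E u u))" for u
      by (simp add: x y w_def G_def H_def p0 D_def power2_eq_square algebra_simps)
    have G: "Re (G \<sigma> u u) = \<sigma> * Re (G 1 u u)" for \<sigma> u by (simp add: G_def algebra_simps)
    show "has_nonneg V k ?F"
    proof (cases "\<beta> = 0")
      \<comment> \<open>Here the tested form is \<alpha> H whatever t is, so membership of z
        suffices.\<close>
      case True
      have "has_nonneg V k (form_comb 1 (form_comb x R y S) (- (x * Re z + y * Im z)) E)"
        using z unfolding mem by blast
      then show ?thesis
      proof (rule seq.has_nonneg_mono)
        fix u
        have "Re (form_comb 1 (form_comb x R y S) (- (x * Re z + y * Im z)) E u u) = \<alpha> * Re (H u u)"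
          by (simp add: x y True H_def p0 a_def b_def algebra_simps)
        then show "Re (form_comb 1 (form_comb x R y S) (- (x * Re z + y * Im z)) E u u) \<le> Re (?F u u)"
          unfolding F True by simp
      qed
    next
      case False
      define \<sigma> where "\<sigma> = sgn \<beta>"
      have \<sigma>: "\<sigma> = 1 \<or> \<sigma> = - 1" "\<bar>\<beta>\<bar> * \<sigma> = \<beta>" and \<beta>: "\<bar>\<beta>\<bar> > 0"
        using False by (auto simp: \<sigma>_def sgn_if)
      \<comment> \<open>The gap for the direction \<sigma> = sgn \<beta>, multiplied by |\<beta>|;
        the displacement t uses up at most the amount \<epsilon>.\<close>
      let ?K = "form_comb \<bar>\<beta>\<bar> (form_comb 1 (form_comb 1 (G \<sigma>) (\<alpha> / \<bar>\<beta>\<bar>) H) (- \<epsilon>) E) 0 E"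
      have "has_nonneg V k ?K = has_nonneg V k (form_comb 1 (form_comb 1 (G \<sigma>) (\<alpha> / \<bar>\<beta>\<bar>) H) (- \<epsilon>) E)"
        by (rule seq.has_nonneg_scale[OF \<beta>]) simp
      then have "has_nonneg V k ?K" using e[OF \<sigma>(1)] by simp
      then show ?thesis
      proof (rule seq.has_nonneg_mono)
        fix u
        have "\<beta> * t \<le> \<bar>\<beta>\<bar> * s" using t s(1) by (metis abs_ge_self abs_ge_zero abs_mult mult_left_mono order_trans)
        then have "\<beta> * t * (D * Re (E u u)) \<le> \<bar>\<beta>\<bar> * s * (D * Re (E u u))"
          using D EV0 by (intro mult_right_mono) auto
        then have "\<beta> * (t * D * Re (E u u)) \<le> \<bar>\<beta>\<bar> * (\<epsilon> * Re (E u u))" unfolding s(2)[symmetric] by (simp add: mult_ac)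
        moreover have "Re (?K u u) = (\<bar>\<beta>\<bar> * \<sigma>) * Re (G 1 u u) + \<alpha> * Re (H u u) - \<bar>\<beta>\<bar> * (\<epsilon> * Re (E u u))"
          using \<beta> G[of \<sigma>] by (simp add: algebra_simps)
        ultimately show "Re (?K u u) \<le> Re (?F u u)" unfolding F \<sigma>(2) by (simp add: algebra_simps)
      qed
    qed
  qed
  have "z = midpoint (w s) (w (- s))"
    by (simp add: midpoint_def w_def a_def b_def complex_eq_iff)
  moreover have "w s \<noteq> w (- s)" using p s(1) by (auto simp: w_def complex_eq_iff)
  ultimately have "z \<in> open_segment (w s) (w (- s))" by (metis midpoint_in_open_segment)
  then show False
    using extreme near[of s] near[of "- s"] s(1) unfolding extreme_point_of_def by auto
qed

theorem theorem6p8: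
  fixes A :: "complex mat" and n k :: nat and p0 p1 p2 :: real
  defines "p \<equiv> (complex_of_real p0, complex_of_real p1, complex_of_real p2)"
  assumes "A \<in> carrier_mat n n"
    and "1 \<le> k" and "real k < (real n + 1) / 2"
    and "(p0, p1, p2) \<noteq> (0, 0, 0)"
    and "p \<in> kippenhahn_curve A"
    and "- p0 = pencil_eigval A k p1 p2"
    and "- p0 = pencil_eigval A (n - k + 1) p1 p2"
  shows "rank_numerical_range k A =
    convex hull {Complex a b | a b. Complex a b \<in> rank_numerical_range k A \<and>
                                    p_tangent A p (dual_line a b)}"
proof -
  let ?\<Lambda> = "rank_numerical_range k A"
  have A: "A \<in> carrier_mat n n" by fact
  have k: "0 < k" "k \<le> n" using assms(3,4) by auto
  let ?T = "{Complex a b | a b. Complex a b \<in> ?\<Lambda> \<and> p_tangent A p (dual_line a b)}"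
  \<comment> \<open>Minkowski's theorem for compact convex sets, which also covers an empty
    range.\<close>
  have "?\<Lambda> = convex hull {z. z extreme_point_of ?\<Lambda>}"
    by (intro Krein_Milman_Minkowski compact_rank_numerical_range[OF A k] convex_rank_numerical_range[OF A])
  also have "\<dots> \<subseteq> convex hull ?T"
  proof (intro hull_mono subsetI CollectI)
    fix z assume "z \<in> {z. z extreme_point_of ?\<Lambda>}"
    then have "z extreme_point_of ?\<Lambda>" "z \<in> ?\<Lambda>" by (auto simp: extreme_point_of_def)
    then show "\<exists>a b. z = Complex a b \<and> Complex a b \<in> ?\<Lambda> \<and> p_tangent A p (dual_line a b)"
      using extreme_point_p_tangent[OF A k _ _ assms(7,8), of z] assms(5) unfolding p_def
      by (intro exI[of _ "Re z"] exI[of _ "Im z"]) auto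
  qed
  finally have "?\<Lambda> \<subseteq> convex hull ?T" .
  moreover have "convex hull ?T \<subseteq> ?\<Lambda>"
    by (intro hull_minimal convex_rank_numerical_range[OF A]) auto
  ultimately show ?thesis by (rule subset_antisym)
qed

end
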